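(* There exists a surjective $\mathbb{Q}$-algebra homomorphism $\pi:\mathcal{G}^f\to\mathcal{Z}^f$ with $\pi(G^f(k_1,\dots,k_r))=\zeta^f(k_1,\dots,k_r)$ for all $r\ge 1$ and $k_1,\dots,k_r\geq 1$. The kernel of $\pi$ is the ideal of $\mathcal{G}^f$ generated by all formal multiple Eisenstein series $G^f(w)$, where $w$ runs over the words in $\mathcal A$ which are not of the form $\left[{1,\dots,1,k_1,\dots,k_r\atop d_1,\dots,d_s,0,\dots,0}\right]$ ($s$ entries equal to $1$ followed by $k_1,\dots,k_r$ in the upper row; $d_1,\dots,d_s$ followed by $r$ zeros in the lower row) for some $r,s\geq 0$, $k_1,\dots,k_r\geq 1$, $d_1,\dots,d_s\geq 0$.
   Context: Formal multiple Eisenstein series. Let $\mathcal A=\{\left[{k\atop d}\right] : k\ge1,\ d\ge0\}$ be a set of letters indexed by pairs of integers, and let $\mathbb Q\langle\mathcal A\rangle$ be the free noncommutative $\mathbb Q$-algebra on $\mathcal A$. Its monic monomials are called words, $1$ is the empty word, and $\left[{k_1,\dots,k_r\atop d_1,\dots,d_r}\right]:=\left[{k_1\atop d_1}\right]\cdots\left[{k_r\atop d_r}\right]$. The stuffle product $*$ on $\mathbb Q\langle\mathcal A\rangle$ is the $\mathbb Q$-bilinear product with $1*w=w*1=w$ for words $w$ and $$\left[{k_1\atop d_1}\right]w*\left[{k_2\atop d_2}\right]v=\left[{k_1\atop d_1}\right]\Big(w*\left[{k_2\atop d_2}\right]v\Big)+\left[{k_2\atop d_2}\right]\Big(\left[{k_1\atop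 d_1}\right]w*v\Big)+\left[{k_1+k_2\atop d_1+d_2}\right](w*v)$$ for letters and words $w,v$; it makes $\mathbb Q\langle\mathcal A\rangle$ a commutative $\mathbb Q$-algebra. For $r\ge1$ put $$\mathfrak A_r\left({X_1,\dots,X_r\atop Y_1,\dots,Y_r}\right)=\sum_{k_i\ge1,\,d_i\ge0}\left[{k_1,\dots,k_r\atop d_1,\dots,d_r}\right]X_1^{k_1-1}\cdots X_r^{k_r-1}\frac{Y_1^{d_1}}{d_1!}\cdots\frac{Y_r^{d_r}}{d_r!}.$$ The swap $\sigma:\mathbb Q\langle\mathcal A\rangle\to\mathbb Q\langle\mathcal A\rangle$ is the $\mathbb Q$-linear map with $\sigma(1)=1$ such that $\sigma\left[{k_1,\dots,k_r\atop d_1,\dots,d_r}\right]$ is the coefficient of $X_1^{k_1-1}\cdots X_r^{k_r-1}\frac{Y_1^{d_1}}{d_1!}\cdots\frac{Y_r^{d_r}}{d_r!}$ in $\mathfrak A_r\left({Y_1+\dots+Y_r,\ \dots,\ Y_1+Y_2,\ Y_1\atop X_r,\ X_{r-1}-X_r,\ \dots,\ X_1-X_2}\right)$. The algebra of formal multiple Eisenstein series is $\mathcal G^f=(\mathbb Q\langle\mathcal A\rangle,* )/\mathcal I$, where $\mathcal I$ is the ideal of $(\mathbb Q\langle\mathcal A\rangle,* )$ generated by all $\sigma(w)-w$, $w\in\mathbb Q\langle\mathcal A\rangle$. The class of a word $w$ is denoted $G^f(w)$, and $G^f(k_1,\dots,k_r):=G^f\left(\left[{k_1,\dots,k_r\atop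 0,\dots,0}\right]\right)$. Formal multiple zeta values. Let $\mathfrak H^1=\mathbb Q\langle z_k: k\ge1\rangle$ be the free noncommutative polynomial algebra, with stuffle product $*$ defined by $1*w=w*1=w$ and $z_iw*z_jv=z_i(w*z_jv)+z_j(z_iw*v)+z_{i+j}(w*v)$. Let $\mathfrak H^0\subset\mathfrak H^1$ be the span of the words (including the empty word) not starting in $z_1$. Via $z_k=x^{k-1}y$ regard $\mathfrak H^1=\mathbb Q+\mathbb Q\langle x,y\rangle y$ as a subspace of $\mathbb Q\langle x,y\rangle$; it is closed under the usual shuffle product $ш$ of words in the two letters $x,y$. The algebra of formal multiple zeta values is $\mathcal Z^f=(\mathfrak H^1,* )/\mathfrak E$, where $\mathfrak E$ is the ideal of $(\mathfrak H^1,* )$ generated by all $w*v-w\,ш\,v$ with $w\in\mathfrak H^1$, $v\in\mathfrak H^0$ (the extended double shuffle relations). The class of $z_{k_1}\cdots z_{k_r}$ is denoted $\zeta^f(k_1,\dots,k_r)$. *)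

theory Defs
  imports "HOL-Algebra.Algebra" "HOL-Library.Poly_Mapping" "HOL-Library.Product_Plus"
begin

section \<open>Free noncommutative rational algebras as vector spaces\<close>

text \<open>
  Words are lists of letters; an element of the free algebra is a finitely supported
  function from words to rationals.
\<close>

abbreviation mon :: "'w \<Rightarrow> 'w \<Rightarrow>\<^sub>0 rat"
  where "mon w \<equiv> Poly_Mapping.single w 1"

definition scale :: "rat \<Rightarrow> ('w \<Rightarrow>\<^sub>0 rat) \<Rightarrow> ('w \<Rightarrow>\<^sub>0 rat)"
  where "scale c p = Poly_Mapping.map ((*) c) p"

definition lin_ext :: "('v \<Rightarrow> ('w \<Rightarrow>\<^sub>0 rat)) \<Rightarrow> ('v \<Rightarrow>\<^sub>0 rat) \<Rightarrow> ('w \<Rightarrow>\<^sub>0 rat)"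
  where "lin_ext f p = (\<Sum>w\<in>Poly_Mapping.keys p. scale (Poly_Mapping.lookup p w) (f w))"

definition bilin_ext ::
    "('u \<Rightarrow> 'v \<Rightarrow> ('w \<Rightarrow>\<^sub>0 rat)) \<Rightarrow> ('u \<Rightarrow>\<^sub>0 rat) \<Rightarrow> ('v \<Rightarrow>\<^sub>0 rat) \<Rightarrow> ('w \<Rightarrow>\<^sub>0 rat)"
  where "bilin_ext f p q = lin_ext (\<lambda>u. lin_ext (f u) q) p"

definition prepend :: "'a \<Rightarrow> ('a list \<Rightarrow>\<^sub>0 rat) \<Rightarrow> ('a list \<Rightarrow>\<^sub>0 rat)"
  where "prepend a = lin_ext (\<lambda>w. mon (a # w))"

section \<open>Stuffle and shuffle products\<close>

text \<open>
  The two stuffle products are instances of one definition: letters are added componentwise for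
  the letters \<open>(k, d)\<close>, and as natural numbers for \<open>z\<^sub>k\<close>, encoded as \<open>k\<close>.
\<close>

fun stuffle_word :: "'a::plus list \<Rightarrow> 'a list \<Rightarrow> ('a list \<Rightarrow>\<^sub>0 rat)"
  where
    "stuffle_word [] v = mon v"
  | "stuffle_word (a # w) [] = mon (a # w)"
  | "stuffle_word (a # w) (b # v) =
       prepend a (stuffle_word w (b # v)) + prepend b (stuffle_word (a # w) v)
       + prepend (a + b) (stuffle_word w v)"

definition stuffle :: "('a::plus list \<Rightarrow>\<^sub>0 rat) \<Rightarrow> ('a list \<Rightarrow>\<^sub>0 rat) \<Rightarrow> ('a list \<Rightarrow>\<^sub>0 rat)"
  where "stuffle = bilin_ext stuffle_word"

fun shuffle_word :: "'a list \<Rightarrow> 'a list \<Rightarrow> ('a list \<Rightarrow>\<^sub>0 rat)"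
  where
    "shuffle_word [] v = mon v"
  | "shuffle_word (a # w) [] = mon (a # w)"
  | "shuffle_word (a # w) (b # v) =
       prepend a (shuffle_word w (b # v)) + prepend b (shuffle_word (a # w) v)"

definition shuffle :: "('a list \<Rightarrow>\<^sub>0 rat) \<Rightarrow> ('a list \<Rightarrow>\<^sub>0 rat) \<Rightarrow> ('a list \<Rightarrow>\<^sub>0 rat)"
  where "shuffle = bilin_ext shuffle_word"

section \<open>Rational algebras, quotients and homomorphisms\<close>

definition stuffle_algebra :: "'a::plus set \<Rightarrow> (rat, 'a list \<Rightarrow>\<^sub>0 rat) module"
  where "stuffle_algebra L =
    \<lparr>carrier = {p. Poly_Mapping.keys p \<subseteq> lists L}, monoid.mult = stuffle, monoid.one = mon [],
     ring.zero = 0, ring.add = (+), smult = scale\<rparr>"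

text \<open>The quotient ring of the library, equipped in addition with the induced scalar
  multiplication, which is defined in the style of \<^const>\<open>rcoset_mult\<close>.\<close>

definition quotient_algebra :: "('r, 'b) module \<Rightarrow> 'b set \<Rightarrow> ('r, 'b set) module"
  where "quotient_algebra A I =
    \<lparr>carrier = carrier (A Quot I), monoid.mult = monoid.mult (A Quot I),
     monoid.one = monoid.one (A Quot I),
     ring.zero = ring.zero (A Quot I), ring.add = ring.add (A Quot I),
     smult = (\<lambda>c C. \<Union>x\<in>C. I +>\<^bsub>A\<^esub> (c \<odot>\<^bsub>A\<^esub> x))\<rparr>"

definition alg_hom :: "(rat, 'b) module \<Rightarrow> (rat, 'c) module \<Rightarrow> ('b \<Rightarrow> 'c) set"
  where "alg_hom A B =
    {h \<in> ring_hom A B. \<forall>c. \<forall>x\<in>carrier A. h (c \<odot>\<^bsub>A\<^esub> x) = c \<odot>\<^bsub>B\<^esub> h x}"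

section \<open>The swap\<close>

text \<open>
  The letter with upper entry \<open>k\<close> and lower entry \<open>d\<close> is the pair \<open>(k, d)\<close>.
  Polynomials in the variables \<open>X\<^sub>1, Y\<^sub>1, X\<^sub>2, Y\<^sub>2, \<dots>\<close> are finitely supported
  functions on exponent vectors, with the convolution product of \<^typ>\<open>'a \<Rightarrow>\<^sub>0 'b\<close>.
\<close>

type_synonym word2 = "(nat \<times> nat) list"

datatype var = XV nat | YV nat

type_synonym pol = "(var \<Rightarrow>\<^sub>0 nat) \<Rightarrow>\<^sub>0 rat"

definition letters :: "(nat \<times> nat) set"
  where "letters = {(k, d). 1 \<le> k}"

definition Var :: "var \<Rightarrow> pol"
  where "Var x = Poly_Mapping.single (Poly_Mapping.single x 1) 1"

definition upper_entry :: "nat \<Rightarrow> nat \<Rightarrow> pol"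
  where "upper_entry r i = (\<Sum>j = 1..r + 1 - i. Var (YV j))"

definition lower_entry :: "nat \<Rightarrow> nat \<Rightarrow> pol"
  where "lower_entry r i =
    (if i = 1 then Var (XV r) else Var (XV (r + 1 - i)) - Var (XV (r + 2 - i)))"

definition exponents :: "word2 \<Rightarrow> (var \<Rightarrow>\<^sub>0 nat)"
  where "exponents w =
    (\<Sum>i = 1..length w. Poly_Mapping.single (XV i) (fst (w ! (i - 1)) - 1)
                      + Poly_Mapping.single (YV i) (snd (w ! (i - 1))))"

definition fact_lower :: "word2 \<Rightarrow> rat"
  where "fact_lower w = (\<Prod>(k, d)\<leftarrow>w. fact d)"

text \<open>
  The factor multiplying the word \<open>v\<close> in the generating series, after the substitution, is
  \<open>scale (1 / fact_lower v) (swap_pol v)\<close>.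
\<close>

definition swap_pol :: "word2 \<Rightarrow> pol"
  where "swap_pol v =
    (\<Prod>i = 1..length v. upper_entry (length v) i ^ (fst (v ! (i - 1)) - 1)
                        * lower_entry (length v) i ^ snd (v ! (i - 1)))"

text \<open>
  The coefficient of \<open>v\<close> in \<open>swap w\<close>. The factor \<^term>\<open>fact_lower w\<close> is
  there since coefficients are taken with respect to the divided powers of the \<open>Y\<^sub>i\<close>.
\<close>

definition swap_coeff :: "word2 \<Rightarrow> word2 \<Rightarrow> rat"
  where "swap_coeff w v =
    (if length v = length w \<and> v \<in> lists letters
     then fact_lower w / fact_lower v * Poly_Mapping.lookup (swap_pol v) (exponents w) else 0)"

definition swap_word :: "word2 \<Rightarrow> (word2 \<Rightarrow>\<^sub>0 rat)"
  where "swap_word w = Abs_poly_mapping (swap_coeff w)"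

definition swap :: "(word2 \<Rightarrow>\<^sub>0 rat) \<Rightarrow> (word2 \<Rightarrow>\<^sub>0 rat)"
  where "swap = lin_ext swap_word"

section \<open>Formal multiple Eisenstein series\<close>

definition QA :: "(rat, word2 \<Rightarrow>\<^sub>0 rat) module"
  where "QA = stuffle_algebra letters"

definition swap_ideal :: "(word2 \<Rightarrow>\<^sub>0 rat) set"
  where "swap_ideal = Idl\<^bsub>QA\<^esub> {swap w - w | w. w \<in> carrier QA}"

definition Gf_algebra :: "(rat, (word2 \<Rightarrow>\<^sub>0 rat) set) module"
  where "Gf_algebra = quotient_algebra QA swap_ideal"

definition Gf :: "word2 \<Rightarrow> (word2 \<Rightarrow>\<^sub>0 rat) set"
  where "Gf w = swap_ideal +>\<^bsub>QA\<^esub> mon w"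

section \<open>Formal multiple zeta values\<close>

datatype xy = LX | LY

definition H1 :: "(rat, nat list \<Rightarrow>\<^sub>0 rat) module"
  where "H1 = stuffle_algebra {k. 1 \<le> k}"

definition H0 :: "(nat list \<Rightarrow>\<^sub>0 rat) set"
  where "H0 = {p \<in> carrier H1. \<forall>w\<in>Poly_Mapping.keys p. w = [] \<or> hd w \<noteq> 1}"

definition to_xy :: "(nat list \<Rightarrow>\<^sub>0 rat) \<Rightarrow> (xy list \<Rightarrow>\<^sub>0 rat)"
  where "to_xy = lin_ext (\<lambda>ks. mon (concat (map (\<lambda>k. replicate (k - 1) LX @ [LY]) ks)))"

text \<open>
  Since \<^const>\<open>to_xy\<close> is injective on \<^const>\<open>H1\<close> and its image is closed under
  the shuffle product, \<open>u\<close> below is the shuffle product of \<open>w\<close> and \<open>v\<close> in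
  \<^const>\<open>H1\<close>.
\<close>

definition eds_ideal :: "(nat list \<Rightarrow>\<^sub>0 rat) set"
  where "eds_ideal = Idl\<^bsub>H1\<^esub>
    {stuffle w v - u | w v u. w \<in> carrier H1 \<and> v \<in> H0 \<and> u \<in> carrier H1
                              \<and> to_xy u = shuffle (to_xy w) (to_xy v)}"

definition Zf_algebra :: "(rat, (nat list \<Rightarrow>\<^sub>0 rat) set) module"
  where "Zf_algebra = quotient_algebra H1 eds_ideal"

definition zetaf :: "nat list \<Rightarrow> (nat list \<Rightarrow>\<^sub>0 rat) set"
  where "zetaf ks = eds_ideal +>\<^bsub>H1\<^esub> mon ks"

section \<open>Well-definedness\<close>

lemma lookup_scale [simp]:
  "Poly_Mapping.lookup (scale c p) w = c * Poly_Mapping.lookup p w"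
  by (simp add: scale_def Poly_Mapping.map.rep_eq when_def)

lemma scale_simps [simp]:
  "scale 0 p = 0" "scale c 0 = 0" "scale 1 p = p" "scale c (scale d p) = scale (c * d) p"
  by (rule poly_mapping_eqI; simp)+

lemma scale_add: "scale c (p + q) = scale c p + scale c q"
  and scale_add_left: "scale (c + d) p = scale c p + scale d p"
  by (rule poly_mapping_eqI; simp add: lookup_add algebra_simps)+

lemma scale_sum: "scale c (sum f A) = (\<Sum>x\<in>A. scale c (f x))"
  by (induction A rule: infinite_finite_induct) (simp_all add: scale_add)

lemma lin_ext_superset:
  assumes "finite S" "Poly_Mapping.keys p \<subseteq> S"
  shows "lin_ext f p = (\<Sum>w\<in>S. scale (Poly_Mapping.lookup p w) (f w))"
  unfolding lin_ext_def using assms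
  by (intro sum.mono_neutral_left) (auto simp: in_keys_iff)

lemma lin_ext_add: "lin_ext f (p + q) = lin_ext f p + lin_ext f q"
proof -
  let ?S = "Poly_Mapping.keys p \<union> Poly_Mapping.keys q"
  have "Poly_Mapping.keys (p + q) \<subseteq> ?S" by (rule keys_add)
  then show ?thesis
    by (simp add: lin_ext_superset[of ?S] lookup_add scale_add_left sum.distrib)
qed

lemma lin_ext_scale: "lin_ext f (scale c p) = scale c (lin_ext f p)"
proof -
  have "Poly_Mapping.keys (scale c p) \<subseteq> Poly_Mapping.keys p" by (auto simp: in_keys_iff)
  then show ?thesis
    by (simp add: lin_ext_superset[of "Poly_Mapping.keys p"] scale_sum)
qed

lemma lin_ext_zero [simp]: "lin_ext f 0 = 0"
  by (simp add: lin_ext_def)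

lemma lin_ext_mon [simp]: "lin_ext f (mon w) = f w"
  by (simp add: lin_ext_def)

lemma poly_expand: "p = (\<Sum>w\<in>Poly_Mapping.keys p. scale (Poly_Mapping.lookup p w) (mon w))"
  by (rule poly_mapping_eqI)
    (auto simp: lookup_sum lookup_single when_def in_keys_iff if_distrib sum.delta cong: if_cong)

lemma poly_induct [case_names zero add mon]:
  assumes "P 0" "\<And>p q. P p \<Longrightarrow> P q \<Longrightarrow> P (p + q)" "\<And>c w. P (scale c (mon w))"
  shows "P p"
proof -
  have "P (\<Sum>w\<in>S. scale (Poly_Mapping.lookup p w) (mon w))" for S
    by (induction S rule: infinite_finite_induct) (simp_all add: assms)
  then show ?thesis by (metis poly_expand)
qed

lemma lin_ext_fun_add: "lin_ext (\<lambda>w. f w + g w) p = lin_ext f p + lin_ext g p"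
  by (simp add: lin_ext_def scale_add sum.distrib)

lemma lin_ext_fun_scale: "lin_ext (\<lambda>w. scale c (f w)) p = scale c (lin_ext f p)"
  by (simp add: lin_ext_def scale_sum mult.commute)

lemma lin_ext_fun_zero: "lin_ext (\<lambda>w. 0) p = 0"
  by (simp add: lin_ext_def)

lemma keys_lin_ext: "Poly_Mapping.keys (lin_ext f p) \<subseteq> (\<Union>w\<in>Poly_Mapping.keys p. Poly_Mapping.keys (f w))"
proof
  fix v assume "v \<in> Poly_Mapping.keys (lin_ext f p)"
  then have "(\<Sum>w\<in>Poly_Mapping.keys p. Poly_Mapping.lookup p w * Poly_Mapping.lookup (f w) v) \<noteq> 0"
    by (simp add: in_keys_iff lin_ext_def lookup_sum)
  then obtain w where "w \<in> Poly_Mapping.keys p" "Poly_Mapping.lookup p w * Poly_Mapping.lookup (f w) v \<noteq> 0"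
    by (rule sum.not_neutral_contains_not_neutral)
  then show "v \<in> (\<Union>w\<in>Poly_Mapping.keys p. Poly_Mapping.keys (f w))"
    by (auto simp: in_keys_iff)
qed

lemma stuffle_linear [simp]:
  "stuffle 0 q = 0" "stuffle p 0 = 0"
  "stuffle (p + p') q = stuffle p q + stuffle p' q"
  "stuffle p (q + q') = stuffle p q + stuffle p q'"
  "stuffle (scale c p) q = scale c (stuffle p q)"
  "stuffle p (scale c q) = scale c (stuffle p q)"
  by (simp_all add: stuffle_def bilin_ext_def lin_ext_add lin_ext_scale lin_ext_fun_add
      lin_ext_fun_scale lin_ext_fun_zero)

lemma prepend_linear [simp]:
  "prepend a 0 = 0" "prepend a (p + q) = prepend a p + prepend a q"
  "prepend a (scale c p) = scale c (prepend a p)"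
  by (simp_all add: prepend_def lin_ext_add lin_ext_scale)

lemma prepend_mon: "prepend a (mon w) = mon (a # w)"
  by (simp add: prepend_def)

lemma stuffle_mon: "stuffle (mon w) (mon v) = stuffle_word w v"
  by (simp add: stuffle_def bilin_ext_def)

lemma stuffle_one: "stuffle (mon []) p = p" "stuffle p (mon []) = p"
proof -
  show "stuffle (mon []) p = p"
    by (induction p rule: poly_induct) (simp_all add: stuffle_mon)
  have "stuffle_word w [] = mon w" for w :: "'a list"
    by (cases w) simp_all
  then show "stuffle p (mon []) = p"
    by (induction p rule: poly_induct) (simp_all add: stuffle_mon)
qed

lemma stuffle_prepend:
  "stuffle (prepend a p) (prepend b q) =
     prepend a (stuffle p (prepend b q)) + prepend b (stuffle (prepend a p) q)
     + prepend (a + b) (stuffle p q)"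
proof (induction p rule: poly_induct)
  case (mon c w)
  show ?case
  proof (induction q rule: poly_induct)
    case (mon d v)
    then show ?case by (simp add: prepend_mon stuffle_mon scale_add)
  qed (simp_all add: scale_add algebra_simps)
qed (simp_all add: algebra_simps)

lemma stuffle_word_comm:
  fixes w v :: "'a::ab_semigroup_add list"
  shows "stuffle_word w v = stuffle_word v w"
proof (induction w v rule: stuffle_word.induct)
  case (1 v)
  then show ?case by (cases v) simp_all
qed (simp_all add: ac_simps)

lemma stuffle_comm:
  fixes p q :: "'a::ab_semigroup_add list \<Rightarrow>\<^sub>0 rat"
  shows "stuffle p q = stuffle q p"
proof (induction p rule: poly_induct)
  case (mon c w)
  show ?case
    by (induction q rule: poly_induct) (simp_all add: stuffle_mon scale_add mult.commute stuffle_word_comm[of w])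
qed simp_all

lemma stuffle_assoc_mon:
  fixes u v w :: "'a::ab_semigroup_add list"
  shows "stuffle (stuffle (mon u) (mon v)) (mon w) = stuffle (mon u) (stuffle (mon v) (mon w))"
proof (induction "length u + length v + length w" arbitrary: u v w rule: less_induct)
  case less
  show ?case
  proof (cases "u = [] \<or> v = [] \<or> w = []")
    case True
    then show ?thesis by (auto simp: stuffle_one)
  next
    case False
    then obtain a u' b v' c w' where eqs: "u = a # u'" "v = b # v'" "w = c # w'"
      by (meson neq_Nil_conv)
    define p q r where "p = mon u'" and "q = mon v'" and "r = mon w'"
    note IH = less[unfolded eqs]
    have ih:
      "stuffle (stuffle p (prepend b q)) (prepend c r) = stuffle p (stuffle (prepend b q) (prepend c r))"
      "stuffle (stuffle (prepend a p) q) (prepend c r) = stuffle (prepend a p) (stuffle q (prepend c r))"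
      "stuffle (stuffle (prepend a p) (prepend b q)) r = stuffle (prepend a p) (stuffle (prepend b q) r)"
      "stuffle (stuffle p q) (prepend c r) = stuffle p (stuffle q (prepend c r))"
      "stuffle (stuffle p (prepend b q)) r = stuffle p (stuffle (prepend b q) r)"
      "stuffle (stuffle (prepend a p) q) r = stuffle (prepend a p) (stuffle q r)"
      "stuffle (stuffle p q) r = stuffle p (stuffle q r)"
      unfolding p_def q_def r_def prepend_mon by (rule IH; simp)+
    let ?A = "prepend a p" and ?B = "prepend b q" and ?C = "prepend c r"
    have l: "stuffle (stuffle ?A ?B) ?C =
       prepend a (stuffle (stuffle p ?B) ?C) + prepend b (stuffle (stuffle ?A q) ?C)
       + prepend (a + b) (stuffle (stuffle p q) ?C) + prepend c (stuffle (stuffle ?A ?B) r)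
       + prepend (a + c) (stuffle (stuffle p ?B) r) + prepend (b + c) (stuffle (stuffle ?A q) r)
       + prepend (a + b + c) (stuffle (stuffle p q) r)"
      by (simp add: stuffle_prepend[of a p b q] stuffle_prepend[where q = r] add_ac)
    have r: "stuffle ?A (stuffle ?B ?C) =
       prepend a (stuffle p (stuffle ?B ?C)) + prepend b (stuffle ?A (stuffle q ?C))
       + prepend (a + b) (stuffle p (stuffle q ?C)) + prepend c (stuffle ?A (stuffle ?B r))
       + prepend (a + c) (stuffle p (stuffle ?B r)) + prepend (b + c) (stuffle ?A (stuffle q r))
       + prepend (a + b + c) (stuffle p (stuffle q r))"
      by (simp add: stuffle_prepend[of b q c r] stuffle_prepend[where p = p] add_ac)
    have "stuffle (stuffle ?A ?B) ?C = stuffle ?A (stuffle ?B ?C)"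
      unfolding l r ih ..
    then show ?thesis unfolding eqs p_def q_def r_def prepend_mon .
  qed
qed

lemma stuffle_assoc:
  fixes p q r :: "'a::ab_semigroup_add list \<Rightarrow>\<^sub>0 rat"
  shows "stuffle (stuffle p q) r = stuffle p (stuffle q r)"
proof (induction p rule: poly_induct)
  case (mon c u)
  show ?case
  proof (induction q rule: poly_induct)
    case (mon d v)
    show ?case
      by (induction r rule: poly_induct) (simp_all add: stuffle_assoc_mon scale_add mult.assoc)
  qed (simp_all add: scale_add)
qed simp_all

lemma keys_stuffle_word:
  assumes "\<And>a b. a \<in> L \<Longrightarrow> b \<in> L \<Longrightarrow> a + b \<in> L" "w \<in> lists L" "v \<in> lists L"
  shows "Poly_Mapping.keys (stuffle_word w v) \<subseteq> lists L"
  using assms(2,3)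
proof (induction w v rule: stuffle_word.induct)
  case (3 a w b v)
  have "Poly_Mapping.keys (prepend c p) \<subseteq> lists L"
    if "c \<in> L" "Poly_Mapping.keys p \<subseteq> lists L" for c p
  proof
    fix x assume "x \<in> Poly_Mapping.keys (prepend c p)"
    then obtain u where "u \<in> Poly_Mapping.keys p" "x = c # u"
      using keys_lin_ext[of "\<lambda>w. mon (c # w)" p] by (auto simp: prepend_def)
    then show "x \<in> lists L" using that by auto
  qed
  moreover have "Poly_Mapping.keys (p + q) \<subseteq> lists L"
    if "Poly_Mapping.keys p \<subseteq> lists L" "Poly_Mapping.keys q \<subseteq> lists L" for p q :: "'a list \<Rightarrow>\<^sub>0 rat"
    using keys_add[of p q] that by blast
  moreover have "a \<in> L" "b \<in> L" "a + b \<in> L" "w \<in> lists L" "v \<in> lists L"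
    using 3 assms(1) by auto
  ultimately show ?case using 3 by simp
qed simp_all

lemma keys_stuffle:
  assumes "\<And>a b. a \<in> L \<Longrightarrow> b \<in> L \<Longrightarrow> a + b \<in> L"
    and "Poly_Mapping.keys p \<subseteq> lists L" "Poly_Mapping.keys q \<subseteq> lists L"
  shows "Poly_Mapping.keys (stuffle p q) \<subseteq> lists L"
proof -
  have "Poly_Mapping.keys (stuffle_word w v) \<subseteq> lists L"
    if "w \<in> Poly_Mapping.keys p" "v \<in> Poly_Mapping.keys q" for w v
    using keys_stuffle_word[of L w v] assms that by blast
  then show ?thesis
    unfolding stuffle_def bilin_ext_def
    by (intro order_trans[OF keys_lin_ext] UN_least)
qed

lemma cring_stuffle_algebra:
  fixes L :: "'a::ab_semigroup_add set"
  assumes "\<And>a b. a \<in> L \<Longrightarrow> b \<in> L \<Longrightarrow> a + b \<in> L"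
  shows "cring (stuffle_algebra L)"
proof (rule cringI)
  show "abelian_group (stuffle_algebra L)"
  proof (rule abelian_groupI)
    fix x assume "x \<in> carrier (stuffle_algebra L)"
    then show "\<exists>y\<in>carrier (stuffle_algebra L). y \<oplus>\<^bsub>stuffle_algebra L\<^esub> x = \<zero>\<^bsub>stuffle_algebra L\<^esub>"
      by (intro bexI[of _ "- x"]) (auto simp: stuffle_algebra_def)
  next
    fix x y assume "x \<in> carrier (stuffle_algebra L)" "y \<in> carrier (stuffle_algebra L)"
    then show "x \<oplus>\<^bsub>stuffle_algebra L\<^esub> y \<in> carrier (stuffle_algebra L)"
      using keys_add[of x y] by (simp add: stuffle_algebra_def) blast
  qed (simp_all add: stuffle_algebra_def add_ac)
  show "Group.comm_monoid (stuffle_algebra L)"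
    using keys_stuffle[OF assms]
    by (intro comm_monoidI)
      (auto simp: stuffle_algebra_def stuffle_assoc stuffle_one intro: stuffle_comm)
qed (simp add: stuffle_algebra_def)

lemma cring_QA: "cring QA"
  unfolding QA_def by (rule cring_stuffle_algebra) (auto simp: letters_def)

lemma cring_H1: "cring H1"
  unfolding H1_def by (rule cring_stuffle_algebra) auto

definition bihomogeneous :: "nat \<Rightarrow> nat \<Rightarrow> nat \<Rightarrow> pol \<Rightarrow> bool"
  where "bihomogeneous r a b p \<longleftrightarrow> (\<forall>m\<in>Poly_Mapping.keys p.
     (\<Sum>i = 1..r. Poly_Mapping.lookup m (XV i)) = a \<and> (\<Sum>i = 1..r. Poly_Mapping.lookup m (YV i)) = b)"

lemma bihomogeneous_one: "bihomogeneous r 0 0 1"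
  by (simp add: bihomogeneous_def)

lemma bihomogeneous_mult:
  assumes "bihomogeneous r a b p" "bihomogeneous r c d q"
  shows "bihomogeneous r (a + c) (b + d) (p * q)"
  unfolding bihomogeneous_def
proof
  fix m assume "m \<in> Poly_Mapping.keys (p * q)"
  then obtain m1 m2 where "m = m1 + m2" "m1 \<in> Poly_Mapping.keys p" "m2 \<in> Poly_Mapping.keys q"
    using keys_mult[of p q] by blast
  then show "(\<Sum>i = 1..r. Poly_Mapping.lookup m (XV i)) = a + c
      \<and> (\<Sum>i = 1..r. Poly_Mapping.lookup m (YV i)) = b + d"
    using assms by (simp add: bihomogeneous_def lookup_add sum.distrib)
qed

lemma bihomogeneous_power:
  assumes "bihomogeneous r a b p"
  shows "bihomogeneous r (n * a) (n * b) (p ^ n)"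
  by (induction n) (simp_all add: bihomogeneous_one bihomogeneous_mult assms)

lemma bihomogeneous_prod:
  assumes "\<And>i. i \<in> I \<Longrightarrow> bihomogeneous r (f i) (g i) (p i)"
  shows "bihomogeneous r (sum f I) (sum g I) (prod p I)"
  using assms
  by (induction I rule: infinite_finite_induct) (simp_all add: bihomogeneous_one bihomogeneous_mult)

lemma bihomogeneous_add_diff:
  assumes "bihomogeneous r a b p" "bihomogeneous r a b q"
  shows "bihomogeneous r a b (p + q)" "bihomogeneous r a b (p - q)"
proof -
  have "m \<in> Poly_Mapping.keys p \<union> Poly_Mapping.keys q"
    if "m \<in> Poly_Mapping.keys (p + q) \<union> Poly_Mapping.keys (p - q)" for m
    using that by (auto simp: in_keys_iff lookup_add lookup_minus)
  then show "bihomogeneous r a b (p + q)" "bihomogeneous r a b (p - q)"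
    using assms unfolding bihomogeneous_def by blast+
qed

lemma bihomogeneous_sum:
  assumes "\<And>i. i \<in> I \<Longrightarrow> bihomogeneous r a b (p i)"
  shows "bihomogeneous r a b (sum p I)"
  using assms
  by (induction I rule: infinite_finite_induct)
    (simp_all add: bihomogeneous_add_diff, simp_all add: bihomogeneous_def)

lemma bihomogeneous_Var:
  assumes "i \<in> {1..r}"
  shows "bihomogeneous r 1 0 (Var (XV i))" "bihomogeneous r 0 1 (Var (YV i))"
  using assms by (simp_all add: bihomogeneous_def Var_def lookup_single when_def)

lemma bihomogeneous_swap_pol:
  "bihomogeneous (length v) (\<Sum>i = 1..length v. snd (v ! (i - 1)))
     (\<Sum>i = 1..length v. fst (v ! (i - 1)) - 1) (swap_pol v)"
proof -
  let ?r = "length v"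
  have "bihomogeneous ?r (snd (v ! (i - 1))) (fst (v ! (i - 1)) - 1)
      (upper_entry ?r i ^ (fst (v ! (i - 1)) - 1) * lower_entry ?r i ^ snd (v ! (i - 1)))"
    if i: "i \<in> {1..?r}" for i
  proof -
    have u: "bihomogeneous ?r 0 1 (upper_entry ?r i)"
      unfolding upper_entry_def
      by (intro bihomogeneous_sum bihomogeneous_Var(2)) (use i in auto)
    have l: "bihomogeneous ?r 1 0 (lower_entry ?r i)"
    proof (cases "i = 1")
      case True
      then show ?thesis
        using bihomogeneous_Var(1)[of ?r ?r] i by (simp add: lower_entry_def)
    next
      case False
      have "bihomogeneous ?r 1 0 (Var (XV (?r + 1 - i)))" "bihomogeneous ?r 1 0 (Var (XV (?r + 2 - i)))"
        by (rule bihomogeneous_Var(1); use i False in auto)+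
      then show ?thesis
        using False bihomogeneous_add_diff(2) by (simp add: lower_entry_def)
    qed
    show ?thesis
      using bihomogeneous_mult[OF bihomogeneous_power[OF u] bihomogeneous_power[OF l]] by simp
  qed
  then show ?thesis
    unfolding swap_pol_def by (rule bihomogeneous_prod)
qed

lemma finite_swap_coeff: "finite {v. swap_coeff w v \<noteq> 0}"
proof -
  let ?r = "length w"
  define a where "a = (\<Sum>i = 1..?r. Poly_Mapping.lookup (exponents w) (XV i))"
  define b where "b = (\<Sum>i = 1..?r. Poly_Mapping.lookup (exponents w) (YV i))"
  have "v \<in> {v. set v \<subseteq> {..b + 1} \<times> {..a} \<and> length v = ?r}" if "swap_coeff w v \<noteq> 0" for v
  proof -
    have len: "length v = ?r" and "exponents w \<in> Poly_Mapping.keys (swap_pol v)"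
      using that by (auto simp: swap_coeff_def in_keys_iff split: if_splits)
    then have s: "(\<Sum>i = 1..?r. snd (v ! (i - 1))) = a" "(\<Sum>i = 1..?r. fst (v ! (i - 1)) - 1) = b"
      using bihomogeneous_swap_pol[of v] by (auto simp: bihomogeneous_def a_def b_def)
    have "x \<in> {..b + 1} \<times> {..a}" if "x \<in> set v" for x
    proof -
      obtain j where j: "j < ?r" "x = v ! j" using \<open>x \<in> set v\<close> len by (metis in_set_conv_nth)
      have "snd (v ! (Suc j - 1)) \<le> a"
        unfolding s[symmetric] using j by (intro member_le_sum[where f = "\<lambda>i. snd (v ! (i - 1))"]) auto
      moreover have "fst (v ! (Suc j - 1)) - 1 \<le> b"
        unfolding s[symmetric] using j by (intro member_le_sum[where f = "\<lambda>i. fst (v ! (i - 1)) - 1"]) auto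
      ultimately show ?thesis using j by (auto simp: mem_Times_iff)
    qed
    then show ?thesis using len by auto
  qed
  then have "{v. swap_coeff w v \<noteq> 0} \<subseteq> {v. set v \<subseteq> {..b + 1} \<times> {..a} \<and> length v = ?r}"
    by blast
  then show ?thesis by (rule finite_subset) (rule finite_lists_length_eq, simp)
qed

lemma lookup_swap_word: "Poly_Mapping.lookup (swap_word w) v = swap_coeff w v"
  unfolding swap_word_def using finite_swap_coeff[of w] by simp

end

theory Submission
  imports Defs
begin

text \<open>
  Call a word \<open>(1, d\<^sub>1) \<dots> (1, d\<^sub>s) (k\<^sub>1, 0) \<dots> (k\<^sub>r, 0)\<close> of zeta type. The swap exchanges the
  two kinds of letters: it turns words with upper row \<open>1, \<dots>, 1\<close> into combinations of words with
  lower row \<open>0, \<dots>, 0\<close>, and conversely. Modulo the words that are not of zeta type, the former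
  multiply by the shuffle product of their lower rows, whereas the latter multiply by the stuffle
  product of their upper rows. Since a swap-invariant map has to respect both products, it satisfies
  the double shuffle relations.

  The translation between the two kinds is the map \<open>tower\<close> from words in the lower entries to
  polynomials in \<open>x\<close> and \<open>y\<close>. It is a homomorphism for the shuffle products (\<open>tower_shuffle\<close>); the
  swap of a word with upper row \<open>1, \<dots>, 1\<close> is \<open>tower\<close> of its lower row, read in the letters
  \<open>z\<^sub>k = x\<^sup>k\<^sup>-\<^sup>1 y\<close> (\<open>swap_lower_word\<close>); and \<open>tower\<close> inverts the swap on words with lower row
  \<open>0, \<dots>, 0\<close> (\<open>tower_swap_upper_word\<close>). Everything that is needed about the swap follows from one
  recursion for its coefficients, obtained by extracting from the swap polynomial the powers of the
  variables \<open>X\<^sub>r\<close> and \<open>Y\<^sub>r\<close> with the largest index (\<open>swap_lookup_snoc\<close>).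

  Existence of the homomorphism. Let \<open>reg\<close> be the shuffle regularisation, which sends \<open>y\<close> to zero and
  is the identity on polynomials without words starting in \<open>y\<close>. Two maps to formal multiple zeta values
  are multiplicative: the one that sends a word with upper row \<open>1, \<dots>, 1\<close> and lower row \<open>ds\<close> to
  \<open>reg (tower ds)\<close>, and the one that sends a word with lower row \<open>0, \<dots>, 0\<close> to its upper row. For the
  first map the extended double shuffle relations between words not starting in \<open>z\<^sub>1\<close> are used. Both
  maps are extended by zero. As the stuffle product is compatible with deconcatenation, their
  convolution \<open>zeta_of_word\<close> is multiplicative as well (\<open>zeta_of_word_stuffle\<close>); it vanishes on words
  that are not of zeta type. For the invariance under the swap, the second map is rewritten by the
  comparison of the stuffle and shuffle regularisations: modulo the extended double shuffle relations
  a word \<open>ks\<close> is the convolution of powers of \<open>z\<^sub>1\<close> and of \<open>reg ks\<close> (\<open>word_regularised\<close>). Thus the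
  homomorphism is a convolution of three maps: \<open>reg (tower ds)\<close> of an initial part, a power of \<open>z\<^sub>1\<close>
  in the middle and \<open>reg ks\<close> of a final part. The swap reverses the order of these factors
  (\<open>conv_swap\<close>) and exchanges the two outer ones, so the convolution is unchanged.

  The kernel. Let \<open>K\<close> be the ideal of the free algebra generated by all \<open>swap w - w\<close> and by the words
  that are not of zeta type. Multiplying out \<open>u * v\<close> for \<open>u\<close> with upper row \<open>1, \<dots>, 1\<close> and \<open>v\<close> with
  lower row \<open>0, \<dots>, 0\<close> shows by induction on the length of \<open>v\<close> that modulo \<open>K\<close> every element comes
  from a polynomial in the letters \<open>z\<^sub>k\<close> (\<open>eqv_upper\<close>). The extended double shuffle relations come
  from elements of \<open>K\<close>: write the two factors as swaps of words with upper row \<open>1, \<dots>, 1\<close>, multiply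
  there, where the product is the shuffle product modulo \<open>K\<close>, and swap back (\<open>upper_eds\<close>). Hence an
  element with value zero lies in \<open>K\<close>, and passing to the quotients gives the theorem.
\<close>

section \<open>Linear maps and supports\<close>

abbreviation supp :: "('w \<Rightarrow>\<^sub>0 rat) \<Rightarrow> 'w set"
  where "supp \<equiv> Poly_Mapping.keys"

abbreviation lookup :: "('w \<Rightarrow>\<^sub>0 'c::zero) \<Rightarrow> 'w \<Rightarrow> 'c"
  where "lookup \<equiv> Poly_Mapping.lookup"

lemma scale_uminus: "scale (- c) p = - scale c p"
  by (rule poly_mapping_eqI) simp

lemma scale_minus_right: "scale c (p - q) = scale c p - scale c q"
  by (rule poly_mapping_eqI) (simp add: lookup_minus algebra_simps)

lemma scale_mon: "scale c (mon w) = Poly_Mapping.single w c"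
  by (rule poly_mapping_eqI) (simp add: lookup_single when_def)

lemma lin_ext_uminus: "lin_ext f (- p) = - lin_ext f p"
  using lin_ext_scale[of f "-1" p] by (simp add: scale_uminus)

lemma lin_ext_minus: "lin_ext f (p - q) = lin_ext f p - lin_ext f q"
  using lin_ext_add[of f p "-q"] by (simp add: lin_ext_uminus)

lemma lin_ext_sum: "lin_ext f (sum g A) = (\<Sum>x\<in>A. lin_ext f (g x))"
  by (induction A rule: infinite_finite_induct) (simp_all add: lin_ext_add)

lemma lin_ext_cong: "(\<And>w. w \<in> supp p \<Longrightarrow> f w = g w) \<Longrightarrow> lin_ext f p = lin_ext g p"
  by (simp add: lin_ext_def)

lemma lin_ext_eq_0: "(\<And>w. w \<in> supp p \<Longrightarrow> f w = 0) \<Longrightarrow> lin_ext f p = 0"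
  by (simp add: lin_ext_def)

lemma lin_ext_fun_sum: "lin_ext (\<lambda>w. \<Sum>i\<in>A. f i w) p = (\<Sum>i\<in>A. lin_ext (f i) p)"
  by (induction A rule: infinite_finite_induct) (simp_all add: lin_ext_fun_zero lin_ext_fun_add)

lemma lin_ext_mon_id [simp]: "lin_ext mon p = p"
  using poly_expand[of p] by (simp add: lin_ext_def)

lemma lin_ext_id_on: "(\<And>w. w \<in> supp p \<Longrightarrow> f w = mon w) \<Longrightarrow> lin_ext f p = p"
  using lin_ext_cong[of p f mon] by simp

lemma lin_ext_lin_ext: "lin_ext f (lin_ext g p) = lin_ext (\<lambda>w. lin_ext f (g w)) p"
  by (induction p rule: poly_induct) (simp_all add: lin_ext_add lin_ext_scale)

lemma lin_ext_prepend: "lin_ext f (prepend a p) = lin_ext (\<lambda>w. f (a # w)) p"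
  by (simp add: prepend_def lin_ext_lin_ext)

lemma lookup_lin_ext_inj:
  assumes "inj_on f S" "supp p \<subseteq> S"
  shows "w \<in> S \<Longrightarrow> lookup (lin_ext (\<lambda>w. mon (f w)) p) (f w) = lookup p w"
    and "v \<notin> f ` S \<Longrightarrow> lookup (lin_ext (\<lambda>w. mon (f w)) p) v = 0"
proof -
  have *: "lookup (lin_ext (\<lambda>w. mon (f w)) p) v =
     (\<Sum>u\<in>supp p. if f u = v then lookup p u else 0)" for v
    by (auto simp: lin_ext_def lookup_sum lookup_single when_def intro!: sum.cong)
  show "lookup (lin_ext (\<lambda>w. mon (f w)) p) v = 0" if "v \<notin> f ` S"
    unfolding * using that assms(2) by (intro sum.neutral) auto
  show "lookup (lin_ext (\<lambda>w. mon (f w)) p) (f w) = lookup p w" if "w \<in> S"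
  proof -
    have "(\<Sum>u\<in>supp p. if f u = f w then lookup p u else 0) =
      (\<Sum>u\<in>supp p. if u = w then lookup p u else 0)"
      using assms that by (intro sum.cong refl) (auto dest: inj_onD)
    then show ?thesis unfolding * by (simp add: sum.delta in_keys_iff)
  qed
qed

lemma keys_scale: "supp (scale c p) \<subseteq> supp p"
  by (auto simp: in_keys_iff)

lemma keys_minus: "supp (p - q) \<subseteq> supp p \<union> supp q"
  by (auto simp: in_keys_iff lookup_minus)

lemma keys_add_subset:
  "supp p \<subseteq> S \<Longrightarrow> supp q \<subseteq> S \<Longrightarrow> supp (p + q) \<subseteq> S"
  using keys_add[of p q] by blast

lemma keys_sum_subset:
  assumes "\<And>x. x \<in> A \<Longrightarrow> supp (f x) \<subseteq> S"
  shows "supp (sum f A) \<subseteq> S"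
  using assms
proof (induction A rule: infinite_finite_induct)
  case (insert x F)
  then show ?case using keys_add[of "f x" "sum f F"] by auto
qed simp_all

lemma keys_lin_ext_subset:
  assumes "\<And>w. w \<in> supp p \<Longrightarrow> supp (f w) \<subseteq> S"
  shows "supp (lin_ext f p) \<subseteq> S"
  using keys_lin_ext[of f p] assms by blast

lemma keys_prepend: "supp (prepend a p) = (#) a ` supp p"
proof -
  have "lookup (prepend a p) w = (case w of [] \<Rightarrow> 0 | b # v \<Rightarrow> if a = b then lookup p v else 0)" for w
    by (induction p rule: poly_induct)
      (simp_all add: prepend_mon lookup_add lookup_single when_def split: list.split)
  then show ?thesis
    by (force simp: in_keys_iff image_iff split: list.splits if_splits)
qed

lemma keys_prepend_subset:
  "(\<And>t. t \<in> supp p \<Longrightarrow> a # t \<in> S) \<Longrightarrow> supp (prepend a p) \<subseteq> S"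
  by (auto simp: keys_prepend)

lemma lookup_prepend: "lookup (prepend a p) (b # v) = (if a = b then lookup p v else 0)"
  by (induction p rule: poly_induct)
    (simp_all add: prepend_mon lookup_add lookup_single when_def)

lemma prepend_minus: "prepend a (p - q) = prepend a p - prepend a q"
  by (simp add: prepend_def lin_ext_minus)

lemma stuffle_word_Nil2 [simp]: "stuffle_word w [] = mon w"
  by (cases w) simp_all

lemma stuffle_sum_left: "stuffle (sum f A) q = (\<Sum>x\<in>A. stuffle (f x) q)"
  by (induction A rule: infinite_finite_induct) simp_all

lemma stuffle_sum_right: "stuffle p (sum f A) = (\<Sum>x\<in>A. stuffle p (f x))"
  by (induction A rule: infinite_finite_induct) simp_all

section \<open>The shuffle algebra\<close>

lemma shuffle_linear [simp]:
  "shuffle 0 q = 0" "shuffle p 0 = 0"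
  "shuffle (p + p') q = shuffle p q + shuffle p' q"
  "shuffle p (q + q') = shuffle p q + shuffle p q'"
  "shuffle (scale c p) q = scale c (shuffle p q)"
  "shuffle p (scale c q) = scale c (shuffle p q)"
  by (simp_all add: shuffle_def bilin_ext_def lin_ext_add lin_ext_scale lin_ext_fun_add
      lin_ext_fun_scale lin_ext_fun_zero)

lemma shuffle_mon: "shuffle (mon w) (mon v) = shuffle_word w v"
  by (simp add: shuffle_def bilin_ext_def)

lemma shuffle_word_Nil2 [simp]: "shuffle_word w [] = mon w"
  by (cases w) simp_all

lemma shuffle_one [simp]: "shuffle (mon []) p = p" "shuffle p (mon []) = p"
  by (induction p rule: poly_induct; simp add: shuffle_mon)+

lemma shuffle_prepend:
  "shuffle (prepend a p) (prepend b q) =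
     prepend a (shuffle p (prepend b q)) + prepend b (shuffle (prepend a p) q)"
proof (induction p rule: poly_induct)
  case (mon c w)
  show ?case
    by (induction q rule: poly_induct) (simp_all add: prepend_mon shuffle_mon scale_add algebra_simps)
qed (simp_all add: algebra_simps)

lemma shuffle_word_comm: "shuffle_word w v = shuffle_word v w"
  by (induction w v rule: shuffle_word.induct) (simp_all add: ac_simps)

lemma shuffle_comm: "shuffle p q = shuffle q p"
proof (induction p rule: poly_induct)
  case (mon c w)
  show ?case
    by (induction q rule: poly_induct)
      (simp_all add: shuffle_mon scale_add mult.commute shuffle_word_comm[of w])
qed simp_all

lemma shuffle_assoc_mon:
  "shuffle (shuffle (mon u) (mon v)) (mon w) = shuffle (mon u) (shuffle (mon v) (mon w))"
proof (induction "length u + length v + length w" arbitrary: u v w rule: less_induct)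
  case less
  show ?case
  proof (cases "u = [] \<or> v = [] \<or> w = []")
    case True
    then show ?thesis by auto
  next
    case False
    then obtain a u' b v' c w' where eqs: "u = a # u'" "v = b # v'" "w = c # w'"
      by (meson neq_Nil_conv)
    define p q r where "p = mon u'" and "q = mon v'" and "r = mon w'"
    note IH = less[unfolded eqs]
    let ?A = "prepend a p" and ?B = "prepend b q" and ?C = "prepend c r"
    have ih:
      "shuffle (shuffle p ?B) ?C = shuffle p (shuffle ?B ?C)"
      "shuffle (shuffle ?A q) ?C = shuffle ?A (shuffle q ?C)"
      "shuffle (shuffle ?A ?B) r = shuffle ?A (shuffle ?B r)"
      unfolding p_def q_def r_def prepend_mon by (rule IH; simp)+
    have l: "shuffle (shuffle ?A ?B) ?C =
       prepend a (shuffle (shuffle p ?B) ?C) + prepend b (shuffle (shuffle ?A q) ?C)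
       + prepend c (shuffle (shuffle ?A ?B) r)"
      by (simp add: shuffle_prepend[of a p b q] shuffle_prepend[where q = r] add_ac)
    have r: "shuffle ?A (shuffle ?B ?C) =
       prepend a (shuffle p (shuffle ?B ?C)) + prepend b (shuffle ?A (shuffle q ?C))
       + prepend c (shuffle ?A (shuffle ?B r))"
      by (simp add: shuffle_prepend[of b q c r] shuffle_prepend[where p = p] add_ac)
    have "shuffle (shuffle ?A ?B) ?C = shuffle ?A (shuffle ?B ?C)"
      unfolding l r ih ..
    then show ?thesis unfolding eqs p_def q_def r_def prepend_mon .
  qed
qed

lemma shuffle_assoc: "shuffle (shuffle p q) r = shuffle p (shuffle q r)"
proof (induction p rule: poly_induct)
  case (mon c u)
  show ?case
  proof (induction q rule: poly_induct)
    case (mon d v)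
    show ?case
      by (induction r rule: poly_induct) (simp_all add: shuffle_assoc_mon scale_add mult.assoc)
  qed (simp_all add: scale_add)
qed simp_all

lemma shuffle_left_comm: "shuffle p (shuffle q r) = shuffle q (shuffle p r)"
  by (metis shuffle_assoc shuffle_comm)

lemmas shuffle_ac = shuffle_assoc shuffle_comm shuffle_left_comm

text \<open>
  The shuffle product is defined by recursion on first letters. It satisfies the same recursion for
  last letters, and this is the one that matches the definition of \<open>tower\<close> below.
\<close>

definition append_letter :: "'a \<Rightarrow> ('a list \<Rightarrow>\<^sub>0 rat) \<Rightarrow> ('a list \<Rightarrow>\<^sub>0 rat)"
  where "append_letter a = lin_ext (\<lambda>w. mon (w @ [a]))"

lemma append_letter_linear [simp]:
  "append_letter a 0 = 0" "append_letter a (p + q) = append_letter a p + append_letter a q"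
  "append_letter a (scale c p) = scale c (append_letter a p)"
  by (simp_all add: append_letter_def lin_ext_add lin_ext_scale)

lemma append_letter_mon: "append_letter a (mon w) = mon (w @ [a])"
  by (simp add: append_letter_def)

lemma append_letter_prepend: "append_letter a (prepend b p) = prepend b (append_letter a p)"
  by (induction p rule: poly_induct) (simp_all add: append_letter_mon prepend_mon)

lemma shuffle_word_snoc:
  "shuffle_word (w @ [a]) (v @ [b]) =
     append_letter a (shuffle_word w (v @ [b])) + append_letter b (shuffle_word (w @ [a]) v)"
proof (induction w v rule: shuffle_word.induct)
  case (1 v)
  then show ?case by (induction v) (simp_all add: append_letter_mon append_letter_prepend prepend_mon add_ac)
next
  case (2 c w)
  have "shuffle_word (u @ [a]) [b] = append_letter a (shuffle_word u [b]) + mon (u @ [a, b])" for u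
    by (induction u) (simp_all add: append_letter_mon append_letter_prepend prepend_mon add_ac)
  from this[of "c # w"] show ?case
    by (simp add: append_letter_mon append_letter_prepend prepend_mon add_ac)
qed (simp_all add: append_letter_prepend add_ac)

lemma shuffle_append_letter:
  "shuffle (append_letter a p) (append_letter b q) =
     append_letter a (shuffle p (append_letter b q)) + append_letter b (shuffle (append_letter a p) q)"
proof (induction p rule: poly_induct)
  case (mon c w)
  show ?case
    by (induction q rule: poly_induct)
      (simp_all add: append_letter_mon shuffle_mon scale_add shuffle_word_snoc algebra_simps)
qed (simp_all add: algebra_simps)

lemma shuffle_word_replicate:
  "shuffle_word (replicate i a) (replicate j a) =
     scale (of_nat ((i + j) choose i)) (mon (replicate (i + j) a))"
proof (induction "i + j" arbitrary: i j)
  case (Suc n)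
  show ?case
  proof (cases "i = 0 \<or> j = 0")
    case False
    then obtain i' j' where ij: "i = Suc i'" "j = Suc j'" by (metis not0_implies_Suc)
    have 1: "shuffle_word (replicate i' a) (a # replicate j' a) = scale (of_nat ((i' + j) choose i')) (mon (replicate (i' + j) a))"
      using Suc(1)[of i' j] Suc(2) ij by simp
    have 2: "shuffle_word (a # replicate i' a) (replicate j' a) = scale (of_nat ((i + j') choose i)) (mon (replicate (i + j') a))"
      using Suc(1)[of i j'] Suc(2) ij by simp
    show ?thesis using ij
      by (simp add: 1 2 prepend_mon scale_add_left[symmetric] add_ac)
  qed auto
qed simp

lemma shuffle_sum_left: "shuffle (sum f A) q = (\<Sum>x\<in>A. shuffle (f x) q)"
  by (induction A rule: infinite_finite_induct) simp_all

lemma shuffle_sum_right: "shuffle p (sum f A) = (\<Sum>x\<in>A. shuffle p (f x))"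
  by (induction A rule: infinite_finite_induct) simp_all

lemma append_letter_sum: "append_letter a (sum f A) = (\<Sum>x\<in>A. append_letter a (f x))"
  by (simp add: append_letter_def lin_ext_sum)

text \<open>
  The series of words \<open>a\<^sup>n\<close> is \<open>exp a\<close> for the shuffle product; its inverse is \<open>exp (- a)\<close>.
\<close>

lemma alternating_shuffle_powers:
  "(\<Sum>j\<le>n. scale ((-1) ^ j) (shuffle (mon (replicate (n - j) a)) (mon (replicate j a)))) =
     (if n = 0 then mon [] else 0)"
proof -
  have "(\<Sum>j\<le>n. scale ((-1) ^ j) (shuffle (mon (replicate (n - j) a)) (mon (replicate j a)))) =
    (\<Sum>j\<le>n. scale ((-1) ^ j * of_nat (n choose j)) (mon (replicate n a)))"
    by (intro sum.cong refl) (simp add: shuffle_mon shuffle_word_replicate binomial_symmetric[symmetric])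
  also have "\<dots> = scale (\<Sum>j\<le>n. (-1) ^ j * of_nat (n choose j)) (mon (replicate n a))"
    by (rule poly_mapping_eqI) (simp add: lookup_sum sum_distrib_right)
  finally show ?thesis
    using choose_alternating_sum[of n, where ?'a = rat] by auto
qed

section \<open>Convolution with respect to deconcatenation\<close>

type_synonym 'b poly_word = "'b list \<Rightarrow>\<^sub>0 rat"

text \<open>
  The convolution of \<open>f\<close> and \<open>g\<close> for the product \<open>m\<close> sums \<open>m (f u) (g v)\<close> over all \<open>w = u @ v\<close>; see
  \<open>conv_eq_sum\<close>. The recursive form makes associativity and multiplicativity short inductions.
\<close>

primrec conv :: "('b poly_word \<Rightarrow> 'b poly_word \<Rightarrow> 'b poly_word) \<Rightarrow>
    ('a list \<Rightarrow> 'b poly_word) \<Rightarrow> ('a list \<Rightarrow> 'b poly_word) \<Rightarrow> 'a list \<Rightarrow> 'b poly_word"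
  where
    "conv m f g [] = m (f []) (g [])"
  | "conv m f g (a # w) = m (f []) (g (a # w)) + conv m (\<lambda>u. f (a # u)) g w"

lemma conv_eq_sum: "conv m f g w = (\<Sum>i\<le>length w. m (f (take i w)) (g (drop i w)))"
  by (induction w arbitrary: f) (simp_all add: sum.atMost_Suc_shift del: sum.atMost_Suc)

lemma conv_assoc:
  assumes ass: "\<And>p q r. m (m p q) r = m p (m q r)"
    and add: "\<And>p q r. m (p + q) r = m p r + m q r" "\<And>p q r. m p (q + r) = m p q + m p r"
  shows "conv m (conv m f g) h w = conv m f (conv m g h) w"
proof (induction w arbitrary: f g)
  case (Cons a w)
  have 1: "conv m (\<lambda>w. p w + q w) h w = conv m p h w + conv m q h w" for p q
    by (simp add: conv_eq_sum add sum.distrib)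
  have "conv m (\<lambda>w. m p (q w)) h w = m p (conv m q h w)" for p q
  proof (induction w arbitrary: q)
    case Nil show ?case by (simp add: ass)
  next
    case (Cons b v)
    show ?case using Cons[of "\<lambda>u. q (b # u)"] by (simp add: ass add)
  qed
  then show ?case using Cons[of "\<lambda>u. f (a # u)" g] by (simp add: 1 ass add)
qed (simp add: ass)

lemma conv_cong:
  assumes "\<And>i. i \<le> length w \<Longrightarrow> f (take i w) = f' (take i w)"
    and "\<And>i. i \<le> length w \<Longrightarrow> g (drop i w) = g' (drop i w)"
  shows "conv m f g w = conv m f' g' w"
  unfolding conv_eq_sum using assms by (intro sum.cong) auto

primrec deconcat :: "('a list \<Rightarrow> 'a list \<Rightarrow> 'b poly_word) \<Rightarrow> 'a list \<Rightarrow> 'b poly_word"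
  where
    "deconcat h [] = h [] []"
  | "deconcat h (a # w) = h [] (a # w) + deconcat (\<lambda>u. h (a # u)) w"

lemma deconcat_conv: "deconcat (\<lambda>u v. m (f u) (g v)) w = conv m f g w"
  by (induction w arbitrary: f) simp_all

text \<open>
  A common generalisation of the shuffle product (\<open>c = 0\<close>) and the stuffle product (\<open>c = 1\<close>), so that
  compatibility with deconcatenation is proved only once.
\<close>

fun qshuffle_word :: "rat \<Rightarrow> ('a \<Rightarrow> 'a \<Rightarrow> 'a) \<Rightarrow> 'a list \<Rightarrow> 'a list \<Rightarrow> ('a list \<Rightarrow>\<^sub>0 rat)"
  where
    "qshuffle_word c m [] v = mon v"
  | "qshuffle_word c m (a # w) [] = mon (a # w)"
  | "qshuffle_word c m (a # w) (b # v) =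
       prepend a (qshuffle_word c m w (b # v)) + prepend b (qshuffle_word c m (a # w) v)
       + scale c (prepend (m a b) (qshuffle_word c m w v))"

lemma stuffle_word_eq_qshuffle: "stuffle_word w v = qshuffle_word 1 (+) w v"
  by (induction w v rule: stuffle_word.induct) simp_all

lemma shuffle_word_eq_qshuffle: "shuffle_word w v = qshuffle_word 0 (\<lambda>a b. a) w v"
  by (induction w v rule: shuffle_word.induct) simp_all

lemma qshuffle_word_Nil2 [simp]: "qshuffle_word c m w [] = mon w"
  by (cases w) simp_all

lemma lin_ext_deconcat_Cons: "lin_ext (\<lambda>w. deconcat h (a # w)) p = lin_ext (\<lambda>w. h [] (a # w)) p + lin_ext (deconcat (\<lambda>u. h (a # u))) p"
  by (simp add: lin_ext_fun_add)

lemma bilin_ext_simps [simp]: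
  "bilin_ext h (p + p') q = bilin_ext h p q + bilin_ext h p' q"
  "bilin_ext h (scale c p) q = scale c (bilin_ext h p q)"
  "bilin_ext h (prepend a p) q = bilin_ext (\<lambda>u. h (a # u)) p q"
  "bilin_ext h (mon w) q = lin_ext (h w) q"
  by (simp_all add: bilin_ext_def lin_ext_add lin_ext_scale lin_ext_prepend)

text \<open>
  Deconcatenation is a homomorphism for quasi-shuffle products. It is stated in the dual form, with a
  test function \<open>h\<close> on pairs of words; generalising over \<open>h\<close> lets the induction split off the first
  letter of the left part. The first letter of a term of the product comes from one of the two factors
  or from a merger of both, and these are the three terms of the recursion.
\<close>

lemma deconcat_qshuffle:
  "lin_ext (deconcat h) (qshuffle_word c m w v) =
     (\<Sum>i\<le>length w. \<Sum>j\<le>length v.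
        bilin_ext h (qshuffle_word c m (take i w) (take j v)) (qshuffle_word c m (drop i w) (drop j v)))"
proof (induction w v arbitrary: h rule: qshuffle_word.induct[of _ c m])
  case (1 c m v)
  show ?case by (induction v arbitrary: h) (simp_all add: sum.atMost_Suc_shift del: sum.atMost_Suc)
next
  case (2 c m a w)
  show ?case by (induction w arbitrary: a h) (simp_all add: sum.atMost_Suc_shift del: sum.atMost_Suc)
next
  case (3 c m a w b v)
  let ?Q = "qshuffle_word c m"
  have "lin_ext (deconcat h) (?Q (a # w) (b # v)) =
     lin_ext (h []) (?Q (a # w) (b # v))
     + lin_ext (deconcat (\<lambda>u. h (a # u))) (?Q w (b # v))
     + lin_ext (deconcat (\<lambda>u. h (b # u))) (?Q (a # w) v)
     + scale c (lin_ext (deconcat (\<lambda>u. h (m a b # u))) (?Q w v))"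
    by (simp add: lin_ext_add lin_ext_scale lin_ext_prepend lin_ext_deconcat_Cons scale_add add_ac
        del: deconcat.simps(2))
  then show ?case
    unfolding 3 by (simp add: sum.atMost_Suc_shift sum.distrib scale_sum scale_add add_ac del: sum.atMost_Suc)
qed

lemma bilin_ext_shuffle:
  "bilin_ext (\<lambda>u v. shuffle (f u) (g v)) p q = shuffle (lin_ext f p) (lin_ext g q)"
proof -
  have "lin_ext (\<lambda>v. shuffle r (g v)) q = shuffle r (lin_ext g q)" for r
    by (induction q rule: poly_induct) (simp_all add: lin_ext_add lin_ext_scale)
  then show ?thesis
    unfolding bilin_ext_def by (induction p rule: poly_induct) (simp_all add: lin_ext_add lin_ext_scale)
qed

lemma bilin_ext_stuffle:
  "bilin_ext (\<lambda>u v. stuffle (f u) (g v)) p q = stuffle (lin_ext f p) (lin_ext g q)"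
proof -
  have "lin_ext (\<lambda>v. stuffle r (g v)) q = stuffle r (lin_ext g q)" for r
    by (induction q rule: poly_induct) (simp_all add: lin_ext_add lin_ext_scale)
  then show ?thesis
    unfolding bilin_ext_def by (induction p rule: poly_induct) (simp_all add: lin_ext_add lin_ext_scale)
qed

lemma lin_ext_shuffle:
  assumes "\<And>w v. lin_ext f (shuffle_word w v) = shuffle (f w) (f v)"
  shows "lin_ext f (shuffle p q) = shuffle (lin_ext f p) (lin_ext f q)"
proof (induction p rule: poly_induct)
  case (mon c w)
  show ?case
    by (induction q rule: poly_induct) (simp_all add: lin_ext_add lin_ext_scale shuffle_mon assms scale_add)
qed (simp_all add: lin_ext_add)

lemma conv_shuffle_hom:
  assumes f: "\<And>w v. lin_ext f (shuffle_word w v) = shuffle (f w) (f v)"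
    and g: "\<And>w v. lin_ext g (shuffle_word w v) = shuffle (g w) (g v)"
  shows "lin_ext (conv shuffle f g) (shuffle_word w v) = shuffle (conv shuffle f g w) (conv shuffle f g v)"
proof -
  have "lin_ext (conv shuffle f g) (shuffle_word w v) = lin_ext (deconcat (\<lambda>u v. shuffle (f u) (g v))) (shuffle_word w v)"
    by (simp add: deconcat_conv[abs_def])
  also have "\<dots> = (\<Sum>i\<le>length w. \<Sum>j\<le>length v. shuffle (shuffle (f (take i w)) (f (take j v)))
         (shuffle (g (drop i w)) (g (drop j v))))"
    unfolding shuffle_word_eq_qshuffle deconcat_qshuffle bilin_ext_shuffle
    unfolding shuffle_word_eq_qshuffle[symmetric] f g ..
  also have "\<dots> = shuffle (conv shuffle f g w) (conv shuffle f g v)"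
    by (simp add: conv_eq_sum shuffle_sum_left shuffle_sum_right shuffle_ac)
  finally show ?thesis .
qed

section \<open>Shuffle regularisation\<close>

lemma keys_shuffle_word:
  "t \<in> supp (shuffle_word w v) \<Longrightarrow>
     length t = length w + length v \<and> set t = set w \<union> set v \<and>
     (t \<noteq> [] \<longrightarrow> w \<noteq> [] \<and> last t = last w \<or> v \<noteq> [] \<and> last t = last v)"
proof (induction w v arbitrary: t rule: shuffle_word.induct)
  case (3 a w b v)
  have "t \<in> supp (prepend a (shuffle_word w (b # v))) \<union> supp (prepend b (shuffle_word (a # w) v))"
    using 3(3) keys_add by fastforce
  then show ?case
  proof
    assume "t \<in> supp (prepend a (shuffle_word w (b # v)))"
    then obtain s where s: "t = a # s" "s \<in> supp (shuffle_word w (b # v))"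
      by (auto simp: keys_prepend)
    with 3(1)[OF s(2)] have "s \<noteq> []" by auto
    with 3(1)[OF s(2)] s show ?thesis by (cases "w = []") auto
  next
    assume "t \<in> supp (prepend b (shuffle_word (a # w) v))"
    then obtain s where s: "t = b # s" "s \<in> supp (shuffle_word (a # w) v)"
      by (auto simp: keys_prepend)
    with 3(2)[OF s(2)] have "s \<noteq> []" by auto
    with 3(2)[OF s(2)] s show ?thesis by (cases "v = []") auto
  qed
qed auto

text \<open>
  The homomorphism from the shuffle algebra to the polynomials in the letter \<open>a\<close> that kills all other
  letters and rescales \<open>a\<close> by \<open>c\<close>.
\<close>

definition letter_power :: "'a \<Rightarrow> rat \<Rightarrow> 'a list \<Rightarrow> ('a list \<Rightarrow>\<^sub>0 rat)"
  where "letter_power a c w = (if set w \<subseteq> {a} then scale (c ^ length w) (mon w) else 0)"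

lemma letter_power_shuffle:
  "lin_ext (letter_power a c) (shuffle_word w v) = shuffle (letter_power a c w) (letter_power a c v)"
proof -
  have "lin_ext (letter_power a c) (shuffle_word w v) =
     lin_ext (\<lambda>t. if set w \<union> set v \<subseteq> {a} then scale (c ^ (length w + length v)) (mon t) else 0) (shuffle_word w v)"
    using keys_shuffle_word[of _ w v] by (intro lin_ext_cong) (simp add: letter_power_def)
  also have "\<dots> = shuffle (letter_power a c w) (letter_power a c v)"
    by (auto simp: letter_power_def lin_ext_fun_zero lin_ext_fun_scale shuffle_mon power_add mult.commute)
  finally show ?thesis .
qed

lemma letter_power_Cons:
  "letter_power a c (b # w) = (if b = a then scale c (prepend a (letter_power a c w)) else 0)"
  by (auto simp: letter_power_def prepend_mon)

lemma letter_power_Nil [simp]: "letter_power a c [] = mon []"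
  by (simp add: letter_power_def)

lemma letter_power_replicate: "letter_power a c (replicate n a) = scale (c ^ n) (mon (replicate n a))"
  by (auto simp: letter_power_def)

text \<open>
  Shuffle regularisation: the Taylor-type formula \<open>\<Sum>\<^sub>i (-1)\<^sup>i y\<^sup>i sh \<partial>\<^sup>i w\<close>, where \<open>\<partial>\<close> removes a leading \<open>y\<close>
  and is zero on words that have none. As \<open>\<partial>\<close> is a derivation of the shuffle product with \<open>\<partial> y = 1\<close>,
  this is the projection onto its kernel that sends \<open>y\<close> to \<open>0\<close>.
\<close>

definition reg_word :: "xy list \<Rightarrow> (xy list \<Rightarrow>\<^sub>0 rat)"
  where "reg_word = conv shuffle (letter_power LY (-1)) mon"

definition reg :: "(xy list \<Rightarrow>\<^sub>0 rat) \<Rightarrow> (xy list \<Rightarrow>\<^sub>0 rat)"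
  where "reg = lin_ext reg_word"

lemma reg_shuffle: "reg (shuffle p q) = shuffle (reg p) (reg q)"
  unfolding reg_def reg_word_def
  by (intro lin_ext_shuffle conv_shuffle_hom letter_power_shuffle) (simp add: shuffle_mon)

lemma letter_power_inverse:
  "conv shuffle (letter_power a 1) (letter_power a (-1)) w = (if w = [] then mon [] else 0)"
proof (cases "set w \<subseteq> {a}")
  case True
  define n where "n = length w"
  have w: "w = replicate n a"
    using True unfolding n_def by (metis replicate_eqI singletonD subset_code(1))
  have "conv shuffle (letter_power a 1) (letter_power a (-1)) w =
     (\<Sum>i\<le>n. scale ((-1) ^ (n - i)) (shuffle (mon (replicate i a)) (mon (replicate (n - i) a))))"
    unfolding conv_eq_sum w
    by (auto intro!: sum.cong simp: letter_power_replicate min_def)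
  also have "\<dots> = (\<Sum>j\<le>n. scale ((-1) ^ j) (shuffle (mon (replicate (n - j) a)) (mon (replicate j a))))"
    by (rule sum.reindex_bij_witness[of _ "\<lambda>j. n - j" "\<lambda>j. n - j"]) auto
  finally show ?thesis
    unfolding alternating_shuffle_powers by (simp add: n_def)
next
  case False
  have "shuffle (letter_power a 1 (take i w)) (letter_power a (-1) (drop i w)) = 0" for i
  proof -
    have "\<not> (set (take i w) \<subseteq> {a} \<and> set (drop i w) \<subseteq> {a})"
      using False by (metis append_take_drop_id le_sup_iff set_append)
    then show ?thesis by (auto simp: letter_power_def)
  qed
  then show ?thesis using False by (auto simp: conv_eq_sum)
qed

lemma conv_unit_left: "conv shuffle (\<lambda>w. if w = [] then mon [] else 0) g w = g w"
proof (cases w)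
  case (Cons a v)
  have "conv shuffle (\<lambda>w. 0) g v = 0" by (simp add: conv_eq_sum)
  then show ?thesis using Cons by simp
qed simp

text \<open>
  The inverse of the regularisation: a word is recovered from the regularised values of its final parts
  and the powers of \<open>y\<close> in front of them.
\<close>

lemma conv_letter_power_reg: "conv shuffle (letter_power LY 1) reg_word w = mon w"
proof -
  have "conv shuffle (letter_power LY 1) reg_word w =
    conv shuffle (conv shuffle (letter_power LY 1) (letter_power LY (-1))) mon w"
    unfolding reg_word_def by (rule conv_assoc[symmetric]) (simp_all add: shuffle_assoc)
  also have "\<dots> = mon w"
    by (simp add: letter_power_inverse[abs_def] conv_unit_left)
  finally show ?thesis .
qed

text \<open>
  The derivation \<open>\<partial>\<close> above, for an arbitrary letter.
\<close>

definition strip_letter :: "'a \<Rightarrow> 'a list \<Rightarrow> ('a list \<Rightarrow>\<^sub>0 rat)"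
  where "strip_letter a w = (case w of [] \<Rightarrow> 0 | b # v \<Rightarrow> if b = a then mon v else 0)"

lemma strip_letter_simps [simp]: "strip_letter a [] = 0" "strip_letter a (b # v) = (if b = a then mon v else 0)"
  by (simp_all add: strip_letter_def)

lemma lin_ext_strip_letter_prepend: "lin_ext (strip_letter a) (prepend b p) = (if b = a then p else 0)"
  by (simp add: lin_ext_prepend lin_ext_fun_zero)

lemma strip_letter_shuffle:
  "lin_ext (strip_letter a) (shuffle p q) = shuffle (lin_ext (strip_letter a) p) q + shuffle p (lin_ext (strip_letter a) q)"
proof -
  have 1: "lin_ext (strip_letter a) (shuffle_word w v) = shuffle (strip_letter a w) (mon v) + shuffle (mon w) (strip_letter a v)" for w v
    by (induction w v rule: shuffle_word.induct)
      (simp_all add: lin_ext_add lin_ext_strip_letter_prepend shuffle_mon)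
  show ?thesis
  proof (induction p rule: poly_induct)
    case (mon c w)
    show ?case
      by (induction q rule: poly_induct)
        (simp_all add: lin_ext_add lin_ext_scale shuffle_mon 1 scale_add algebra_simps)
  qed (simp_all add: lin_ext_add algebra_simps)
qed

lemma conv_zero: "conv shuffle (\<lambda>u. 0) g w = 0"
  by (simp add: conv_eq_sum)

lemma shuffle_uminus: "shuffle (- p) q = - shuffle p q"
  using shuffle_linear(5)[of "-1" p q] by (simp add: scale_uminus)

text \<open>
  If the left factor is supported on powers of \<open>a\<close>, a nonzero summand has the form \<open>a\<^sup>i\<close> times the
  rest of the word after \<open>a\<^sup>i\<^sup>+\<^sup>1\<close>; so removing the letter after the cut is the same as removing the
  letter in front of the whole word.
\<close>

lemma conv_strip_letter:
  assumes "\<And>w. \<not> set w \<subseteq> {a} \<Longrightarrow> f w = 0"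
  shows "conv shuffle f (strip_letter a) (a # w) = conv shuffle f mon w"
  using assms
proof (induction w arbitrary: f)
  case (Cons b w)
  show ?case
  proof (cases "b = a")
    case True
    then show ?thesis using Cons(1)[of "\<lambda>u. f (a # u)"] Cons(2) by simp
  next
    case False
    have "f (b # u) = 0" "f (a # b # u) = 0" for u using Cons(2) False by auto
    then show ?thesis using False by (simp add: conv_zero)
  qed
qed simp

text \<open>
  Applying the derivation to \<open>(-1)\<^sup>i y\<^sup>i sh \<partial>\<^sup>i w\<close> gives two terms, and the sum over \<open>i\<close> telescopes.
\<close>

lemma strip_letter_reg: "lin_ext (strip_letter LY) (reg p) = 0"
proof -
  let ?f = "letter_power LY (-1)"
  have 1: "lin_ext (strip_letter LY) (conv shuffle f mon w) =
     conv shuffle (\<lambda>u. lin_ext (strip_letter LY) (f u)) mon w + conv shuffle f (strip_letter LY) w" for f w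
    by (simp add: conv_eq_sum lin_ext_sum strip_letter_shuffle sum.distrib)
  have "lin_ext (strip_letter LY) (reg_word w) = 0" for w
  proof (cases w)
    case (Cons b v)
    have 2: "lin_ext (strip_letter LY) (?f (LY # u)) = - ?f u" for u
      by (simp add: letter_power_Cons lin_ext_uminus lin_ext_strip_letter_prepend scale_uminus)
    have 3: "?f (b # u) = 0" if "b \<noteq> LY" for u
      using that by (simp add: letter_power_Cons)
    show ?thesis
    proof (cases "b = LY")
      case True
      have "conv shuffle ?f (strip_letter LY) (LY # v) = conv shuffle ?f mon v"
        by (rule conv_strip_letter) (simp add: letter_power_def)
      moreover have "conv shuffle (\<lambda>u. - ?f u) mon v = - conv shuffle ?f mon v"
        by (simp add: conv_eq_sum shuffle_uminus sum_negf)
      ultimately show ?thesis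
        unfolding reg_word_def 1 Cons True by (simp add: 2)
    next
      case False
      then show ?thesis
        unfolding reg_word_def 1 Cons by (simp add: 3 conv_zero)
    qed
  qed (simp add: reg_word_def)
  then show ?thesis
    by (simp add: reg_def lin_ext_lin_ext lin_ext_fun_zero)
qed

lemma keys_reg_not_LY: "w \<in> supp (reg p) \<Longrightarrow> w = [] \<or> hd w \<noteq> LY"
proof (cases w)
  case (Cons b v)
  have "lookup (lin_ext (strip_letter LY) q) v = lookup q (LY # v)" for q
    by (induction q rule: poly_induct)
      (auto simp: lin_ext_add lin_ext_scale lookup_add strip_letter_def lookup_single when_def split: list.split)
  from this[of "reg p"] show "w \<in> supp (reg p) \<Longrightarrow> w = [] \<or> hd w \<noteq> LY"
    using Cons by (auto simp: strip_letter_reg in_keys_iff)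
qed simp

lemma reg_replicate_LY: "reg (mon (replicate n LY)) = (if n = 0 then mon [] else 0)"
proof (cases n)
  case (Suc k)
  have "reg_word (replicate n LY) = (\<Sum>i\<le>n. scale ((-1) ^ i) (shuffle (mon (replicate i LY)) (mon (replicate (n - i) LY))))"
    unfolding reg_word_def conv_eq_sum by (auto intro!: sum.cong simp: letter_power_replicate min_def)
  also have "\<dots> = (\<Sum>i\<le>n. scale ((-1) ^ i) (shuffle (mon (replicate (n - i) LY)) (mon (replicate i LY))))"
    by (simp add: shuffle_comm)
  finally show ?thesis
    using alternating_shuffle_powers[of n LY] Suc by (simp add: reg_def)
qed (simp add: reg_def reg_word_def)

section \<open>Iterated integrals attached to words in the lower entries\<close>

text \<open>
  Consider \<open>d\<^sub>i\<close> labelled letters \<open>x\<close> of colour \<open>i\<close> for each \<open>i\<close>, and one letter \<open>y\<^sub>i\<close> for each \<open>i\<close>. Then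
  \<open>tower_word [d\<^sub>1, \<dots>, d\<^sub>r]\<close> is the sum of all arrangements in which the \<open>y\<close> occur in the order
  \<open>y\<^sub>r, \<dots>, y\<^sub>1\<close> and every \<open>x\<close> of colour \<open>i\<close> precedes \<open>y\<^sub>i\<close>. Thus the coefficient of
  \<open>x^n\<^sub>1 y x^n\<^sub>2 y \<dots> x^n\<^sub>r y\<close> is that of the product of the \<open>Y\<^sub>i^d\<^sub>i / d\<^sub>i!\<close> in
  \<open>(Y\<^sub>1 + \<dots> + Y\<^sub>r)^n\<^sub>1 (Y\<^sub>1 + \<dots> + Y\<^sub>r\<^sub>-\<^sub>1)^n\<^sub>2 \<dots> Y\<^sub>1^n\<^sub>r\<close>, which is a coefficient of the swap.
\<close>

primrec tower_word :: "nat list \<Rightarrow> (xy list \<Rightarrow>\<^sub>0 rat)"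
  where
    "tower_word [] = mon []"
  | "tower_word (d # ds) =
       append_letter LY (shuffle (scale (fact d) (mon (replicate d LX))) (tower_word ds))"

definition tower :: "(nat list \<Rightarrow>\<^sub>0 rat) \<Rightarrow> (xy list \<Rightarrow>\<^sub>0 rat)"
  where "tower = lin_ext tower_word"

lemma lin_ext_append_shuffle:
  "lin_ext (\<lambda>w. append_letter a (shuffle q (f w))) p = append_letter a (shuffle q (lin_ext f p))"
  by (induction p rule: poly_induct) (simp_all add: lin_ext_add lin_ext_scale)

lemma tower_prepend:
  "tower (prepend d p) = append_letter LY (shuffle (scale (fact d) (mon (replicate d LX))) (tower p))"
  unfolding tower_def lin_ext_prepend tower_word.simps by (rule lin_ext_append_shuffle)

lemma tower_mon [simp]: "tower (mon w) = tower_word w"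
  by (simp add: tower_def)

text \<open>
  The last letter of a term on the right is the \<open>y\<close> that belongs to the first letter of one of the two
  words. So the recursion of the shuffle product on last letters in \<open>x, y\<close> matches its recursion on
  first letters of the words in the lower entries.
\<close>

lemma tower_shuffle: "tower (shuffle p q) = shuffle (tower p) (tower q)"
  unfolding tower_def
proof (rule lin_ext_shuffle)
  show "lin_ext tower_word (shuffle_word w v) = shuffle (tower_word w) (tower_word v)" for w v
    unfolding tower_def[symmetric]
  proof (induction w v rule: shuffle_word.induct)
    case (3 d w e v)
    let ?x = "\<lambda>d. scale (fact d) (mon (replicate d LX))"
    have "tower (shuffle_word (d # w) (e # v)) =
      append_letter LY (shuffle (?x d) (shuffle (tower_word w) (tower_word (e # v))))
      + append_letter LY (shuffle (?x e) (shuffle (tower_word (d # w)) (tower_word v)))"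
      unfolding 3[symmetric] tower_prepend[symmetric] by (simp add: tower_def lin_ext_add)
    also have "\<dots> = shuffle (tower_word (d # w)) (tower_word (e # v))"
      by (simp only: tower_word.simps shuffle_append_letter[of LY _ LY]) (simp only: shuffle_ac)
    finally show ?case .
  qed simp_all
qed

text \<open>
  All ways to put a new \<open>y\<close> in front of every other \<open>y\<close>, together with \<open>m\<close> unlabelled new letters \<open>x\<close>
  in front of the new \<open>y\<close>. In terms of the arrangements that define \<open>tower_word\<close>, this adds the last
  colour, whereas the definition of \<open>tower_word\<close> adds the first one; the recursion for the coefficients
  of the swap removes the last one.
\<close>

fun insert_y_word :: "nat \<Rightarrow> xy list \<Rightarrow> (xy list \<Rightarrow>\<^sub>0 rat)"
  where
    "insert_y_word 0 (LX # w) = mon (LY # LX # w) + prepend LX (insert_y_word 0 w)"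
  | "insert_y_word 0 w = mon (LY # w)"
  | "insert_y_word (Suc m) (LX # w) = prepend LX (insert_y_word m (LX # w)) + prepend LX (insert_y_word (Suc m) w)"
  | "insert_y_word (Suc m) w = prepend LX (insert_y_word m w)"

definition insert_y :: "nat \<Rightarrow> (xy list \<Rightarrow>\<^sub>0 rat) \<Rightarrow> (xy list \<Rightarrow>\<^sub>0 rat)"
  where "insert_y m = lin_ext (insert_y_word m)"

lemma insert_y_linear [simp]:
  "insert_y m 0 = 0" "insert_y m (p + q) = insert_y m p + insert_y m q" "insert_y m (scale c p) = scale c (insert_y m p)"
  "insert_y m (mon w) = insert_y_word m w"
  by (simp_all add: insert_y_def lin_ext_add lin_ext_scale)

lemma lookup_insert_y_word:
  "lookup (insert_y_word m u) (replicate n LX @ LY # t) =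
     (if m \<le> n \<and> u = replicate (n - m) LX @ t then of_nat (n choose m) else 0)"
proof (induction m u arbitrary: n rule: insert_y_word.induct)
  case (1 w)
  then show ?case
    by (cases n) (auto simp: lookup_add lookup_prepend lookup_single when_def)
next
  case ("2_1")
  then show ?case by (cases n) (auto simp: lookup_single when_def)
next
  case ("2_2" w)
  then show ?case by (cases n) (auto simp: lookup_single when_def)
next
  case (3 m w)
  show ?case
  proof (cases n)
    case (Suc k)
    consider r where "k = Suc (m + r)" | "m = k" | "k < m"
      by (metis less_iff_Suc_add nat_neq_iff)
    then show ?thesis
      using 3[of k] Suc by cases (auto simp: lookup_add lookup_prepend)
  qed (simp add: lookup_add lookup_prepend)
next
  case ("4_1" m)
  show ?case
  proof (cases n)
    case (Suc k)
    consider r where "k = Suc (m + r)" | "m = k" | "k < m"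
      by (metis less_iff_Suc_add nat_neq_iff)
    then show ?thesis
      using "4_1"[of k] Suc by cases (auto simp: lookup_prepend)
  qed (simp add: lookup_prepend)
next
  case ("4_2" m w)
  show ?case
  proof (cases n)
    case (Suc k)
    consider r where "k = Suc (m + r)" | "m = k" | "k < m"
      by (metis less_iff_Suc_add nat_neq_iff)
    then show ?thesis
      using "4_2"[of k] Suc by cases (auto simp: lookup_prepend)
  qed (simp add: lookup_prepend)
qed

lemma lookup_insert_y:
  "lookup (insert_y m p) (replicate n LX @ LY # t) =
     (if m \<le> n then of_nat (n choose m) * lookup p (replicate (n - m) LX @ t) else 0)"
  by (induction p rule: poly_induct)
    (auto simp: lookup_add lookup_insert_y_word lookup_single when_def algebra_simps)

lemma insert_y_append_letter_LY: "insert_y m (append_letter LY p) = append_letter LY (insert_y m p)"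
proof -
  have "insert_y_word m (w @ [LY]) = append_letter LY (insert_y_word m w)" for w
    by (induction m w rule: insert_y_word.induct) (simp_all add: append_letter_mon append_letter_prepend)
  then show ?thesis by (induction p rule: poly_induct) (simp_all add: append_letter_mon)
qed

lemma shuffle_single_prepend:
  "shuffle (mon [a]) (prepend b p) = prepend a (prepend b p) + prepend b (shuffle (mon [a]) p)"
  by (induction p rule: poly_induct) (simp_all add: prepend_mon shuffle_mon scale_add algebra_simps)

lemma insert_y_prepend:
  "insert_y 0 (prepend LX p) = prepend LY (prepend LX p) + prepend LX (insert_y 0 p)"
  "insert_y 0 (prepend LY p) = prepend LY (prepend LY p)"
  "insert_y (Suc m) (prepend LX p) = prepend LX (insert_y m (prepend LX p)) + prepend LX (insert_y (Suc m) p)"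
  "insert_y (Suc m) (prepend LY p) = prepend LX (insert_y m (prepend LY p))"
  by (induction p rule: poly_induct; simp add: prepend_mon scale_add add_ac)+

text \<open>
  The letter \<open>x\<close> that is shuffled in is subject to no constraint, so it does not interfere with the
  insertion.
\<close>

lemma insert_y_shuffle_LX: "insert_y m (shuffle (mon [LX]) p) = shuffle (mon [LX]) (insert_y m p)"
proof -
  have *: "insert_y m (shuffle_word [LX] w) = shuffle (mon [LX]) (insert_y_word m w)" for w
  proof (induction m w rule: insert_y_word.induct)
    case (1 w)
    then show ?case
      by (simp add: insert_y_prepend shuffle_single_prepend shuffle_mon prepend_mon add_ac)
  next
    case "2_1"
    show ?case by (simp add: shuffle_mon prepend_mon)
  next
    case ("2_2" w)
    show ?case by (simp add: insert_y_prepend shuffle_mon prepend_mon)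
  next
    case (3 m w)
    have "prepend LX (insert_y m (shuffle_word [LX] (LX # w))) = prepend LX (shuffle (mon [LX]) (insert_y_word m (LX # w)))"
      using 3(1) by simp
    then show ?case
      using 3(2) by (simp add: insert_y_prepend shuffle_single_prepend prepend_mon add_ac)
  next
    case ("4_1" m)
    then show ?case by (simp add: shuffle_single_prepend prepend_mon)
  next
    case ("4_2" m w)
    have "prepend LX (insert_y m (shuffle_word [LX] (LY # w))) = prepend LX (shuffle (mon [LX]) (insert_y_word m (LY # w)))"
      using "4_2" by simp
    then show ?case
      by (simp add: insert_y_prepend shuffle_single_prepend prepend_mon add_ac)
  qed
  show ?thesis by (induction p rule: poly_induct) (simp_all add: shuffle_mon *)
qed

lemma power_LX: "mon (replicate (Suc d) LX) = scale (1 / of_nat (Suc d)) (shuffle (mon [LX]) (mon (replicate d LX)))"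
  using shuffle_word_replicate[of 1 LX d] by (simp add: shuffle_mon)

lemma insert_y_shuffle_power: "insert_y m (shuffle (mon (replicate d LX)) p) = shuffle (mon (replicate d LX)) (insert_y m p)"
proof (induction d)
  case (Suc d)
  then show ?case unfolding power_LX by (simp add: shuffle_assoc insert_y_shuffle_LX)
qed simp

lemma tower_word_snoc: "tower_word (ds @ [m]) = scale (fact m) (insert_y m (tower_word ds))"
proof (induction ds)
  case Nil
  have "insert_y_word m [] = mon (replicate m LX @ [LY])"
    by (induction m) (simp_all add: prepend_mon)
  then show ?case by (simp add: append_letter_mon)
next
  case (Cons d ds)
  then show ?case by (simp add: insert_y_append_letter_LY insert_y_shuffle_power mult.commute)
qed

section \<open>Words in x, y and words in the letters z\<close>

definition xy_word :: "nat list \<Rightarrow> xy list"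
  where "xy_word ks = concat (map (\<lambda>k. replicate (k - 1) LX @ [LY]) ks)"

lemma xy_word_simps [simp]:
  "xy_word [] = []" "xy_word (k # ks) = replicate (k - 1) LX @ LY # xy_word ks"
  "xy_word (ks @ ls) = xy_word ks @ xy_word ls"
  by (simp_all add: xy_word_def)

lemma to_xy_eq: "to_xy = lin_ext (\<lambda>ks. mon (xy_word ks))"
  by (simp add: to_xy_def xy_word_def)

text \<open>
  Reads a word in \<open>x\<close> and \<open>y\<close> in the letters \<open>z\<^sub>k = x\<^sup>k\<^sup>-\<^sup>1 y\<close>, the argument \<open>n\<close> counting the letters \<open>x\<close>
  since the last \<open>y\<close>. A final block of letters \<open>x\<close> is dropped; such words are not \<open>y_closed\<close>.
\<close>

fun z_word :: "nat \<Rightarrow> xy list \<Rightarrow> nat list"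
  where
    "z_word n [] = []"
  | "z_word n (LX # w) = z_word (Suc n) w"
  | "z_word n (LY # w) = Suc n # z_word 0 w"

definition from_xy :: "(xy list \<Rightarrow>\<^sub>0 rat) \<Rightarrow> (nat list \<Rightarrow>\<^sub>0 rat)"
  where "from_xy = lin_ext (\<lambda>w. mon (z_word 0 w))"

lemma xy_linear [simp]:
  "to_xy 0 = 0" "to_xy (p + q) = to_xy p + to_xy q" "to_xy (p - q) = to_xy p - to_xy q"
  "to_xy (scale c p) = scale c (to_xy p)" "to_xy (mon ks) = mon (xy_word ks)"
  "from_xy 0 = 0" "from_xy (p' + q') = from_xy p' + from_xy q'"
  "from_xy (p' - q') = from_xy p' - from_xy q'"
  "from_xy (scale c p') = scale c (from_xy p')" "from_xy (mon w) = mon (z_word 0 w)"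
  by (simp_all add: to_xy_eq from_xy_def lin_ext_add lin_ext_minus lin_ext_scale)

lemma z_word_replicate: "z_word n (replicate m LX @ LY # t) = Suc (n + m) # z_word 0 t"
  by (induction m arbitrary: n) simp_all

lemma z_word_xy_word: "\<forall>k\<in>set ks. 1 \<le> k \<Longrightarrow> z_word 0 (xy_word ks) = ks"
  by (induction ks) (simp_all add: z_word_replicate)

text \<open>
  The words that belong to \<open>\<rat> + \<rat>\<langle>x, y\<rangle> y\<close>.
\<close>

definition y_closed :: "xy list set"
  where "y_closed = {w. w = [] \<or> last w = LY}"

lemma xy_word_closed: "xy_word ks \<in> y_closed"
  by (induction ks rule: rev_induct) (auto simp: y_closed_def)

lemma xy_word_z_word: "w \<in> y_closed \<Longrightarrow> xy_word (z_word 0 w) = w"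
proof -
  have "xy_word (z_word n w) = replicate n LX @ w" if "w \<noteq> []" "w \<in> y_closed" for n
    using that
  proof (induction n w rule: z_word.induct)
    case (2 n w)
    then show ?case by (cases w) (auto simp: y_closed_def replicate_append_same)
  next
    case (3 n w)
    then show ?case by (cases w) (auto simp: y_closed_def)
  qed simp
  from this[of 0] show "w \<in> y_closed \<Longrightarrow> xy_word (z_word 0 w) = w" by (cases w) auto
qed

lemma z_word_pos: "z_word n w \<in> lists {k. 1 \<le> k}"
  by (induction n w rule: z_word.induct) auto

abbreviation y_polys :: "(xy list \<Rightarrow>\<^sub>0 rat) set"
  where "y_polys \<equiv> {p. supp p \<subseteq> y_closed}"

lemma carrier_H1: "carrier H1 = {p. supp p \<subseteq> lists {k. 1 \<le> k}}"
  by (simp add: H1_def stuffle_algebra_def)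

lemma from_xy_carrier: "from_xy p \<in> carrier H1"
  using keys_lin_ext[of "\<lambda>w. mon (z_word 0 w)" p] z_word_pos by (auto simp: from_xy_def carrier_H1)

lemma from_xy_to_xy: "p \<in> carrier H1 \<Longrightarrow> from_xy (to_xy p) = p"
  unfolding from_xy_def to_xy_eq lin_ext_lin_ext lin_ext_mon
  by (rule lin_ext_id_on) (auto simp: carrier_H1 z_word_xy_word)

lemma to_xy_from_xy: "p \<in> y_polys \<Longrightarrow> to_xy (from_xy p) = p"
  unfolding from_xy_def to_xy_eq lin_ext_lin_ext lin_ext_mon
  by (rule lin_ext_id_on) (auto simp: xy_word_z_word)

lemma shuffle_closed:
  assumes "p \<in> y_polys" "q \<in> y_polys"
  shows "shuffle p q \<in> y_polys"
proof -
  have *: "supp (shuffle_word w v) \<subseteq> y_closed" if "w \<in> y_closed" "v \<in> y_closed" for w v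
  proof
    fix t assume "t \<in> supp (shuffle_word w v)"
    from keys_shuffle_word[OF this] that show "t \<in> y_closed"
      unfolding y_closed_def by auto
  qed
  have "supp (lin_ext (\<lambda>u. lin_ext (shuffle_word u) q) p) \<subseteq> y_closed"
    by (intro keys_lin_ext_subset *) (use assms in auto)
  then show ?thesis by (simp add: shuffle_def bilin_ext_def)
qed

lemma append_letter_closed: "append_letter LY p \<in> y_polys"
  using keys_lin_ext_subset[of p "\<lambda>w. mon (w @ [LY])" y_closed] by (auto simp: append_letter_def y_closed_def)

lemma tower_word_closed: "tower_word ds \<in> y_polys"
proof (cases ds)
  case Nil
  then show ?thesis by (simp add: y_closed_def)
next
  case (Cons d es)
  show ?thesis unfolding Cons tower_word.simps by (rule append_letter_closed)
qed

lemma reg_closed: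
  assumes "p \<in> y_polys"
  shows "reg p \<in> y_polys"
proof -
  have "reg_word w \<in> y_polys" if w: "w \<in> y_closed" for w
  proof -
    have *: "shuffle (letter_power LY (-1) (take i w)) (mon (drop i w)) \<in> y_polys" for i
    proof (rule shuffle_closed)
      have "take i w \<in> y_closed" if "set (take i w) \<subseteq> {LY}"
        using that last_in_set[of "take i w"] unfolding y_closed_def by blast
      then show "letter_power LY (-1) (take i w) \<in> y_polys"
        by (auto simp: letter_power_def dest: keys_scale[THEN subsetD])
      show "mon (drop i w) \<in> y_polys" using w by (cases "i < length w") (auto simp: y_closed_def last_drop)
    qed
    show ?thesis
      unfolding reg_word_def conv_eq_sum mem_Collect_eq by (rule keys_sum_subset) (use * in simp)
  qed
  then show ?thesis
    using assms keys_lin_ext_subset[of p reg_word y_closed] by (auto simp: reg_def)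
qed

section \<open>Congruences modulo ideals of stuffle algebras\<close>

lemma stuffle_algebra_simps:
  "carrier (stuffle_algebra L) = {p. supp p \<subseteq> lists L}"
  "x \<otimes>\<^bsub>stuffle_algebra L\<^esub> y = stuffle x y" "x \<oplus>\<^bsub>stuffle_algebra L\<^esub> y = x + y"
  "\<one>\<^bsub>stuffle_algebra L\<^esub> = mon []" "\<zero>\<^bsub>stuffle_algebra L\<^esub> = 0"
  "c \<odot>\<^bsub>stuffle_algebra L\<^esub> x = scale c x"
  by (simp_all add: stuffle_algebra_def)

text \<open>
  Calculations modulo an ideal of a stuffle algebra are done on representatives, with the congruence
  \<open>\<doteq>\<close>, and are transferred to the quotients only at the end.
\<close>

locale stuffle_ideal =
  fixes L :: "'a::ab_semigroup_add set" and I :: "('a list \<Rightarrow>\<^sub>0 rat) set"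
  assumes closed: "a \<in> L \<Longrightarrow> b \<in> L \<Longrightarrow> a + b \<in> L"
    and ideal: "ideal I (stuffle_algebra L)"
begin

abbreviation "R \<equiv> stuffle_algebra L"

interpretation I: ideal I R by (rule ideal)

lemma carrier_simps [simp]:
  "0 \<in> carrier R" "p \<in> carrier R \<Longrightarrow> q \<in> carrier R \<Longrightarrow> p + q \<in> carrier R"
  "p \<in> carrier R \<Longrightarrow> q \<in> carrier R \<Longrightarrow> p - q \<in> carrier R"
  "p \<in> carrier R \<Longrightarrow> scale c p \<in> carrier R"
  "p \<in> carrier R \<Longrightarrow> q \<in> carrier R \<Longrightarrow> stuffle p q \<in> carrier R"
  "mon w \<in> carrier R \<longleftrightarrow> w \<in> lists L"
  unfolding stuffle_algebra_simps mem_Collect_eq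
  using keys_add[of p q] keys_minus[of p q] keys_scale[of c p] keys_stuffle[of L p q, OF closed]
  by (simp, blast, blast, blast, blast, simp)

lemma sum_carrier: "(\<And>x. x \<in> A \<Longrightarrow> f x \<in> carrier R) \<Longrightarrow> sum f A \<in> carrier R"
  by (induction A rule: infinite_finite_induct) simp_all

lemma lin_ext_carrier:
  "(\<And>w. w \<in> supp p \<Longrightarrow> f w \<in> carrier R) \<Longrightarrow> lin_ext f p \<in> carrier R"
  unfolding lin_ext_def by (intro sum_carrier) simp

lemma ideal_carrier: "p \<in> I \<Longrightarrow> p \<in> carrier R"
  by (rule I.Icarr)

lemma ideal_zero [simp]: "0 \<in> I"
  using additive_subgroup.zero_closed[OF I.is_additive_subgroup] by (simp add: stuffle_algebra_simps)

lemma ideal_add: "p \<in> I \<Longrightarrow> q \<in> I \<Longrightarrow> p + q \<in> I"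
  using additive_subgroup.a_closed[OF I.is_additive_subgroup, of p q] by (simp add: stuffle_algebra_simps)

lemma ideal_mult: "p \<in> I \<Longrightarrow> q \<in> carrier R \<Longrightarrow> stuffle q p \<in> I"
  using I.I_l_closed[of p q] by (simp add: stuffle_algebra_simps)

lemma ideal_scale: "p \<in> I \<Longrightarrow> scale c p \<in> I"
  using ideal_mult[of p "scale c (mon [])"] by (simp add: stuffle_one)

lemma ideal_uminus: "p \<in> I \<Longrightarrow> - p \<in> I"
  using ideal_scale[of p "-1"] by (simp add: scale_uminus)

lemma ideal_minus: "p \<in> I \<Longrightarrow> q \<in> I \<Longrightarrow> p - q \<in> I"
  using ideal_add[of p "-q"] ideal_uminus by simp

definition eqv :: "('a list \<Rightarrow>\<^sub>0 rat) \<Rightarrow> ('a list \<Rightarrow>\<^sub>0 rat) \<Rightarrow> bool"  (infix "\<doteq>" 50)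
  where "p \<doteq> q \<longleftrightarrow> p - q \<in> I"

lemma eqv_refl [simp]: "p \<doteq> p"
  by (simp add: eqv_def)

lemma eqv_sym: "p \<doteq> q \<Longrightarrow> q \<doteq> p"
  using ideal_uminus by (fastforce simp: eqv_def)

lemma eqv_trans [trans]: "p \<doteq> q \<Longrightarrow> q \<doteq> r \<Longrightarrow> p \<doteq> r"
  using ideal_add by (fastforce simp: eqv_def)

lemma eqv_add: "p \<doteq> q \<Longrightarrow> p' \<doteq> q' \<Longrightarrow> p + p' \<doteq> q + q'"
  using ideal_add by (fastforce simp: eqv_def algebra_simps)

lemma eqv_scale: "p \<doteq> q \<Longrightarrow> scale c p \<doteq> scale c q"
  using ideal_scale by (simp add: eqv_def flip: scale_minus_right)

lemma stuffle_minus_left: "stuffle (p - q) r = stuffle p r - stuffle q r"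
  using stuffle_linear(3)[of "p - q" q r] by (simp add: algebra_simps)

lemma eqv_mult_left: "p \<doteq> q \<Longrightarrow> r \<in> carrier R \<Longrightarrow> stuffle p r \<doteq> stuffle q r"
  using ideal_mult[of "p - q" r] by (simp add: eqv_def stuffle_minus_left stuffle_comm[of r])

lemma eqv_mult:
  assumes "p \<doteq> q" "p' \<doteq> q'" "p' \<in> carrier R" "q \<in> carrier R"
  shows "stuffle p p' \<doteq> stuffle q q'"
proof -
  have "stuffle p p' \<doteq> stuffle q p'" using assms by (intro eqv_mult_left)
  also have "\<dots> \<doteq> stuffle q q'"
    using eqv_mult_left[of p' q' q] assms by (simp add: stuffle_comm)
  finally show ?thesis .
qed

lemma eqv_sum: "(\<And>x. x \<in> A \<Longrightarrow> f x \<doteq> g x) \<Longrightarrow> sum f A \<doteq> sum g A"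
  by (induction A rule: infinite_finite_induct) (simp_all add: eqv_add)

lemma eqv_lin_ext:
  "(\<And>w. w \<in> supp p \<Longrightarrow> f w \<doteq> g w) \<Longrightarrow> lin_ext f p \<doteq> lin_ext g p"
  unfolding lin_ext_def by (intro eqv_sum eqv_scale)

lemma ideal_eqv: "p \<doteq> q \<Longrightarrow> q \<in> I \<Longrightarrow> p \<in> I"
  using ideal_add[of "p - q" q] by (simp add: eqv_def)

lemma lin_ext_ideal: "(\<And>w. w \<in> supp p \<Longrightarrow> f w \<in> I) \<Longrightarrow> lin_ext f p \<in> I"
  using eqv_lin_ext[of p f "\<lambda>_. 0"] by (simp add: lin_ext_fun_zero eqv_def)

end

definition eds_relations :: "(nat list \<Rightarrow>\<^sub>0 rat) set"
  where "eds_relations = {stuffle w v - u | w v u. w \<in> carrier H1 \<and> v \<in> H0 \<and> u \<in> carrier H1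
                              \<and> to_xy u = shuffle (to_xy w) (to_xy v)}"

lemma stuffle_H1:
  assumes "p \<in> carrier H1" "q \<in> carrier H1"
  shows "stuffle p q \<in> carrier H1"
  using keys_stuffle[of "{k::nat. 1 \<le> k}" p q] assms by (simp add: carrier_H1)

lemma eds_relations_carrier: "eds_relations \<subseteq> carrier H1"
proof
  fix x assume "x \<in> eds_relations"
  then obtain w v u where x: "x = stuffle w v - u" "w \<in> carrier H1" "v \<in> carrier H1" "u \<in> carrier H1"
    unfolding eds_relations_def H0_def by blast
  have "stuffle w v \<in> carrier H1" using x by (intro stuffle_H1)
  then show "x \<in> carrier H1"
    using x(4) keys_minus[of "stuffle w v" u] unfolding x(1) carrier_H1 by blast
qed

interpretation eds: stuffle_ideal "{k::nat. 1 \<le> k}" eds_ideal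
proof (rule stuffle_ideal.intro)
  interpret H1: cring H1 by (rule cring_H1)
  show "ideal eds_ideal (stuffle_algebra {k::nat. 1 \<le> k})"
    unfolding eds_ideal_def H1_def[symmetric] eds_relations_def[symmetric]
    by (rule H1.genideal_ideal) (rule eds_relations_carrier)
  show "a + b \<in> {k::nat. 1 \<le> k}" if "a \<in> {k. 1 \<le> k}" "b \<in> {k. 1 \<le> k}" for a b
    using that by simp
qed

lemma eds_relations_subset: "eds_relations \<subseteq> eds_ideal"
proof -
  interpret H1: cring H1 by (rule cring_H1)
  show ?thesis
    unfolding eds_ideal_def eds_relations_def[symmetric]
    by (rule H1.genideal_self) (rule eds_relations_carrier)
qed

notation eds.eqv (infix "\<doteq>" 50)

lemma hd_z_word: "z_word n w \<noteq> [] \<Longrightarrow> 0 < n \<or> hd w \<noteq> LY \<Longrightarrow> hd (z_word n w) \<noteq> 1"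
  by (induction n w rule: z_word.induct) auto

lemma from_xy_H0:
  assumes "\<And>w. w \<in> supp q \<Longrightarrow> w = [] \<or> hd w \<noteq> LY"
  shows "from_xy q \<in> H0"
proof -
  have "v = [] \<or> hd v \<noteq> 1" if v: "v \<in> supp (from_xy q)" for v
  proof -
    obtain w where "w \<in> supp q" "v = z_word 0 w"
      using v keys_lin_ext[of "\<lambda>w. mon (z_word 0 w)" q] by (auto simp: from_xy_def)
    then show ?thesis using assms[of w] hd_z_word[of 0 w] by auto
  qed
  then show ?thesis using from_xy_carrier[of q] by (simp add: H0_def)
qed

lemma eds_relation:
  assumes "p \<in> y_polys" "q \<in> y_polys" "\<And>w. w \<in> supp q \<Longrightarrow> w = [] \<or> hd w \<noteq> LY"
  shows "stuffle (from_xy p) (from_xy q) \<doteq> from_xy (shuffle p q)"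
proof -
  have "from_xy q \<in> H0" by (rule from_xy_H0) (rule assms(3))
  moreover have "to_xy (from_xy (shuffle p q)) = shuffle (to_xy (from_xy p)) (to_xy (from_xy q))"
    by (simp only: to_xy_from_xy[OF assms(1)] to_xy_from_xy[OF assms(2)] to_xy_from_xy[OF shuffle_closed[OF assms(1,2)]])
  ultimately have "stuffle (from_xy p) (from_xy q) - from_xy (shuffle p q) \<in> eds_relations"
    unfolding eds_relations_def using from_xy_carrier by blast
  then show ?thesis using eds_relations_subset unfolding eds.eqv_def by blast
qed

section \<open>Elimination of the last variables from the swap polynomial\<close>

lemma lookup_single_mult_add:
  fixes t s :: "var \<Rightarrow>\<^sub>0 nat" and p :: pol
  shows "lookup (Poly_Mapping.single t c * p) (t + s) = c * lookup p s"
proof (induction p rule: poly_induct)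
  case (mon d w)
  show ?case unfolding scale_mon mult_single by (simp add: lookup_single when_def)
qed (simp_all add: lookup_add algebra_simps)

lemma lookup_single_mult:
  assumes "\<And>s. u \<noteq> t + s"
  shows "lookup (Poly_Mapping.single t c * p :: pol) u = 0"
proof (induction p rule: poly_induct)
  case (mon d w)
  show ?case unfolding scale_mon mult_single using assms[of w] by (simp add: lookup_single when_def)
qed (simp_all add: lookup_add algebra_simps)

definition free_of :: "var \<Rightarrow> pol \<Rightarrow> bool"
  where "free_of a p \<longleftrightarrow> (\<forall>t\<in>supp p. lookup t a = 0)"

lemma free_of_mult: "free_of a p \<Longrightarrow> free_of a q \<Longrightarrow> free_of a (p * q)"
  unfolding free_of_def
proof
  fix t assume "\<forall>t\<in>supp p. lookup t a = 0"
    "\<forall>t\<in>supp q. lookup t a = 0" "t \<in> supp (p * q)"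
  moreover obtain t1 t2 where "t = t1 + t2" "t1 \<in> supp p" "t2 \<in> supp q"
    using calculation keys_mult[of p q] by blast
  ultimately show "lookup t a = 0" by (simp add: lookup_add)
qed

lemma free_of_one: "free_of a 1"
  by (simp add: free_of_def)

lemma free_of_power: "free_of a p \<Longrightarrow> free_of a (p ^ n)"
  by (induction n) (simp_all add: free_of_one free_of_mult)

lemma free_of_add: "free_of a p \<Longrightarrow> free_of a q \<Longrightarrow> free_of a (p + q)"
  using keys_add[of p q] unfolding free_of_def by blast

lemma free_of_minus: "free_of a p \<Longrightarrow> free_of a q \<Longrightarrow> free_of a (p - q)"
  using keys_minus[of p q] unfolding free_of_def by blast

lemma free_of_zero: "free_of a 0"
  by (simp add: free_of_def)

lemma free_of_sum: "(\<And>i. i \<in> A \<Longrightarrow> free_of a (f i)) \<Longrightarrow> free_of a (sum f A)"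
  by (induction A rule: infinite_finite_induct) (simp_all add: free_of_zero free_of_add)

lemma free_of_prod: "(\<And>i. i \<in> A \<Longrightarrow> free_of a (f i)) \<Longrightarrow> free_of a (prod f A)"
  by (induction A rule: infinite_finite_induct) (simp_all add: free_of_one free_of_mult)

lemma free_of_Var [simp]: "a \<noteq> b \<Longrightarrow> free_of a (Var b)"
  by (simp add: free_of_def Var_def lookup_single)

lemma lookup_free_of:
  "free_of a p \<Longrightarrow> 0 < m \<Longrightarrow> lookup p (t + Poly_Mapping.single a m) = 0"
  unfolding free_of_def
  by (rule ccontr) (drule bspec[of _ _ "t + Poly_Mapping.single a m"], simp_all add: in_keys_iff lookup_add)

lemma single_power: "Poly_Mapping.single (Poly_Mapping.single a (Suc 0)) c ^ k = (Poly_Mapping.single (Poly_Mapping.single a k) (c ^ k) :: pol)"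
  by (induction k) (simp_all add: mult_single mult.commute flip: single_add)

lemma lookup_of_nat_mult: "lookup (of_nat n * p :: pol) t = of_nat n * lookup p t"
  using lookup_single_mult_add[of 0 "of_nat n" p t] by simp

lemma lookup_Var_power_mult:
  fixes p :: pol
  assumes "lookup t a = 0"
  shows "lookup (Poly_Mapping.single (Poly_Mapping.single a k) c * p) (t + Poly_Mapping.single a m) =
    (if k \<le> m then c * lookup p (t + Poly_Mapping.single a (m - k)) else 0)"
proof (cases "k \<le> m")
  case True
  then have "t + Poly_Mapping.single a m = Poly_Mapping.single a k + (t + Poly_Mapping.single a (m - k))"
    by (simp add: add.left_commute flip: single_add)
  then show ?thesis using True by (simp only: lookup_single_mult_add) simp
next
  case False
  have "t + Poly_Mapping.single a m \<noteq> Poly_Mapping.single a k + s" for s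
  proof
    assume "t + Poly_Mapping.single a m = Poly_Mapping.single a k + s"
    then have "lookup (t + Poly_Mapping.single a m) a = lookup (Poly_Mapping.single a k + s) a"
      by simp
    then show False using False assms by (simp add: lookup_add)
  qed
  then show ?thesis using False by (simp add: lookup_single_mult)
qed

text \<open>
  Coefficient extraction by the binomial theorem: if \<open>a\<close> does not occur in \<open>p\<close> and \<open>q\<close>, the power
  \<open>a\<^sup>m\<close> in \<open>(c a + q)\<^sup>n p\<close> comes from \<open>m\<close> of the \<open>n\<close> factors.
\<close>

lemma lookup_binomial:
  fixes p q :: pol
  assumes "free_of a p" "free_of a q" "lookup t a = 0"
  shows "lookup ((Poly_Mapping.single (Poly_Mapping.single a (Suc 0)) c + q) ^ n * p) (t + Poly_Mapping.single a m) =
    of_nat (n choose m) * c ^ m * lookup (q ^ (n - m) * p) t"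
proof -
  let ?S = "\<lambda>k. Poly_Mapping.single (Poly_Mapping.single a k)"
  have "lookup ((?S (Suc 0) c + q) ^ n * p) (t + Poly_Mapping.single a m) =
    (\<Sum>k\<le>n. of_nat (n choose k) * lookup (?S k (c ^ k) * (q ^ (n - k) * p)) (t + Poly_Mapping.single a m))"
    by (simp add: binomial_ring sum_distrib_right lookup_sum single_power mult.assoc lookup_of_nat_mult)
  also have "\<dots> = (\<Sum>k\<le>n. if k = m then of_nat (n choose k) * c ^ k * lookup (q ^ (n - k) * p) t else 0)"
  proof (intro sum.cong refl)
    fix k
    have "lookup (q ^ (n - k) * p) (t + Poly_Mapping.single a (m - k)) = 0" if "k < m"
      using assms that by (intro lookup_free_of free_of_mult free_of_power) simp_all
    then show "of_nat (n choose k) * lookup (?S k (c ^ k) * (q ^ (n - k) * p)) (t + Poly_Mapping.single a m)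
      = (if k = m then of_nat (n choose k) * c ^ k * lookup (q ^ (n - k) * p) t else 0)"
      unfolding lookup_Var_power_mult[OF assms(3)] by auto
  qed
  finally show ?thesis by (simp add: sum.delta)
qed

text \<open>
  The factors of the swap polynomial for \<open>x # v\<close> that belong to the letters of \<open>v\<close>; they do not depend
  on the letter \<open>x\<close>.
\<close>

definition swap_tail :: "word2 \<Rightarrow> pol"
  where "swap_tail v = (\<Prod>i = 1..length v. upper_entry (Suc (length v)) (Suc i) ^ (fst (v ! (i - 1)) - 1)
     * lower_entry (Suc (length v)) (Suc i) ^ snd (v ! (i - 1)))"

lemma swap_pol_Cons:
  "swap_pol ((k, d) # v) = upper_entry (Suc (length v)) 1 ^ (k - 1) * lower_entry (Suc (length v)) 1 ^ d * swap_tail v"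
proof -
  have "swap_pol ((k, d) # v) = upper_entry (Suc (length v)) 1 ^ (k - 1) * lower_entry (Suc (length v)) 1 ^ d *
    (\<Prod>i = Suc 1..Suc (length v). upper_entry (Suc (length v)) i ^ (fst (((k, d) # v) ! (i - 1)) - 1)
     * lower_entry (Suc (length v)) i ^ snd (((k, d) # v) ! (i - 1)))"
    unfolding swap_pol_def by (subst prod.atLeast_Suc_atMost) simp_all
  also have "(\<Prod>i = Suc 1..Suc (length v). upper_entry (Suc (length v)) i ^ (fst (((k, d) # v) ! (i - 1)) - 1)
     * lower_entry (Suc (length v)) i ^ snd (((k, d) # v) ! (i - 1))) = swap_tail v"
    unfolding swap_tail_def prod.atLeast_Suc_atMost_Suc_shift by (intro prod.cong) (auto simp: nth_Cons')
  finally show ?thesis .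
qed

lemma swap_tail_Cons:
  "swap_tail ((k, d) # v) = upper_entry (Suc (Suc (length v))) 2 ^ (k - 1) * lower_entry (Suc (Suc (length v))) 2 ^ d * swap_tail v"
proof -
  let ?r = "Suc (Suc (length v))"
  have "swap_tail ((k, d) # v) = upper_entry ?r 2 ^ (k - 1) * lower_entry ?r 2 ^ d *
    (\<Prod>i = Suc 1..Suc (length v). upper_entry ?r (Suc i) ^ (fst (((k, d) # v) ! (i - 1)) - 1)
     * lower_entry ?r (Suc i) ^ snd (((k, d) # v) ! (i - 1)))"
    unfolding swap_tail_def by (subst prod.atLeast_Suc_atMost) (simp_all add: numeral_2_eq_2)
  also have "(\<Prod>i = Suc 1..Suc (length v). upper_entry ?r (Suc i) ^ (fst (((k, d) # v) ! (i - 1)) - 1)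
     * lower_entry ?r (Suc i) ^ snd (((k, d) # v) ! (i - 1))) = swap_tail v"
    unfolding swap_tail_def prod.atLeast_Suc_atMost_Suc_shift
    by (intro prod.cong) (auto simp: nth_Cons' upper_entry_def lower_entry_def Suc_diff_Suc Suc_diff_le)
  finally show ?thesis .
qed

lemma free_of_upper_entry: "0 < i \<Longrightarrow> r < s \<Longrightarrow> free_of (YV s) (upper_entry r i)" "free_of (XV s) (upper_entry r i)"
  unfolding upper_entry_def by (rule free_of_sum, rule free_of_Var, force)+

lemma free_of_lower_entry:
  "r < s \<Longrightarrow> 1 < i \<Longrightarrow> free_of (XV s) (lower_entry r i)" "free_of (YV s) (lower_entry r i)"
  by (simp_all add: lower_entry_def free_of_minus)

lemma free_of_swap_tail:
  "Suc (length v) < s \<Longrightarrow> free_of (YV s) (swap_tail v)" "Suc (length v) < s \<Longrightarrow> free_of (XV s) (swap_tail v)"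
  unfolding swap_tail_def by (intro free_of_prod free_of_mult free_of_power free_of_upper_entry free_of_lower_entry; simp)+

lemma exponents_snoc:
  "exponents (w @ [(k, e)]) =
     exponents w + Poly_Mapping.single (XV (Suc (length w))) (k - 1) + Poly_Mapping.single (YV (Suc (length w))) e"
proof -
  have "(\<Sum>i = 1..length w. Poly_Mapping.single (XV i) (fst ((w @ [(k, e)]) ! (i - 1)) - 1)
      + Poly_Mapping.single (YV i) (snd ((w @ [(k, e)]) ! (i - 1)))) = exponents w"
    unfolding exponents_def by (intro sum.cong) (auto simp: nth_append)
  then show ?thesis unfolding exponents_def by (simp add: add_ac)
qed

lemma lookup_exponents:
  "length w < s \<Longrightarrow> lookup (exponents w) (XV s) = 0"
  "length w < s \<Longrightarrow> lookup (exponents w) (YV s) = 0"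
  by (auto simp: exponents_def lookup_sum lookup_add lookup_single intro!: sum.neutral)

text \<open>
  For words of equal length, \<open>swap_coeff\<close> up to the factorials.
\<close>

definition swap_lookup :: "word2 \<Rightarrow> word2 \<Rightarrow> rat"
  where "swap_lookup w v = lookup (swap_pol v) (exponents w)"

lemma swap_lookup_Nil [simp]: "swap_lookup [] [] = 1"
  by (simp add: swap_lookup_def swap_pol_def exponents_def)

lemma Var_power: "Var a ^ n = Poly_Mapping.single (Poly_Mapping.single a n) 1"
  using single_power[of a 1 n] by (simp add: Var_def)

lemma swap_lookup_single:
  "swap_lookup [(k, e)] [(k', d)] = (if k - 1 = d \<and> k' - 1 = e then 1 else 0)"
proof -
  have "swap_pol [(k', d)] = Var (YV 1) ^ (k' - 1) * Var (XV 1) ^ d"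
    by (simp add: swap_pol_Cons swap_tail_def upper_entry_def lower_entry_def)
  then have "swap_pol [(k', d)] = mon (Poly_Mapping.single (YV 1) (k' - 1) + Poly_Mapping.single (XV 1) d)"
    by (simp add: Var_power mult_single)
  moreover have "exponents [(k, e)] = Poly_Mapping.single (XV 1) (k - 1) + Poly_Mapping.single (YV 1) e"
    by (simp add: exponents_def)
  moreover have "Poly_Mapping.single (YV 1) i + Poly_Mapping.single (XV 1) j =
      Poly_Mapping.single (XV 1) i' + Poly_Mapping.single (YV 1) j' \<longleftrightarrow> i = j' \<and> j = i'" for i j i' j' :: nat
  proof
    assume *: "Poly_Mapping.single (YV 1) i + Poly_Mapping.single (XV 1) j =
      Poly_Mapping.single (XV 1) i' + Poly_Mapping.single (YV 1) j'"
    from arg_cong[OF *, of "\<lambda>p. lookup p (XV 1)"] arg_cong[OF *, of "\<lambda>p. lookup p (YV 1)"]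
    show "i = j' \<and> j = i'" by (simp add: lookup_add lookup_single)
  qed (simp add: add.commute)
  ultimately show ?thesis by (auto simp: swap_lookup_def lookup_single when_def)
qed

text \<open>
  Let \<open>r\<close> be the length of the words. The variable \<open>Y\<^sub>r\<close> occurs in the swap polynomial only in the first
  upper entry, which is \<open>Y\<^sub>r\<close> plus the second upper entry. The variable \<open>X\<^sub>r\<close> occurs only in the first
  two lower entries \<open>X\<^sub>r\<close> and \<open>X\<^sub>r\<^sub>-\<^sub>1 - X\<^sub>r\<close>. After the extraction of a power of each of them, the factors
  left over from the first letter merge into those of the second one, and what remains is the swap
  polynomial of a word that is shorter by one letter.
\<close>

lemma swap_lookup_snoc:
  assumes len: "length w = Suc (length v)"
  shows "swap_lookup (w @ [(k, e)]) ((k1, d1) # (k2, d2) # v) =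
    (if d1 \<le> k - 1 then of_nat ((k1 - 1) choose e) * of_nat (d2 choose (k - 1 - d1)) * (-1) ^ (k - 1 - d1)
       * swap_lookup w ((Suc (k2 - 1 + (k1 - 1 - e)), d2 - (k - 1 - d1)) # v) else 0)"
proof -
  define s where "s = Suc (length v)"
  let ?U = "upper_entry s 1"
  let ?x = "Var (XV s)"
  let ?S = "\<lambda>a c. Poly_Mapping.single (Poly_Mapping.single a (Suc 0)) c :: pol"
  have U1: "upper_entry (Suc s) 1 = ?S (YV (Suc s)) 1 + ?U" "upper_entry (Suc s) 2 = ?U"
    by (simp_all add: upper_entry_def Var_def add.commute)
  have L: "lower_entry (Suc s) 1 = Var (XV (Suc s))" "lower_entry (Suc s) 2 = ?S (XV (Suc s)) (-1) + ?x"
    "lower_entry s 1 = ?x"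
    by (simp_all add: lower_entry_def Var_def single_uminus)
  \<comment> \<open>The last variables have the index \<open>r = Suc s\<close>. First \<open>Y\<^sub>r\<close> is extracted, with cofactor \<open>?P\<close>, then \<open>X\<^sub>r\<close>,
    with cofactor \<open>?Q\<close>.\<close>
  let ?P = "Var (XV (Suc s)) ^ d1 * (?U ^ (k2 - 1) * (?S (XV (Suc s)) (-1) + ?x) ^ d2 * swap_tail v)"
  let ?Q = "?U ^ (k1 - 1 - e) * ?U ^ (k2 - 1) * swap_tail v"
  have pol: "swap_pol ((k1, d1) # (k2, d2) # v) = (?S (YV (Suc s)) 1 + ?U) ^ (k1 - 1) * ?P"
    unfolding swap_pol_Cons swap_tail_Cons list.size by (simp only: U1 L s_def[symmetric] add_Suc_right add_0_right mult.assoc)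
  have fS: "free_of b (?S a c)" if "a \<noteq> b" for a b c
    using that by (simp add: free_of_def lookup_single)
  have fP: "free_of (YV (Suc s)) ?P"
    by (intro free_of_mult free_of_power free_of_add free_of_upper_entry free_of_swap_tail fS free_of_Var)
      (simp_all add: s_def)
  have fQ: "free_of (XV (Suc s)) ?Q"
    by (intro free_of_mult free_of_power free_of_upper_entry free_of_swap_tail) (simp_all add: s_def)
  have E0: "lookup (exponents w) (XV (Suc s)) = 0"
    by (rule lookup_exponents) (simp add: len s_def)
  have fx: "free_of (XV (Suc s)) ?x" by (rule free_of_Var) simp
  let ?E = "exponents w" and ?X = "Poly_Mapping.single (XV (Suc s))"
  have "swap_lookup (w @ [(k, e)]) ((k1, d1) # (k2, d2) # v) =
    of_nat ((k1 - 1) choose e) * lookup (?U ^ (k1 - 1 - e) * ?P) (?E + ?X (k - 1))"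
    unfolding swap_lookup_def pol exponents_snoc len s_def[symmetric]
    by (subst lookup_binomial[OF fP free_of_upper_entry(1)])
      (simp_all add: lookup_add lookup_single lookup_exponents len s_def)
  also have "?U ^ (k1 - 1 - e) * ?P = Poly_Mapping.single (?X d1) 1 * ((?S (XV (Suc s)) (-1) + ?x) ^ d2 * ?Q)"
    by (simp add: Var_power mult_ac)
  also have "lookup \<dots> (?E + ?X (k - 1)) =
    (if d1 \<le> k - 1 then of_nat (d2 choose (k - 1 - d1)) * (-1) ^ (k - 1 - d1)
       * lookup (?x ^ (d2 - (k - 1 - d1)) * ?Q) ?E else 0)"
    unfolding lookup_Var_power_mult[OF E0] lookup_binomial[OF fQ fx E0] by simp
  also have "?x ^ (d2 - (k - 1 - d1)) * ?Q = swap_pol ((Suc (k2 - 1 + (k1 - 1 - e)), d2 - (k - 1 - d1)) # v)"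
    unfolding swap_pol_Cons s_def[symmetric] L by (simp add: power_add mult_ac)
  finally show ?thesis by (simp add: swap_lookup_def)
qed

section \<open>The swap on words with trivial upper or lower row\<close>

lemma swap_coeff_eq:
  "swap_coeff w v = (if length v = length w \<and> v \<in> lists letters
     then fact_lower w / fact_lower v * swap_lookup w v else 0)"
  by (simp add: swap_coeff_def swap_lookup_def)

lemma fact_lower_simps [simp]:
  "fact_lower [] = 1" "fact_lower ((k, d) # w) = fact d * fact_lower w"
  "fact_lower (w @ v) = fact_lower w * fact_lower v"
  by (simp_all add: fact_lower_def)

lemma fact_lower_pos: "fact_lower w > 0"
  by (induction w) auto

lemma fact_lower_nz [simp]: "fact_lower w \<noteq> 0"
  using fact_lower_pos[of w] by simp

text \<open>
  If the first letters of a word have upper entry \<open>1\<close> and the others have lower entry \<open>0\<close>, its swap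
  polynomial is a product of one polynomial in the variables \<open>X\<close> with large indices and one in the
  variables \<open>Y\<close> with small indices. Hence the coefficients factorise, and the two parts trade places.
\<close>

lemma swap_lookup_append:
  assumes "length w1 = length v3" "length w3 = length v1" "\<forall>x\<in>set v1. fst x = 1"
    "\<forall>x\<in>set v3. snd x = 0 \<and> 1 \<le> fst x"
  shows "swap_lookup (w1 @ w3) (v1 @ v3) = swap_lookup w3 v1 * swap_lookup w1 v3"
  using assms(2,3)
proof (induction w3 arbitrary: v1 rule: rev_induct)
  case Nil
  then show ?case by simp
next
  case (snoc x w)
  obtain k e where x: "x = (k, e)" by (cases x)
  obtain d1 v' where v1: "v1 = (1, d1) # v'" using snoc.prems by (cases v1) auto
  show ?case
  proof (cases v')
    case Nil
    then have w: "w = []" using snoc.prems v1 by simp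
    show ?thesis
    proof (cases v3)
      case Nil
      then show ?thesis using assms(1) by simp
    next
      case (Cons y v)
      obtain k2 where y: "y = (k2, 0)" "1 \<le> k2" using assms(4) Cons by (cases y) auto
      have "length w1 = Suc (length v)" using assms(1) Cons by simp
      note S = swap_lookup_snoc[OF this, of k e 1 d1 k2 0]
      have "swap_lookup (w1 @ [(k, e)]) ((1, d1) # (k2, 0) # v) =
        (if k - 1 = d1 \<and> e = 0 then swap_lookup w1 ((k2, 0) # v) else 0)"
      proof (cases "k - 1 = d1 \<and> e = 0")
        case True
        then show ?thesis unfolding S using y(2) by simp
      next
        case False
        then have "k - 1 < d1 \<or> 0 < e \<or> 0 < k - 1 - d1" by linarith
        then show ?thesis unfolding S using False by (elim disjE) (auto simp: binomial_eq_0)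
      qed
      then show ?thesis unfolding v1 Nil w Cons y(1) x
        by (simp add: swap_lookup_single)
    qed
  next
    case (Cons y v'')
    obtain d2 where y: "y = (1, d2)" using snoc.prems v1 Cons by (cases y) auto
    let ?v = "(Suc (1 - 1 + (1 - 1 - e)), d2 - (k - 1 - d1)) # v''"
    have IH: "swap_lookup (w1 @ w) (?v @ v3) = swap_lookup w ?v * swap_lookup w1 v3"
      using snoc.prems v1 Cons by (intro snoc.IH) auto
    have 1: "length (w1 @ w) = Suc (length (v'' @ v3))" and 2: "length w = Suc (length v'')"
      using snoc.prems v1 Cons assms(1) by simp_all
    show ?thesis
      using swap_lookup_snoc[OF 1, of k e 1 d1 1 d2] swap_lookup_snoc[OF 2, of k e 1 d1 1 d2] IH
      unfolding v1 Cons y x by simp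
  qed
qed

lemma in_lists_letters: "w \<in> lists letters \<longleftrightarrow> (\<forall>x\<in>set w. 1 \<le> fst x)"
  by (auto simp: letters_def)

lemma swap_coeff_append:
  assumes "length w1 = length v3" "length w3 = length v1" "\<forall>x\<in>set v1. fst x = 1"
    "\<forall>x\<in>set v3. snd x = 0"
  shows "swap_coeff (w1 @ w3) (v1 @ v3) = swap_coeff w3 v1 * swap_coeff w1 v3"
proof (cases "v3 \<in> lists letters")
  case True
  then have "\<forall>x\<in>set v3. snd x = 0 \<and> 1 \<le> fst x"
    using assms(4) by (auto simp: in_lists_letters)
  moreover have "v1 \<in> lists letters" using assms(3) by (auto simp: in_lists_letters)
  ultimately show ?thesis
    using assms True swap_lookup_append[OF assms(1-3)] by (simp add: swap_coeff_eq)
qed (simp add: swap_coeff_eq)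

lemma swap_lookup_induct [consumes 1, case_names Nil single snoc]:
  assumes "length w = length v"
    and "P [] []" "\<And>k e k' d. P [(k, e)] [(k', d)]"
    and "\<And>w k e k1 d1 k2 d2 v. length w = Suc (length v) \<Longrightarrow>
       (\<And>k d. P w ((k, d) # v)) \<Longrightarrow> P (w @ [(k, e)]) ((k1, d1) # (k2, d2) # v)"
  shows "P w v"
  using assms(1)
proof (induction w arbitrary: v rule: rev_induct)
  case (snoc x w)
  obtain k e where x: "x = (k, e)" by (cases x)
  obtain k1 d1 v1 where v: "v = (k1, d1) # v1" using snoc.prems by (cases v) auto
  show ?case
  proof (cases v1)
    case Nil
    then show ?thesis using snoc.prems assms(3) v x by simp
  next
    case (Cons y v2)
    then obtain k2 d2 where y: "v1 = (k2, d2) # v2" by (cases y) auto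
    have "length w = Suc (length v2)" using snoc.prems v y by simp
    then show ?thesis unfolding v y x by (intro assms(4) snoc.IH) auto
  qed
qed (use assms(2) in simp)

text \<open>
  The swap polynomial has degree \<open>\<Sum> d\<^sub>i\<close> in the \<open>X\<close> and \<open>\<Sum> (k\<^sub>i - 1)\<close> in the \<open>Y\<close>; so one row of a word
  is trivial if and only if the other row is trivial for any of the words in its swap.
\<close>

lemma swap_lookup_nonzero:
  assumes "length w = length v" "swap_lookup w v \<noteq> 0"
  shows "(\<forall>x\<in>set v. fst x \<le> 1) \<longleftrightarrow> (\<forall>x\<in>set w. snd x = 0)"
    and "(\<forall>x\<in>set v. snd x = 0) \<longleftrightarrow> (\<forall>x\<in>set w. fst x \<le> 1)"
proof -
  have "((\<forall>x\<in>set v. fst x \<le> 1) \<longleftrightarrow> (\<forall>x\<in>set w. snd x = 0)) \<and>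
    ((\<forall>x\<in>set v. snd x = 0) \<longleftrightarrow> (\<forall>x\<in>set w. fst x \<le> 1))"
    using assms
  proof (induction w v rule: swap_lookup_induct)
    case Nil
    then show ?case by simp
  next
    case (single k e k' d)
    then show ?case by (auto simp: swap_lookup_single split: if_splits)
  next
    case (snoc w k e k1 d1 k2 d2 v)
    let ?k = "Suc (k2 - 1 + (k1 - 1 - e))" and ?d = "d2 - (k - 1 - d1)"
    note S = snoc.prems[unfolded swap_lookup_snoc[OF snoc.hyps]]
    have 1: "d1 \<le> k - 1" using S by (rule contrapos_np) simp
    have 2: "e \<le> k1 - 1" using S by (rule contrapos_np) (simp add: binomial_eq_0 not_le)
    have 3: "k - 1 - d1 \<le> d2" using S by (rule contrapos_np) (simp add: binomial_eq_0 not_le)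
    have 4: "swap_lookup w ((?k, ?d) # v) \<noteq> 0" using S by (rule contrapos_nn) simp
    have "k1 \<le> 1 \<and> k2 \<le> 1 \<longleftrightarrow> e = 0 \<and> ?k \<le> 1" using 2 by arith
    moreover have "d1 = 0 \<and> d2 = 0 \<longleftrightarrow> k \<le> 1 \<and> ?d = 0" using 1 3 by arith
    ultimately show ?case
      using snoc.IH[OF 4] unfolding set_append set_simps ball_Un ball_simps fst_conv snd_conv by argo
  qed
  then show "(\<forall>x\<in>set v. fst x \<le> 1) \<longleftrightarrow> (\<forall>x\<in>set w. snd x = 0)"
    and "(\<forall>x\<in>set v. snd x = 0) \<longleftrightarrow> (\<forall>x\<in>set w. fst x \<le> 1)" by blast+
qed

lemma swap_coeff_nonzero:
  assumes "swap_coeff w v \<noteq> 0" "w \<in> lists letters"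
  shows "length v = length w" "v \<in> lists letters"
    "(\<forall>x\<in>set v. fst x = 1) \<longleftrightarrow> (\<forall>x\<in>set w. snd x = 0)"
    "(\<forall>x\<in>set v. snd x = 0) \<longleftrightarrow> (\<forall>x\<in>set w. fst x = 1)"
proof -
  show *: "length v = length w" "v \<in> lists letters"
    using assms by (auto simp: swap_coeff_eq split: if_splits)
  have 1: "fst x \<le> 1 \<longleftrightarrow> fst x = 1" if "x \<in> set v \<union> set w" for x
  proof -
    have "1 \<le> fst x" using that * assms(2) by (auto simp: in_lists_letters)
    then show ?thesis by linarith
  qed
  have "swap_lookup w v \<noteq> 0" using assms by (auto simp: swap_coeff_eq split: if_splits)
  from swap_lookup_nonzero[OF *(1)[symmetric] this] 1
  show "(\<forall>x\<in>set v. fst x = 1) \<longleftrightarrow> (\<forall>x\<in>set w. snd x = 0)"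
    "(\<forall>x\<in>set v. snd x = 0) \<longleftrightarrow> (\<forall>x\<in>set w. fst x = 1)" by auto
qed

lemma swap_lookup_replicate: "swap_lookup (replicate n (1, 0)) (replicate n (1, 0)) = 1"
proof (induction n)
  case (Suc n)
  show ?case
  proof (cases n)
    case 0
    then show ?thesis by (simp add: swap_lookup_single)
  next
    case (Suc m)
    have "swap_lookup (replicate n (1, 0) @ [(1, 0)]) ((1, 0) # (1, 0) # replicate m (1, 0)) =
      swap_lookup (replicate n (1, 0)) ((1, 0) # replicate m (1, 0))"
      by (subst swap_lookup_snoc) (simp_all add: Suc)
    then show ?thesis using Suc.IH Suc by (simp add: replicate_append_same)
  qed
qed simp

text \<open>
  The lower entries of all letters but the first can only decrease in the recursion, and at the end the
  remaining one is the power of \<open>X\<^sub>1\<close>. This records that words not starting in \<open>z\<^sub>1\<close> correspond to lower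
  rows with a positive last entry.
\<close>

lemma last_swap_lookup:
  assumes "length w = length v" "swap_lookup w v \<noteq> 0" "w \<noteq> []" "2 \<le> fst (hd w)"
  shows "1 \<le> snd (last v)"
  using assms
proof (induction w v rule: swap_lookup_induct)
  case (single k e k' d)
  then show ?case by (auto simp: swap_lookup_single split: if_splits)
next
  case (snoc w k e k1 d1 k2 d2 v)
  let ?k = "Suc (k2 - 1 + (k1 - 1 - e))" and ?d = "d2 - (k - 1 - d1)"
  have nz: "swap_lookup w ((?k, ?d) # v) \<noteq> 0"
    using snoc.prems(1)[unfolded swap_lookup_snoc[OF snoc.hyps]] by (rule contrapos_nn) simp
  have "w \<noteq> []" using snoc.hyps by auto
  then have "1 \<le> snd (last ((?k, ?d) # v))" using snoc.IH[OF nz] snoc.prems by simp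
  then show ?case by (auto split: if_splits)
qed simp

abbreviation lower_word :: "nat list \<Rightarrow> word2"
  where "lower_word ds \<equiv> map (Pair 1) ds"

abbreviation upper_word :: "nat list \<Rightarrow> word2"
  where "upper_word ks \<equiv> map (\<lambda>k. (k, 0)) ks"

lemma lookup_append_letter_Nil: "lookup (append_letter a p) [] = 0"
  by (induction p rule: poly_induct) (simp_all add: append_letter_mon lookup_add lookup_single)

lemma lookup_tower_Nil: "lookup (tower_word ds) [] = (if ds = [] then 1 else 0)"
  by (cases ds) (simp_all add: lookup_append_letter_Nil)

lemma lookup_tower_replicate_LX:
  "lookup (tower_word ds) (replicate n LX) = (if ds = [] \<and> n = 0 then 1 else 0)"
proof (cases n)
  case (Suc m)
  then have "replicate n LX \<notin> y_closed" by (simp add: y_closed_def last_replicate)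
  then show ?thesis using tower_word_closed[of ds] Suc by (auto simp: in_keys_iff)
qed (simp add: lookup_tower_Nil)

text \<open>
  Both sides satisfy the recursion that removes the last entry of \<open>ds\<close>: on the left it is
  \<open>tower_word_snoc\<close>, on the right the part of \<open>swap_lookup_snoc\<close> that concerns the variables \<open>Y\<close>.
\<close>

lemma lookup_tower:
  assumes "\<forall>k\<in>set ks. 1 \<le> k"
  shows "lookup (tower_word ds) (xy_word ks) =
    (if length ks = length ds then fact_lower (lower_word ds) * swap_lookup (lower_word ds) (upper_word ks) else 0)"
  using assms
proof (induction ds arbitrary: ks rule: rev_induct)
  case Nil
  then show ?case by (cases ks) (simp_all add: lookup_single)
next
  case (snoc m ds)
  show ?case
  proof (cases ks)
    case Nil
    then show ?thesis by (simp add: lookup_tower_Nil)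
  next
    case (Cons k1 ks')
    show ?thesis
    proof (cases ks')
      case Nil
      show ?thesis
        unfolding Cons Nil tower_word_snoc lookup_scale xy_word_simps lookup_insert_y
        using lookup_tower_replicate_LX[of ds "k1 - 1 - m"] by (auto simp: swap_lookup_single)
    next
      case ks': (Cons k2 ks'')
      let ?k = "Suc (k2 - 1 + (k1 - 1 - m))"
      have "replicate (k1 - 1 - m) LX @ xy_word ks' = xy_word (?k # ks'')"
        by (simp add: ks' add.commute flip: replicate_add append_assoc)
      then have 1: "lookup (tower_word (ds @ [m])) (xy_word ks) =
         fact m * (if m \<le> k1 - 1 then of_nat ((k1 - 1) choose m) * lookup (tower_word ds) (xy_word (?k # ks'')) else 0)"
        unfolding Cons tower_word_snoc lookup_scale xy_word_simps(2) lookup_insert_y by simp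
      have 2: "lookup (tower_word ds) (xy_word (?k # ks'')) =
        (if length (?k # ks'') = length ds then fact_lower (lower_word ds) * swap_lookup (lower_word ds) (upper_word (?k # ks'')) else 0)"
        using snoc Cons ks' by (intro snoc.IH) auto
      show ?thesis
      proof (cases "length ds = Suc (length ks'')")
        case True
        then have "length (lower_word ds) = Suc (length (upper_word ks''))" by simp
        from swap_lookup_snoc[OF this, of 1 m k1 0 k2 0]
        show ?thesis unfolding 1 2 unfolding Cons ks' using True
          by (auto simp: binomial_eq_0_iff)
      next
        case False
        then show ?thesis unfolding 1 2 unfolding Cons ks' by auto
      qed
    qed
  qed
qed

definition upper :: "(nat list \<Rightarrow>\<^sub>0 rat) \<Rightarrow> (word2 \<Rightarrow>\<^sub>0 rat)"
  where "upper = lin_ext (\<lambda>ks. mon (upper_word ks))"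

lemma swap_lower_word: "swap_word (lower_word ds) = upper (from_xy (tower_word ds))"
proof (rule poly_mapping_eqI)
  fix v
  let ?S = "lists {k::nat. 1 \<le> k}"
  have inj: "inj_on upper_word ?S" by (rule inj_on_inverseI[of _ "map fst"]) (simp add: comp_def)
  have k: "supp (from_xy (tower_word ds)) \<subseteq> ?S"
    using from_xy_carrier by (auto simp: carrier_H1)
  have lower: "lower_word ds \<in> lists letters" by (auto simp: letters_def)
  show "lookup (swap_word (lower_word ds)) v = lookup (upper (from_xy (tower_word ds))) v"
  proof (cases "v \<in> upper_word ` ?S")
    case True
    then obtain ks where ks: "v = upper_word ks" "ks \<in> ?S" by blast
    then have pos: "\<forall>k\<in>set ks. 1 \<le> k" by auto
    have z: "lookup (from_xy q) ks = lookup q (xy_word ks)" if "q \<in> y_polys" for q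
    proof -
      have "inj_on (z_word 0) y_closed"
        by (rule inj_on_inverseI[of _ xy_word]) (rule xy_word_z_word)
      then have "lookup (from_xy q) (z_word 0 (xy_word ks)) = lookup q (xy_word ks)"
        unfolding from_xy_def using that xy_word_closed by (intro lookup_lin_ext_inj) auto
      then show ?thesis by (simp add: z_word_xy_word[OF pos])
    qed
    have "lookup (upper (from_xy (tower_word ds))) v = lookup (tower_word ds) (xy_word ks)"
      unfolding upper_def ks(1) lookup_lin_ext_inj(1)[OF inj k ks(2)] by (rule z[OF tower_word_closed])
    moreover have "fact_lower (upper_word ks) = 1" by (induction ks) simp_all
    moreover have "upper_word ks \<in> lists letters" using pos by (auto simp: letters_def)
    ultimately show ?thesis
      unfolding lookup_swap_word swap_coeff_eq lookup_tower[OF pos] using ks by simp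
  next
    case False
    have "swap_coeff (lower_word ds) v = 0"
    proof (rule ccontr)
      assume nz: "swap_coeff (lower_word ds) v \<noteq> 0"
      have "\<forall>x\<in>set v. snd x = 0" "v \<in> lists letters" using swap_coeff_nonzero[OF nz lower] by auto
      then have "v = upper_word (map fst v)" "map fst v \<in> ?S"
        by (auto simp: in_lists_letters map_idI prod_eq_iff intro!: map_idI[symmetric])
      then show False using False by blast
    qed
    then show ?thesis unfolding upper_def lookup_swap_word using lookup_lin_ext_inj(2)[OF inj k False] by simp
  qed
qed

definition append_power :: "'a \<Rightarrow> nat \<Rightarrow> ('a list \<Rightarrow>\<^sub>0 rat) \<Rightarrow> ('a list \<Rightarrow>\<^sub>0 rat)"
  where "append_power a n = (append_letter a ^^ n)"

lemma append_power_simps [simp]: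
  "append_power a 0 p = p" "append_power a (Suc n) p = append_letter a (append_power a n p)"
  by (simp_all add: append_power_def)

lemma append_power_linear [simp]:
  "append_power a n 0 = 0" "append_power a n (p + q) = append_power a n p + append_power a n q"
  "append_power a n (scale c p) = scale c (append_power a n p)"
  by (induction n) simp_all

lemma append_power_mon: "append_power a n (mon w) = mon (w @ replicate n a)"
  by (induction n) (simp_all add: append_letter_mon replicate_append_same)

lemma shuffle_replicate_Suc_append:
  "shuffle (mon (replicate (Suc m) a)) (append_letter b q) =
     append_letter a (shuffle (mon (replicate m a)) (append_letter b q))
     + append_letter b (shuffle (mon (replicate (Suc m) a)) q)"
  using shuffle_append_letter[of a "mon (replicate m a)" b q]
  by (simp add: append_letter_mon replicate_append_same)

text \<open>
  With \<open>b\<close> put at the end of \<open>a\<^sup>j sh p\<close>, the letters \<open>a\<close> that are shuffled into the result from outside may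
  also come after \<open>b\<close>. The alternating sum cancels all terms in which some new \<open>a\<close> precedes \<open>b\<close>, by
  \<open>alternating_shuffle_powers\<close>.
\<close>

lemma alternating_shuffle_append:
  "(\<Sum>j\<le>n. scale ((-1) ^ j) (shuffle (mon (replicate (n - j) a))
      (append_letter b (shuffle (mon (replicate j a)) p)))) = append_power a n (append_letter b p)"
proof (induction n)
  case (Suc n)
  let ?f = "\<lambda>n j. shuffle (mon (replicate (n - j) a)) (append_letter b (shuffle (mon (replicate j a)) p))"
  let ?g = "\<lambda>j. append_letter b (shuffle (shuffle (mon (replicate (Suc n - j) a)) (mon (replicate j a))) p)"
  \<comment> \<open>A term ends in a new \<open>a\<close> or in \<open>b\<close>; those of the second kind add up to zero.\<close>
  have 1: "?f (Suc n) j = append_letter a (?f n j) + ?g j" if "j \<le> n" for j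
    using that shuffle_replicate_Suc_append[of "n - j" a b] by (simp add: Suc_diff_le shuffle_assoc)
  have 2: "?f (Suc n) (Suc n) = ?g (Suc n)" by simp
  have "(\<Sum>j\<le>Suc n. scale ((-1) ^ j) (?f (Suc n) j)) =
    (\<Sum>j\<le>n. scale ((-1) ^ j) (append_letter a (?f n j) + ?g j)) + scale ((-1) ^ Suc n) (?g (Suc n))"
    unfolding sum.atMost_Suc 2 using 1 by (intro arg_cong2[of _ _ _ _ "(+)"] sum.cong refl) simp
  also have "\<dots> = append_letter a (\<Sum>j\<le>n. scale ((-1) ^ j) (?f n j)) + (\<Sum>j\<le>Suc n. scale ((-1) ^ j) (?g j))"
    by (simp add: scale_add sum.distrib append_letter_sum add.assoc)
  also have "(\<Sum>j\<le>Suc n. scale ((-1) ^ j) (?g j)) = append_letter b (shuffle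
     (\<Sum>j\<le>Suc n. scale ((-1) ^ j) (shuffle (mon (replicate (Suc n - j) a)) (mon (replicate j a)))) p)"
    by (simp only: append_letter_sum shuffle_sum_left append_letter_linear shuffle_linear)
  also have "\<dots> = 0" unfolding alternating_shuffle_powers by simp
  finally show ?case unfolding Suc.IH by simp
qed simp

definition tower_of_lower_row :: "(word2 \<Rightarrow>\<^sub>0 rat) \<Rightarrow> (xy list \<Rightarrow>\<^sub>0 rat)"
  where "tower_of_lower_row = lin_ext (\<lambda>v. tower_word (map snd v))"

text \<open>
  The inverse of one step of the recursion for the swap, on words with upper row \<open>1, \<dots>, 1\<close>: of \<open>n\<close>
  units, \<open>j\<close> are added to the first lower entry and \<open>n - j\<close> form a new entry in front of it.
\<close>

fun split_first_letter :: "nat \<Rightarrow> nat \<Rightarrow> word2 \<Rightarrow> (word2 \<Rightarrow>\<^sub>0 rat)"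
  where
    "split_first_letter n j [] = 0"
  | "split_first_letter n j ((k, d) # v) = mon ((1, n - j) # (k, d + j) # v)"

lemma lookup_split_first_letter:
  "lookup (lin_ext (split_first_letter n j) p) ((k1, d1) # (k2, d2) # v) =
     (if k1 = 1 \<and> n - j = d1 \<and> j \<le> d2 then lookup p ((k2, d2 - j) # v) else 0)"
proof (induction p rule: poly_induct)
  case (mon c w)
  then show ?case
    by (cases "(n, j, w)" rule: split_first_letter.cases) (auto simp: lin_ext_scale lookup_single when_def)
qed (simp_all add: lin_ext_add lookup_add)

lemma lookup_split_first_letter_short:
  "length v \<le> 1 \<Longrightarrow> lookup (lin_ext (split_first_letter n j) p) v = 0"
proof (induction p rule: poly_induct)
  case (mon c w)
  then show ?case
    by (cases "(n, j, w)" rule: split_first_letter.cases) (auto simp: lin_ext_scale lookup_single when_def)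
qed (simp_all add: lin_ext_add lookup_add)

lemma swap_word_snoc:
  assumes w: "w \<in> lists letters" "\<forall>x\<in>set w. snd x = 0" "w \<noteq> []"
  shows "swap_word (w @ [(Suc n, 0)]) =
    (\<Sum>j\<le>n. scale ((-1) ^ j / (fact j * fact (n - j))) (lin_ext (split_first_letter n j) (swap_word w)))"
    (is "_ = ?R")
proof (rule poly_mapping_eqI)
  fix u
  have wn: "w @ [(Suc n, 0)] \<in> lists letters" using w by (simp add: letters_def)
  show "lookup (swap_word (w @ [(Suc n, 0)])) u = lookup ?R u"
  proof (cases "length u \<le> 1")
    case True
    then have "length u \<noteq> length (w @ [(Suc n, 0)])" using w(3) by (cases w) auto
    then show ?thesis
      using True by (simp add: lookup_swap_word swap_coeff_eq lookup_sum lookup_split_first_letter_short)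
  next
    case False
    then obtain x y v where "u = x # y # v" by (cases u; cases "tl u") auto
    then obtain k1 d1 k2 d2 where u: "u = (k1, d1) # (k2, d2) # v" by (cases x; cases y) auto
    have R: "lookup ?R u = (\<Sum>j\<le>n. if j = n - d1 then
       (if k1 = 1 \<and> d1 \<le> n \<and> j \<le> d2 then (-1) ^ j / (fact j * fact (n - j)) * swap_coeff w ((k2, d2 - j) # v) else 0) else 0)"
      unfolding u lookup_sum lookup_scale lookup_split_first_letter lookup_swap_word by (intro sum.cong) auto
    define j where "j = n - d1"
    have R': "lookup ?R u = (if k1 = 1 \<and> d1 \<le> n \<and> j \<le> d2
       then (-1) ^ j / (fact j * fact d1) * swap_coeff w ((k2, d2 - j) # v) else 0)"
      unfolding R by (simp add: sum.delta j_def)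
    show ?thesis
    proof (cases "k1 = 1 \<and> length w = Suc (length v) \<and> (k2, d2) # v \<in> lists letters")
      case True
      have len: "length w = Suc (length v)" using True by simp
      have "1 \<le> k2" using True by (auto simp: letters_def)
      then have k2: "Suc (k2 - 1 + (1 - 1 - 0)) = k2" by simp
      have uL: "u \<in> lists letters" "(k2, d2 - j) # v \<in> lists letters"
        using True by (auto simp: u letters_def)
      have c: "swap_coeff w ((k2, d2 - j) # v) = fact_lower w / (fact (d2 - j) * fact_lower v) * swap_lookup w ((k2, d2 - j) # v)"
        using uL(2) len by (simp add: swap_coeff_eq)
      have "swap_coeff (w @ [(Suc n, 0)]) u = fact_lower w / (fact d1 * (fact d2 * fact_lower v)) *
        swap_lookup (w @ [(Suc n, 0)]) u"
        using uL(1) len by (simp add: swap_coeff_eq u)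
      also have "swap_lookup (w @ [(Suc n, 0)]) u = (if d1 \<le> n then of_nat (d2 choose j) * (-1) ^ j * swap_lookup w ((k2, d2 - j) # v) else 0)"
        using swap_lookup_snoc[OF len, of "Suc n" 0 1 d1 k2 d2] unfolding k2
        using True by (simp add: u j_def)
      finally have L: "swap_coeff (w @ [(Suc n, 0)]) u = (if d1 \<le> n then fact_lower w / (fact d1 * (fact d2 * fact_lower v)) *
        (of_nat (d2 choose j) * (-1) ^ j * swap_lookup w ((k2, d2 - j) # v)) else 0)" by simp
      show ?thesis
      proof (cases "j \<le> d2")
        case True
        then show ?thesis using \<open>k1 = 1 \<and> _\<close> unfolding R' lookup_swap_word L c
          by (simp add: binomial_fact field_simps)
      next
        case False
        then show ?thesis unfolding R' lookup_swap_word L by (simp add: binomial_eq_0)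
      qed
    next
      case False
      have "swap_coeff (w @ [(Suc n, 0)]) u = 0"
      proof (rule ccontr)
        assume nz: "swap_coeff (w @ [(Suc n, 0)]) u \<noteq> 0"
        from swap_coeff_nonzero[OF nz wn] w(2) have "length u = Suc (length w)" "u \<in> lists letters" "\<forall>x\<in>set u. fst x = 1"
          by simp_all
        then show False using False by (simp add: u)
      qed
      moreover have "swap_coeff w ((k2, d2 - j) # v) = 0" if "k1 = 1"
        using False that by (auto simp: swap_coeff_eq letters_def)
      ultimately show ?thesis unfolding R' lookup_swap_word by simp
    qed
  qed
qed

lemma tower_of_lower_row_split_first_letter:
  assumes "v \<noteq> []"
  shows "(\<Sum>j\<le>n. scale ((-1) ^ j / (fact j * fact (n - j))) (tower_of_lower_row (split_first_letter n j v))) =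
    append_letter LY (append_power LX n (tower_word (map snd v)))"
proof -
  obtain k d u where v: "v = (k, d) # u" using assms by (cases v) auto
  define P where "P = shuffle (scale (fact d) (mon (replicate d LX))) (tower_word (map snd u))"
  have 1: "scale (fact (d + j)) (mon (replicate (d + j) LX)) =
    scale (fact j) (shuffle (mon (replicate j LX)) (scale (fact d) (mon (replicate d LX))))" for j
    by (simp add: shuffle_mon shuffle_word_replicate binomial_fact add.commute)
  have "scale ((-1) ^ j / (fact j * fact (n - j))) (tower_of_lower_row (split_first_letter n j v)) =
    append_letter LY (scale ((-1) ^ j) (shuffle (mon (replicate (n - j) LX))
      (append_letter LY (shuffle (mon (replicate j LX)) P))))" for j
    unfolding v P_def tower_of_lower_row_def by (simp add: 1 shuffle_assoc)
  then have "(\<Sum>j\<le>n. scale ((-1) ^ j / (fact j * fact (n - j))) (tower_of_lower_row (split_first_letter n j v))) =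
     append_letter LY (append_power LX n (append_letter LY P))"
    by (simp only: append_letter_sum[symmetric] alternating_shuffle_append)
  then show ?thesis by (simp add: v P_def)
qed

text \<open>
  By induction from the end of \<open>ks\<close>: \<open>swap_word_snoc\<close> expresses the swap through that of a shorter word,
  and \<open>tower\<close> turns the alternating sum that arises into the word with \<open>x\<^sup>k\<^sup>-\<^sup>1 y\<close> appended.
\<close>

lemma tower_swap_upper_word:
  assumes "\<forall>k\<in>set ks. 1 \<le> k"
  shows "tower_of_lower_row (swap_word (upper_word ks)) = mon (xy_word ks)"
  using assms
proof (induction ks rule: rev_induct)
  case Nil
  have "swap_word [] = mon []"
    by (rule poly_mapping_eqI) (auto simp: lookup_swap_word swap_coeff_eq lookup_single when_def)
  then show ?case by (simp add: tower_of_lower_row_def)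
next
  case (snoc k ks)
  define n where "n = k - 1"
  have k: "k = Suc n" using snoc.prems by (simp add: n_def)
  show ?case
  proof (cases "ks = []")
    case True
    have "swap_word [(Suc n, 0)] = scale (1 / fact n) (mon [(1, n)])"
    proof (rule poly_mapping_eqI)
      fix v :: word2
      show "lookup (swap_word [(Suc n, 0)]) v = lookup (scale (1 / fact n) (mon [(1, n)])) v"
      proof (cases "length v = 1")
        case True
        then obtain k' d where "v = [(k', d)]" by (cases v) auto
        then show ?thesis
          by (auto simp: lookup_swap_word swap_coeff_eq swap_lookup_single lookup_single when_def letters_def)
      qed (auto simp: lookup_swap_word swap_coeff_eq lookup_single when_def)
    qed
    then show ?thesis
      using True by (simp add: k tower_of_lower_row_def lin_ext_scale append_letter_mon)
  next
    case False
    let ?w = "upper_word ks"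
    have w: "?w \<in> lists letters" "\<forall>x\<in>set ?w. snd x = 0" "?w \<noteq> []"
      using snoc.prems False by (auto simp: letters_def)
    have "tower_of_lower_row (swap_word (upper_word (ks @ [k]))) =
      lin_ext (\<lambda>v. \<Sum>j\<le>n. scale ((-1) ^ j / (fact j * fact (n - j))) (tower_of_lower_row (split_first_letter n j v))) (swap_word ?w)"
      unfolding lin_ext_fun_sum lin_ext_fun_scale
      using swap_word_snoc[OF w, of n] by (simp add: k tower_of_lower_row_def lin_ext_sum lin_ext_scale lin_ext_lin_ext)
    also have "\<dots> = lin_ext (\<lambda>v. append_letter LY (append_power LX n (tower_word (map snd v)))) (swap_word ?w)"
    proof (rule lin_ext_cong)
      fix v assume "v \<in> supp (swap_word ?w)"
      then have "length v = length ?w" by (auto simp: in_keys_iff lookup_swap_word swap_coeff_eq split: if_splits)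
      then have "v \<noteq> []" using w(3) by auto
      then show "(\<Sum>j\<le>n. scale ((-1) ^ j / (fact j * fact (n - j))) (tower_of_lower_row (split_first_letter n j v))) =
         append_letter LY (append_power LX n (tower_word (map snd v)))"
        by (rule tower_of_lower_row_split_first_letter)
    qed
    also have "\<dots> = append_letter LY (append_power LX n (tower_of_lower_row (swap_word ?w)))"
    proof -
      have "lin_ext (\<lambda>v. append_letter LY (append_power LX n (f v))) p = append_letter LY (append_power LX n (lin_ext f p))"
        for f and p :: "word2 \<Rightarrow>\<^sub>0 rat"
        by (induction p rule: poly_induct) (simp_all add: lin_ext_add lin_ext_scale)
      then show ?thesis by (simp add: tower_of_lower_row_def)
    qed
    also have "tower_of_lower_row (swap_word ?w) = mon (xy_word ks)"
      using snoc by simp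
    finally show ?thesis by (simp add: k append_power_mon append_letter_mon)
  qed
qed

section \<open>The swap and convolutions\<close>

lemma lin_ext_swap_append:
  fixes f h :: "word2 \<Rightarrow> nat poly_word"
  assumes f: "\<And>v. f v \<noteq> 0 \<Longrightarrow> \<forall>x\<in>set v. fst x = 1"
    and h: "\<And>v. h v \<noteq> 0 \<Longrightarrow> \<forall>x\<in>set v. snd x = 0"
  shows "lin_ext (\<lambda>v. stuffle (f (take (length w3) v)) (h (drop (length w3) v))) (swap_word (w1 @ w3)) =
    stuffle (lin_ext f (swap_word w3)) (lin_ext h (swap_word w1))"
proof -
  let ?T = "\<lambda>v. stuffle (f (take (length w3) v)) (h (drop (length w3) v))"
  let ?c = "\<lambda>v. swap_coeff (w1 @ w3) v"
  define A where "A = supp (swap_word w3)"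
  define B where "B = supp (swap_word w1)"
  have lenA: "length a = length w3" if "a \<in> A" for a
    using that by (auto simp: A_def in_keys_iff lookup_swap_word swap_coeff_eq split: if_splits)
  have lenB: "length b = length w1" if "b \<in> B" for b
    using that by (auto simp: B_def in_keys_iff lookup_swap_word swap_coeff_eq split: if_splits)
  define S where "S = (\<lambda>(a, b). a @ b) ` (A \<times> B)"
  have fin: "finite S" by (simp add: S_def A_def B_def)
  let ?KS = "supp (swap_word (w1 @ w3)) \<union> S"
  \<comment> \<open>If neither test function vanishes, the coefficient factorises, and it is zero unless both factors occur.\<close>
  have out: "scale (?c v) (?T v) = 0" if "v \<notin> S" for v
  proof (rule ccontr)
    assume nz: "scale (?c v) (?T v) \<noteq> 0"
    let ?a = "take (length w3) v" and ?b = "drop (length w3) v"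
    have c: "?c v \<noteq> 0" using nz by auto
    then have len: "length v = length w1 + length w3" by (auto simp: swap_coeff_eq split: if_splits)
    have "f ?a \<noteq> 0" "h ?b \<noteq> 0" using nz by auto
    then have "?c (?a @ ?b) = swap_coeff w3 ?a * swap_coeff w1 ?b"
      using len by (intro swap_coeff_append f h) auto
    then have "?a \<in> A" "?b \<in> B" using c by (auto simp: A_def B_def in_keys_iff lookup_swap_word)
    then have "v \<in> S" unfolding S_def by (metis (mono_tags, lifting) SigmaI append_take_drop_id case_prod_conv image_eqI)
    with that show False by contradiction
  qed
  have inj: "inj_on (\<lambda>(a, b). a @ b) (A \<times> B)"
    using lenA by (auto simp: inj_on_def)
  have "lin_ext ?T (swap_word (w1 @ w3)) = (\<Sum>v\<in>?KS. scale (?c v) (?T v))"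
    using fin by (subst lin_ext_superset[of ?KS]) (simp_all add: lookup_swap_word)
  also have "\<dots> = (\<Sum>v\<in>S. scale (?c v) (?T v))"
    using fin out by (intro sum.mono_neutral_right) auto
  also have "\<dots> = (\<Sum>(a, b)\<in>A \<times> B. scale (?c (a @ b)) (?T (a @ b)))"
    unfolding S_def by (subst sum.reindex[OF inj]) (simp add: case_prod_unfold comp_def)
  also have "\<dots> = (\<Sum>(a, b)\<in>A \<times> B. stuffle (scale (swap_coeff w3 a) (f a)) (scale (swap_coeff w1 b) (h b)))"
  proof (intro sum.cong refl, clarify)
    fix a b assume ab: "a \<in> A" "b \<in> B"
    have T: "?T (a @ b) = stuffle (f a) (h b)" using lenA[OF ab(1)] by simp
    show "scale (?c (a @ b)) (?T (a @ b)) = stuffle (scale (swap_coeff w3 a) (f a)) (scale (swap_coeff w1 b) (h b))"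
    proof (cases "f a = 0 \<or> h b = 0")
      case True
      then show ?thesis unfolding T by auto
    next
      case False
      then have "?c (a @ b) = swap_coeff w3 a * swap_coeff w1 b"
        using lenA[OF ab(1)] lenB[OF ab(2)] by (intro swap_coeff_append f h) auto
      then show ?thesis unfolding T by (simp add: mult.commute)
    qed
  qed
  also have "\<dots> = stuffle (lin_ext f (swap_word w3)) (lin_ext h (swap_word w1))"
    unfolding lin_ext_def A_def[symmetric] B_def[symmetric] lookup_swap_word stuffle_sum_left stuffle_sum_right
    by (simp add: sum.cartesian_product[symmetric] del: stuffle_linear) (rule sum.swap)
  finally show ?thesis .
qed

text \<open>
  The swap reverses convolutions whose factors are supported on words with upper row \<open>1, \<dots>, 1\<close> and
  with lower row \<open>0, \<dots>, 0\<close>, respectively: by \<open>swap_coeff_append\<close> the swap of \<open>w\<close> is, on the words that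
  matter, the concatenation of the swap of a final part and the swap of an initial part of \<open>w\<close>.
\<close>

lemma conv_swap:
  fixes f h :: "word2 \<Rightarrow> nat poly_word"
  assumes f: "\<And>v. f v \<noteq> 0 \<Longrightarrow> \<forall>x\<in>set v. fst x = 1"
    and h: "\<And>v. h v \<noteq> 0 \<Longrightarrow> \<forall>x\<in>set v. snd x = 0"
  shows "lin_ext (conv stuffle f h) (swap_word w) =
    conv stuffle (\<lambda>u. lin_ext h (swap_word u)) (\<lambda>u. lin_ext f (swap_word u)) w"
proof -
  let ?r = "length w"
  have "lin_ext (conv stuffle f h) (swap_word w) =
    lin_ext (\<lambda>v. \<Sum>i\<le>?r. stuffle (f (take i v)) (h (drop i v))) (swap_word w)"
    by (intro lin_ext_cong) (auto simp: conv_eq_sum in_keys_iff lookup_swap_word swap_coeff_eq split: if_splits)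
  also have "\<dots> = (\<Sum>i\<le>?r. lin_ext (\<lambda>v. stuffle (f (take i v)) (h (drop i v))) (swap_word w))"
    by (rule lin_ext_fun_sum)
  also have "\<dots> = (\<Sum>i\<le>?r. stuffle (lin_ext h (swap_word (take (?r - i) w))) (lin_ext f (swap_word (drop (?r - i) w))))"
  proof (intro sum.cong refl)
    fix i assume "i \<in> {..?r}"
    then have i: "length (drop (?r - i) w) = i" by simp
    show "lin_ext (\<lambda>v. stuffle (f (take i v)) (h (drop i v))) (swap_word w) =
      stuffle (lin_ext h (swap_word (take (?r - i) w))) (lin_ext f (swap_word (drop (?r - i) w)))"
      using lin_ext_swap_append[of f h "drop (?r - i) w" "take (?r - i) w", OF f h]
      unfolding i append_take_drop_id by (simp add: stuffle_comm)
  qed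
  also have "\<dots> = (\<Sum>i\<le>?r. stuffle (lin_ext h (swap_word (take i w))) (lin_ext f (swap_word (drop i w))))"
    by (rule sum.reindex_bij_witness[of _ "\<lambda>j. ?r - j" "\<lambda>j. ?r - j"]) auto
  finally show ?thesis by (simp add: conv_eq_sum)
qed

section \<open>The realisation of words by formal multiple zeta values\<close>

definition on_lower :: "(nat list \<Rightarrow> 'b poly_word) \<Rightarrow> word2 \<Rightarrow> 'b poly_word"
  where "on_lower f w = (if \<forall>x\<in>set w. fst x = 1 then f (map snd w) else 0)"

definition on_upper :: "(nat list \<Rightarrow> 'b poly_word) \<Rightarrow> word2 \<Rightarrow> 'b poly_word"
  where "on_upper f w = (if \<forall>x\<in>set w. snd x = 0 then f (map fst w) else 0)"

lemma on_lower_Cons: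
  "on_lower f ((k, d) # w) = (if k = 1 then on_lower (\<lambda>u. f (d # u)) w else 0)"
  by (simp add: on_lower_def)

lemma on_upper_Cons:
  "on_upper f ((k, d) # w) = (if d = 0 then on_upper (\<lambda>u. f (k # u)) w else 0)"
  by (simp add: on_upper_def)

lemma on_lower_prepend:
  "lin_ext (on_lower f) (prepend (k, d) p) = (if k = 1 then lin_ext (on_lower (\<lambda>u. f (d # u))) p else 0)"
  by (simp add: lin_ext_prepend on_lower_Cons lin_ext_fun_zero)

lemma on_upper_prepend:
  "lin_ext (on_upper f) (prepend (k, d) p) = (if d = 0 then lin_ext (on_upper (\<lambda>u. f (k # u))) p else 0)"
  by (simp add: lin_ext_prepend on_upper_Cons lin_ext_fun_zero)

text \<open>
  A merged letter has upper entry at least \<open>2\<close> and is killed, which turns stuffles into shuffles.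
\<close>

lemma on_lower_stuffle:
  assumes "w \<in> lists letters" "v \<in> lists letters"
  shows "lin_ext (on_lower f) (stuffle_word w v) =
    (if (\<forall>x\<in>set w. fst x = 1) \<and> (\<forall>x\<in>set v. fst x = 1)
     then lin_ext f (shuffle_word (map snd w) (map snd v)) else 0)"
  using assms
proof (induction w v arbitrary: f rule: stuffle_word.induct)
  case (3 a w b v)
  obtain k d k' d' where ab: "a = (k, d)" "b = (k', d')" by (cases a; cases b)
  have "1 \<le> k" "1 \<le> k'" using 3 by (auto simp: ab letters_def)
  then have "k + k' \<noteq> 1" by linarith
  then have L: "lin_ext (on_lower f) (stuffle_word (a # w) (b # v)) =
      (if k = 1 then lin_ext (on_lower (\<lambda>u. f (d # u))) (stuffle_word w (b # v)) else 0)
      + (if k' = 1 then lin_ext (on_lower (\<lambda>u. f (d' # u))) (stuffle_word (a # w) v) else 0)"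
    by (simp only: ab stuffle_word.simps add_Pair lin_ext_add on_lower_prepend if_False add_0_right)
  have R: "lin_ext f (shuffle_word (map snd (a # w)) (map snd (b # v))) =
      lin_ext (\<lambda>u. f (d # u)) (shuffle_word (map snd w) (map snd (b # v)))
      + lin_ext (\<lambda>u. f (d' # u)) (shuffle_word (map snd (a # w)) (map snd v))"
    by (simp add: ab lin_ext_add lin_ext_prepend)
  have "w \<in> lists letters" "v \<in> lists letters" using 3 by auto
  note IH = 3(1)[OF this(1) 3(5)] 3(2)[OF 3(4) this(2)]
  show ?case unfolding L R IH by (simp add: ab)
qed (auto simp: on_lower_def)

lemma on_upper_stuffle:
  "lin_ext (on_upper f) (stuffle_word w v) =
    (if (\<forall>x\<in>set w. snd x = 0) \<and> (\<forall>x\<in>set v. snd x = 0)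
     then lin_ext f (stuffle_word (map fst w) (map fst v)) else 0)"
proof (induction w v arbitrary: f rule: stuffle_word.induct)
  case (3 a w b v)
  obtain k d k' d' where ab: "a = (k, d)" "b = (k', d')" by (cases a; cases b)
  have L: "lin_ext (on_upper f) (stuffle_word (a # w) (b # v)) =
      (if d = 0 then lin_ext (on_upper (\<lambda>u. f (k # u))) (stuffle_word w (b # v)) else 0)
      + (if d' = 0 then lin_ext (on_upper (\<lambda>u. f (k' # u))) (stuffle_word (a # w) v) else 0)
      + (if d + d' = 0 then lin_ext (on_upper (\<lambda>u. f ((k + k') # u))) (stuffle_word w v) else 0)"
    by (simp only: ab stuffle_word.simps add_Pair lin_ext_add on_upper_prepend)
  have R: "lin_ext f (stuffle_word (map fst (a # w)) (map fst (b # v))) =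
      lin_ext (\<lambda>u. f (k # u)) (stuffle_word (map fst w) (map fst (b # v)))
      + lin_ext (\<lambda>u. f (k' # u)) (stuffle_word (map fst (a # w)) (map fst v))
      + lin_ext (\<lambda>u. f ((k + k') # u)) (stuffle_word (map fst w) (map fst v))"
    by (simp add: ab lin_ext_add lin_ext_prepend)
  show ?case unfolding L R 3 by (simp add: ab)
qed (auto simp: on_upper_def)

definition zeta_of_lower :: "word2 \<Rightarrow> nat poly_word"
  where "zeta_of_lower = on_lower (\<lambda>ds. from_xy (reg (tower_word ds)))"

definition zeta_of_upper :: "word2 \<Rightarrow> nat poly_word"
  where "zeta_of_upper = on_upper mon"

definition reg_zeta_of_upper :: "word2 \<Rightarrow> nat poly_word"
  where "reg_zeta_of_upper = on_upper (\<lambda>ks. from_xy (reg (mon (xy_word ks))))"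

definition zeta_of_ones :: "word2 \<Rightarrow> nat poly_word"
  where "zeta_of_ones = on_upper (letter_power 1 1)"

text \<open>
  The value of a word. Only the cuts into a part with upper row \<open>1, \<dots>, 1\<close> and a part with lower row
  \<open>0, \<dots>, 0\<close> contribute, so the value is zero unless the word is of zeta type.
\<close>

definition zeta_of_word :: "word2 \<Rightarrow> nat poly_word"
  where "zeta_of_word = conv stuffle zeta_of_lower zeta_of_upper"

lemma H1_eds: "stuffle_algebra {k::nat. 1 \<le> k} = H1"
  by (simp add: H1_def)

lemma H1_simps [simp]:
  "0 \<in> carrier H1" "p \<in> carrier H1 \<Longrightarrow> q \<in> carrier H1 \<Longrightarrow> p + q \<in> carrier H1"
  "p \<in> carrier H1 \<Longrightarrow> q \<in> carrier H1 \<Longrightarrow> p - q \<in> carrier H1"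
  "p \<in> carrier H1 \<Longrightarrow> scale c p \<in> carrier H1"
  "p \<in> carrier H1 \<Longrightarrow> q \<in> carrier H1 \<Longrightarrow> stuffle p q \<in> carrier H1"
  "mon w \<in> carrier H1 \<longleftrightarrow> w \<in> lists {k. 1 \<le> k}"
  by (fact eds.carrier_simps[unfolded H1_eds])+

lemma zeta_of_lower_carrier: "zeta_of_lower w \<in> carrier H1"
  by (simp add: zeta_of_lower_def on_lower_def from_xy_carrier)

lemma zeta_of_upper_carrier: "w \<in> lists letters \<Longrightarrow> zeta_of_upper w \<in> carrier H1"
  by (auto simp: zeta_of_upper_def on_upper_def in_lists_letters)

lemma take_drop_letters:
  assumes "w \<in> lists letters"
  shows "take i w \<in> lists letters" "drop i w \<in> lists letters"
  using assms set_take_subset[of i w] set_drop_subset[of i w] unfolding in_lists_conv_set by blast+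

lemma zeta_of_word_carrier:
  assumes "w \<in> lists letters"
  shows "zeta_of_word w \<in> carrier H1"
proof -
  have "stuffle (zeta_of_lower (take i w)) (zeta_of_upper (drop i w)) \<in> carrier H1" for i
    by (intro H1_simps zeta_of_lower_carrier zeta_of_upper_carrier take_drop_letters assms)
  then show ?thesis
    unfolding zeta_of_word_def conv_eq_sum by (intro eds.sum_carrier[unfolded H1_eds])
qed

lemma lin_ext_from_xy_reg: "lin_ext (\<lambda>w. from_xy (reg (f w))) p = from_xy (reg (lin_ext f p))"
  by (induction p rule: poly_induct) (simp_all add: lin_ext_add lin_ext_scale reg_def)

lemma reg_tower_relation:
  "from_xy (reg (shuffle (tower_word ds) (tower_word es))) \<doteq>
   stuffle (from_xy (reg (tower_word ds))) (from_xy (reg (tower_word es)))"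
  unfolding reg_shuffle
  by (rule eds.eqv_sym, rule eds_relation)
    (rule reg_closed[OF tower_word_closed], rule reg_closed[OF tower_word_closed], rule keys_reg_not_LY)

text \<open>
  Both factors \<open>reg (tower ds)\<close> are free of words starting in \<open>y\<close>, so the extended double shuffle
  relations replace their shuffle product by the stuffle product.
\<close>

lemma zeta_of_lower_stuffle:
  assumes "w \<in> lists letters" "v \<in> lists letters"
  shows "lin_ext zeta_of_lower (stuffle_word w v) \<doteq> stuffle (zeta_of_lower w) (zeta_of_lower v)"
proof (cases "(\<forall>x\<in>set w. fst x = 1) \<and> (\<forall>x\<in>set v. fst x = 1)")
  case True
  have "lin_ext tower_word (shuffle_word ds es) = shuffle (tower_word ds) (tower_word es)" for ds es
    using tower_shuffle[of "mon ds" "mon es"] by (simp add: tower_def shuffle_mon)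
  then have "lin_ext zeta_of_lower (stuffle_word w v) =
      from_xy (reg (shuffle (tower_word (map snd w)) (tower_word (map snd v))))"
    using True by (simp add: zeta_of_lower_def on_lower_stuffle[OF assms] lin_ext_from_xy_reg)
  moreover have "zeta_of_lower w = from_xy (reg (tower_word (map snd w)))" "zeta_of_lower v = from_xy (reg (tower_word (map snd v)))"
    using True by (simp_all add: zeta_of_lower_def on_lower_def)
  ultimately show ?thesis using reg_tower_relation by metis
next
  case False
  then have "zeta_of_lower w = 0 \<or> zeta_of_lower v = 0" by (auto simp: zeta_of_lower_def on_lower_def)
  then have "stuffle (zeta_of_lower w) (zeta_of_lower v) = 0" by auto
  moreover have "lin_ext zeta_of_lower (stuffle_word w v) = 0"
    unfolding zeta_of_lower_def on_lower_stuffle[OF assms] using False by (simp only: if_False)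
  ultimately show ?thesis by simp
qed

lemma zeta_of_upper_stuffle: "lin_ext zeta_of_upper (stuffle_word w v) = stuffle (zeta_of_upper w) (zeta_of_upper v)"
  unfolding zeta_of_upper_def on_upper_stuffle by (auto simp: on_upper_def stuffle_mon)

lemma zeta_of_word_stuffle:
  assumes w: "w \<in> lists letters" and v: "v \<in> lists letters"
  shows "lin_ext zeta_of_word (stuffle_word w v) \<doteq> stuffle (zeta_of_word w) (zeta_of_word v)"
proof -
  have "lin_ext zeta_of_word (stuffle_word w v) = lin_ext (deconcat (\<lambda>u v. stuffle (zeta_of_lower u) (zeta_of_upper v))) (stuffle_word w v)"
    by (simp add: deconcat_conv[abs_def] zeta_of_word_def)
  also have "\<dots> = (\<Sum>i\<le>length w. \<Sum>j\<le>length v.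
      stuffle (lin_ext zeta_of_lower (stuffle_word (take i w) (take j v))) (lin_ext zeta_of_upper (stuffle_word (drop i w) (drop j v))))"
    unfolding stuffle_word_eq_qshuffle deconcat_qshuffle bilin_ext_stuffle ..
  also have "\<dots> \<doteq> (\<Sum>i\<le>length w. \<Sum>j\<le>length v.
      stuffle (stuffle (zeta_of_lower (take i w)) (zeta_of_lower (take j v))) (stuffle (zeta_of_upper (drop i w)) (zeta_of_upper (drop j v))))"
    unfolding zeta_of_upper_stuffle
    by (intro eds.eqv_sum eds.eqv_mult_left zeta_of_lower_stuffle take_drop_letters w v)
      (unfold H1_eds, intro H1_simps zeta_of_upper_carrier take_drop_letters w v)
  also have "\<dots> = stuffle (zeta_of_word w) (zeta_of_word v)"
  proof -
    have "stuffle (stuffle a b) (stuffle c d) = stuffle (stuffle a c) (stuffle b d)" for a b c d :: "nat poly_word"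
      by (metis stuffle_assoc stuffle_comm)
    then show ?thesis by (simp add: zeta_of_word_def conv_eq_sum stuffle_sum_left stuffle_sum_right) (rule sum.swap)
  qed
  finally show ?thesis .
qed

lemma conv_map: "conv m f g (map h w) = conv m (\<lambda>u. f (map h u)) (\<lambda>u. g (map h u)) w"
  by (simp add: conv_eq_sum take_map drop_map)

lemma conv_xy_word:
  assumes "\<And>u. \<not> set u \<subseteq> {LY} \<Longrightarrow> f u = 0" "\<forall>k\<in>set ks. 1 \<le> k"
  shows "conv shuffle f g (xy_word ks) =
    conv shuffle (\<lambda>u. f (xy_word u)) (\<lambda>v. g (xy_word v)) ks"
  using assms
proof (induction ks arbitrary: f)
  case (Cons k ks)
  show ?case
  proof (cases "k = 1")
    case True
    then show ?thesis using Cons.IH[of "\<lambda>u. f (LY # u)"] Cons.prems by simp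
  next
    case False
    then obtain m where "k = Suc (Suc m)" using Cons.prems(2) by (cases k; cases "k - 1") auto
    moreover have "f (LX # u) = 0" for u using Cons.prems(1)[of "LX # u"] by simp
    ultimately show ?thesis by (simp add: conv_zero)
  qed
qed simp

section \<open>Invariance under the swap\<close>

lemma letter_power_one: "letter_power a 1 w = (if set w \<subseteq> {a} then mon w else 0)"
  by (simp add: letter_power_def)

lemma set_xy_word_subset: "\<forall>k\<in>set ls. 1 \<le> k \<Longrightarrow> set (xy_word ls) \<subseteq> {LY} \<longleftrightarrow> set ls \<subseteq> {1}"
proof (induction ls)
  case (Cons k ls)
  then show ?case by (cases "k = 1") (auto simp: set_replicate_conv_if)
qed simp

lemma from_xy_sum: "from_xy (sum f A) = (\<Sum>x\<in>A. from_xy (f x))"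
  by (simp add: from_xy_def lin_ext_sum)

text \<open>
  The comparison of the two regularisations. The word is \<open>\<Sum>\<^sub>i y\<^sup>i sh reg (\<partial>\<^sup>i w)\<close> by
  \<open>conv_letter_power_reg\<close>, and the extended double shuffle relations replace these shuffle products by
  stuffle products.
\<close>

lemma word_regularised:
  assumes ks: "\<forall>k\<in>set ks. 1 \<le> k"
  shows "mon ks \<doteq> conv stuffle (letter_power 1 1) (\<lambda>ls. from_xy (reg (mon (xy_word ls)))) ks"
proof -
  have "mon ks = from_xy (mon (xy_word ks))"
    by (simp add: z_word_xy_word[OF ks])
  also have "mon (xy_word ks) = conv shuffle (letter_power LY 1) reg_word (xy_word ks)"
    by (rule conv_letter_power_reg[symmetric])
  also have "\<dots> = conv shuffle (\<lambda>u. letter_power LY 1 (xy_word u)) (\<lambda>v. reg_word (xy_word v)) ks"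
    by (rule conv_xy_word) (simp add: letter_power_one, rule ks)
  also have "from_xy \<dots> = (\<Sum>i\<le>length ks. from_xy (shuffle (letter_power LY 1 (xy_word (take i ks))) (reg_word (xy_word (drop i ks)))))"
    by (simp only: conv_eq_sum from_xy_sum)
  also have "\<dots> \<doteq> (\<Sum>i\<le>length ks. stuffle (letter_power 1 1 (take i ks)) (from_xy (reg (mon (xy_word (drop i ks))))))"
  proof (rule eds.eqv_sum)
    fix i
    let ?u = "take i ks" and ?v = "drop i ks"
    have u: "\<forall>k\<in>set ?u. 1 \<le> k" using ks by (auto dest: in_set_takeD)
    have r: "reg_word (xy_word ?v) = reg (mon (xy_word ?v))" by (simp add: reg_def)
    show "from_xy (shuffle (letter_power LY 1 (xy_word ?u)) (reg_word (xy_word ?v))) \<doteq>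
      stuffle (letter_power 1 1 ?u) (from_xy (reg (mon (xy_word ?v))))"
    proof (cases "set ?u \<subseteq> {1}")
      case True
      have 1: "letter_power LY 1 (xy_word ?u) = mon (xy_word ?u)" "letter_power 1 1 ?u = mon ?u"
        using True set_xy_word_subset[OF u] by (simp_all only: letter_power_one if_True)
      have 2: "mon ?u = from_xy (mon (xy_word ?u))" by (simp add: z_word_xy_word[OF u])
      have c: "mon (xy_word ls) \<in> y_polys" for ls using xy_word_closed by simp
      show ?thesis unfolding 1 r 2
        by (rule eds.eqv_sym, rule eds_relation) (rule c, rule reg_closed[OF c], rule keys_reg_not_LY)
    next
      case False
      then have "letter_power LY 1 (xy_word ?u) = 0" "letter_power 1 1 ?u = 0"
        using set_xy_word_subset[OF u] by (simp_all only: letter_power_one if_False)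
      then show ?thesis by simp
    qed
  qed
  finally show ?thesis by (simp only: conv_eq_sum)
qed

lemma zeta_of_upper_eqv:
  assumes "w \<in> lists letters"
  shows "zeta_of_upper w \<doteq> conv stuffle zeta_of_ones reg_zeta_of_upper w"
proof (cases "\<forall>x\<in>set w. snd x = 0")
  case True
  define ks where "ks = map fst w"
  have w: "w = upper_word ks" unfolding ks_def using True by (auto intro!: map_idI[symmetric] simp: comp_def prod_eq_iff)
  have ks: "\<forall>k\<in>set ks. 1 \<le> k" using assms by (auto simp: ks_def in_lists_letters)
  have "zeta_of_ones (upper_word u) = letter_power 1 1 u" "reg_zeta_of_upper (upper_word u) = from_xy (reg (mon (xy_word u)))"
    "zeta_of_upper (upper_word u) = mon u" for u
    by (simp_all add: zeta_of_ones_def reg_zeta_of_upper_def zeta_of_upper_def on_upper_def comp_def)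
  then show ?thesis using word_regularised[OF ks] by (simp add: w conv_map)
next
  case False
  have "stuffle (zeta_of_ones (take i w)) (reg_zeta_of_upper (drop i w)) = 0" for i
  proof -
    have "\<not> ((\<forall>x\<in>set (take i w). snd x = 0) \<and> (\<forall>x\<in>set (drop i w). snd x = 0))"
      using False by (metis UnE append_take_drop_id set_append)
    then have "zeta_of_ones (take i w) = 0 \<or> reg_zeta_of_upper (drop i w) = 0"
      by (auto simp: zeta_of_ones_def reg_zeta_of_upper_def on_upper_def)
    then show ?thesis by auto
  qed
  then have "conv stuffle zeta_of_ones reg_zeta_of_upper w = 0" by (simp add: conv_eq_sum)
  moreover have "zeta_of_upper w = 0" unfolding zeta_of_upper_def on_upper_def using False by (simp only: if_False)
  ultimately show ?thesis by simp
qed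

lemma zeta_of_word_eqv:
  assumes "w \<in> lists letters"
  shows "zeta_of_word w \<doteq> conv stuffle zeta_of_lower (conv stuffle zeta_of_ones reg_zeta_of_upper) w"
  unfolding zeta_of_word_def conv_eq_sum[of _ zeta_of_lower]
proof (rule eds.eqv_sum)
  fix i
  have "zeta_of_upper (drop i w) \<doteq> conv stuffle zeta_of_ones reg_zeta_of_upper (drop i w)"
    by (intro zeta_of_upper_eqv take_drop_letters assms)
  moreover have "zeta_of_upper (drop i w) \<in> carrier H1"
    by (intro zeta_of_upper_carrier take_drop_letters assms)
  ultimately show "stuffle (zeta_of_lower (take i w)) (zeta_of_upper (drop i w)) \<doteq> stuffle (zeta_of_lower (take i w)) (conv stuffle zeta_of_ones reg_zeta_of_upper (drop i w))"
    by (intro eds.eqv_mult, unfold H1_eds) (simp, assumption+, rule zeta_of_lower_carrier)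
qed

lemma in_keys_swap: "v \<in> supp (swap_word u) \<longleftrightarrow> swap_coeff u v \<noteq> 0"
  by (simp add: in_keys_iff lookup_swap_word)

lemma lower_word_eq: "\<forall>x\<in>set u. fst x = 1 \<Longrightarrow> u = lower_word (map snd u)"
  by (auto intro!: map_idI[symmetric] simp: comp_def prod_eq_iff)

lemma upper_word_eq: "\<forall>x\<in>set u. snd x = 0 \<Longrightarrow> u = upper_word (map fst u)"
  by (auto intro!: map_idI[symmetric] simp: comp_def prod_eq_iff)

lemma reg_zeta_of_upper_swap:
  assumes "u \<in> lists letters"
  shows "lin_ext reg_zeta_of_upper (swap_word u) = zeta_of_lower u"
proof (cases "\<forall>x\<in>set u. fst x = 1")
  case True
  define ds where "ds = map snd u"
  have u: "u = lower_word ds" unfolding ds_def by (rule lower_word_eq[OF True])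
  have "reg_zeta_of_upper (upper_word ks) = from_xy (reg (mon (xy_word ks)))" for ks
    by (simp add: reg_zeta_of_upper_def on_upper_def comp_def)
  then have "lin_ext reg_zeta_of_upper (upper q) = from_xy (reg (to_xy q))" for q
    by (simp add: upper_def lin_ext_lin_ext lin_ext_from_xy_reg to_xy_eq)
  moreover have "zeta_of_lower u = from_xy (reg (tower_word ds))"
    by (simp add: u zeta_of_lower_def on_lower_def comp_def)
  ultimately show ?thesis
    by (simp only: u swap_lower_word to_xy_from_xy[OF tower_word_closed])
next
  case False
  have "reg_zeta_of_upper v = 0" if "v \<in> supp (swap_word u)" for v
  proof -
    have "\<not> (\<forall>x\<in>set v. snd x = 0)"
      using that False swap_coeff_nonzero(4)[of u v] assms unfolding in_keys_swap by blast
    then show ?thesis unfolding reg_zeta_of_upper_def on_upper_def by (simp only: if_False)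
  qed
  then have "lin_ext reg_zeta_of_upper (swap_word u) = 0" by (rule lin_ext_eq_0)
  moreover have "zeta_of_lower u = 0" unfolding zeta_of_lower_def on_lower_def using False by (simp only: if_False)
  ultimately show ?thesis by simp
qed

lemma zeta_of_lower_swap:
  assumes "u \<in> lists letters"
  shows "lin_ext zeta_of_lower (swap_word u) = reg_zeta_of_upper u"
proof (cases "\<forall>x\<in>set u. snd x = 0")
  case True
  define ks where "ks = map fst u"
  have u: "u = upper_word ks" unfolding ks_def by (rule upper_word_eq[OF True])
  have ks: "\<forall>k\<in>set ks. 1 \<le> k" using assms by (auto simp: ks_def in_lists_letters)
  have "lin_ext zeta_of_lower (swap_word u) = lin_ext (\<lambda>v. from_xy (reg (tower_word (map snd v)))) (swap_word u)"
  proof (rule lin_ext_cong)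
    fix v assume "v \<in> supp (swap_word u)"
    then have "\<forall>x\<in>set v. fst x = 1"
      using True swap_coeff_nonzero(3)[of u v] assms unfolding in_keys_swap by blast
    then show "zeta_of_lower v = from_xy (reg (tower_word (map snd v)))"
      unfolding zeta_of_lower_def on_lower_def by (rule if_P)
  qed
  also have "\<dots> = from_xy (reg (tower_of_lower_row (swap_word u)))"
    by (simp only: lin_ext_from_xy_reg tower_of_lower_row_def)
  also have "\<dots> = reg_zeta_of_upper u"
    unfolding u tower_swap_upper_word[OF ks] by (simp add: reg_zeta_of_upper_def on_upper_def comp_def)
  finally show ?thesis .
next
  case False
  have "zeta_of_lower v = 0" if "v \<in> supp (swap_word u)" for v
  proof -
    have "\<not> (\<forall>x\<in>set v. fst x = 1)"
      using that False swap_coeff_nonzero(3)[of u v] assms unfolding in_keys_swap by blast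
    then show ?thesis unfolding zeta_of_lower_def on_lower_def by (simp only: if_False)
  qed
  then have "lin_ext zeta_of_lower (swap_word u) = 0" by (rule lin_ext_eq_0)
  moreover have "reg_zeta_of_upper u = 0" unfolding reg_zeta_of_upper_def on_upper_def using False by (simp only: if_False)
  ultimately show ?thesis by simp
qed

lemma zeta_of_ones_nonzero: "zeta_of_ones w \<noteq> 0 \<Longrightarrow> (\<forall>x\<in>set w. snd x = 0) \<and> (\<forall>x\<in>set w. fst x = 1)"
  by (auto simp: zeta_of_ones_def on_upper_def letter_power_one split: if_splits)

lemma ones_eq: "(\<forall>x\<in>set w. snd x = 0) \<Longrightarrow> (\<forall>x\<in>set w. fst x = 1) \<Longrightarrow> w = replicate (length w) (1, 0::nat)"
  by (intro replicate_eqI) (auto simp: prod_eq_iff)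

lemma zeta_of_ones_swap:
  assumes "u \<in> lists letters"
  shows "lin_ext zeta_of_ones (swap_word u) = zeta_of_ones u"
proof (cases "(\<forall>x\<in>set u. snd x = 0) \<and> (\<forall>x\<in>set u. fst x = 1)")
  case True
  have u: "u = replicate (length u) (1, 0)" using True ones_eq by blast
  have "swap_word u = mon u"
  proof (rule poly_mapping_eqI)
    fix v
    show "lookup (swap_word u) v = lookup (mon u) v"
    proof (cases "v = u")
      case True
      have "swap_lookup u u = 1" using swap_lookup_replicate[of "length u"] u by metis
      then show ?thesis using assms True by (simp add: lookup_swap_word swap_coeff_eq)
    next
      case False
      have "swap_coeff u v = 0"
      proof (rule ccontr)
        assume nz: "swap_coeff u v \<noteq> 0"
        note * = swap_coeff_nonzero[OF nz assms]
        then have "v = replicate (length v) (1, 0)" using True ones_eq by blast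
        then show False using *(1) u False by metis
      qed
      then show ?thesis using False by (simp add: lookup_swap_word lookup_single)
    qed
  qed
  then show ?thesis by simp
next
  case False
  have "zeta_of_ones v = 0" if "v \<in> supp (swap_word u)" for v
  proof (rule ccontr)
    assume "zeta_of_ones v \<noteq> 0"
    from zeta_of_ones_nonzero[OF this] show False
      using that False swap_coeff_nonzero(3,4)[of u v] assms unfolding in_keys_swap by blast
  qed
  then have "lin_ext zeta_of_ones (swap_word u) = 0" by (rule lin_ext_eq_0)
  moreover have "zeta_of_ones u = 0" using False zeta_of_ones_nonzero by blast
  ultimately show ?thesis by simp
qed

lemma zeta_of_lower_nonzero: "zeta_of_lower w \<noteq> 0 \<Longrightarrow> \<forall>x\<in>set w. fst x = 1"
  unfolding zeta_of_lower_def on_lower_def by (simp split: if_splits)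

lemma reg_zeta_of_upper_nonzero: "reg_zeta_of_upper w \<noteq> 0 \<Longrightarrow> \<forall>x\<in>set w. snd x = 0"
  unfolding reg_zeta_of_upper_def on_upper_def by (simp split: if_splits)

lemma zeta_of_upper_nonzero: "zeta_of_upper w \<noteq> 0 \<Longrightarrow> \<forall>x\<in>set w. snd x = 0"
  unfolding zeta_of_upper_def on_upper_def by (simp split: if_splits)

lemma conv_nonzero:
  assumes "conv stuffle f g w \<noteq> 0"
  obtains u v where "w = u @ v" "f u \<noteq> 0" "g v \<noteq> 0"
proof -
  obtain i where "stuffle (f (take i w)) (g (drop i w)) \<noteq> 0"
    using assms unfolding conv_eq_sum by (rule sum.not_neutral_contains_not_neutral)
  then have "f (take i w) \<noteq> 0" "g (drop i w) \<noteq> 0" by auto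
  then show thesis using that[of "take i w" "drop i w"] by simp
qed

lemma conv_stuffle_assoc:
  fixes f g h :: "'a list \<Rightarrow> nat poly_word"
  shows "conv stuffle (conv stuffle f g) h w = conv stuffle f (conv stuffle g h) w"
  by (rule conv_assoc) (simp_all add: stuffle_assoc)

text \<open>
  By \<open>conv_swap\<close>, first for the last factor and then for the two others, the swap reverses the order of
  the three factors; it exchanges the outer factors and fixes the middle one.
\<close>

lemma triple_conv_swap:
  assumes w: "w \<in> lists letters"
  shows "lin_ext (conv stuffle zeta_of_lower (conv stuffle zeta_of_ones reg_zeta_of_upper)) (swap_word w) =
    conv stuffle zeta_of_lower (conv stuffle zeta_of_ones reg_zeta_of_upper) w"
proof -
  have be: "\<forall>x\<in>set v. fst x = 1" if nz: "conv stuffle zeta_of_lower zeta_of_ones v \<noteq> 0" for v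
  proof -
    obtain u u' where "v = u @ u'" "zeta_of_lower u \<noteq> 0" "zeta_of_ones u' \<noteq> 0" using conv_nonzero[OF nz] by blast
    then show ?thesis using zeta_of_lower_nonzero[of u] zeta_of_ones_nonzero[of u'] by auto
  qed
  have 1: "lin_ext (conv stuffle zeta_of_lower zeta_of_ones) (swap_word u) = conv stuffle zeta_of_ones reg_zeta_of_upper u" if u: "u \<in> lists letters" for u
  proof -
    have "lin_ext (conv stuffle zeta_of_lower zeta_of_ones) (swap_word u) =
      conv stuffle (\<lambda>u. lin_ext zeta_of_ones (swap_word u)) (\<lambda>u. lin_ext zeta_of_lower (swap_word u)) u"
      by (rule conv_swap) (erule zeta_of_lower_nonzero, erule zeta_of_ones_nonzero[THEN conjunct1])
    also have "\<dots> = conv stuffle zeta_of_ones reg_zeta_of_upper u"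
      by (rule conv_cong; intro zeta_of_ones_swap zeta_of_lower_swap take_drop_letters u)
    finally show ?thesis .
  qed
  have "lin_ext (conv stuffle zeta_of_lower (conv stuffle zeta_of_ones reg_zeta_of_upper)) (swap_word w) =
    lin_ext (conv stuffle (conv stuffle zeta_of_lower zeta_of_ones) reg_zeta_of_upper) (swap_word w)"
    by (rule lin_ext_cong) (rule conv_stuffle_assoc[symmetric])
  also have "\<dots> = conv stuffle (\<lambda>u. lin_ext reg_zeta_of_upper (swap_word u)) (\<lambda>u. lin_ext (conv stuffle zeta_of_lower zeta_of_ones) (swap_word u)) w"
    by (rule conv_swap) (erule be, erule reg_zeta_of_upper_nonzero)
  also have "\<dots> = conv stuffle zeta_of_lower (conv stuffle zeta_of_ones reg_zeta_of_upper) w"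
    by (rule conv_cong; intro reg_zeta_of_upper_swap 1 take_drop_letters w)
  finally show ?thesis .
qed

lemma keys_swap_letters: "supp (swap_word w) \<subseteq> lists letters"
  unfolding subset_iff in_keys_swap by (simp add: swap_coeff_eq)

lemma zeta_of_word_swap:
  assumes w: "w \<in> lists letters"
  shows "lin_ext zeta_of_word (swap_word w) \<doteq> zeta_of_word w"
proof -
  have "lin_ext zeta_of_word (swap_word w) \<doteq> lin_ext (conv stuffle zeta_of_lower (conv stuffle zeta_of_ones reg_zeta_of_upper)) (swap_word w)"
    by (rule eds.eqv_lin_ext, rule zeta_of_word_eqv, rule subsetD[OF keys_swap_letters])
  also have "\<dots> \<doteq> zeta_of_word w"
    unfolding triple_conv_swap[OF w] by (rule eds.eqv_sym, rule zeta_of_word_eqv[OF w])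
  finally show ?thesis .
qed

definition zeta_type :: "word2 \<Rightarrow> bool"
  where "zeta_type w \<longleftrightarrow> (\<exists>ds ks. (\<forall>k\<in>set ks. 1 \<le> k) \<and> w = lower_word ds @ upper_word ks)"

lemma zeta_of_word_not_zeta_type:
  assumes "w \<in> lists letters" "\<not> zeta_type w"
  shows "zeta_of_word w = 0"
proof (rule ccontr)
  assume "zeta_of_word w \<noteq> 0"
  then obtain u v where w: "w = u @ v" "zeta_of_lower u \<noteq> 0" "zeta_of_upper v \<noteq> 0"
    unfolding zeta_of_word_def by (rule conv_nonzero)
  have "u = lower_word (map snd u)" "v = upper_word (map fst v)"
    by (rule lower_word_eq[OF zeta_of_lower_nonzero[OF w(2)]], rule upper_word_eq[OF zeta_of_upper_nonzero[OF w(3)]])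
  moreover have "\<forall>k\<in>set (map fst v). 1 \<le> k"
    using assms(1) w(1) by (auto simp: in_lists_letters)
  ultimately have "w = lower_word (map snd u) @ upper_word (map fst v)" "\<forall>k\<in>set (map fst v). 1 \<le> k"
    using w(1) by simp_all
  then have "zeta_type w" unfolding zeta_type_def by (intro exI conjI)
  with assms(2) show False by contradiction
qed

text \<open>
  The value is the word itself and not only congruent to it: every nonempty initial part with upper row
  \<open>1, \<dots>, 1\<close> is sent to \<open>reg (y\<^sup>n) = 0\<close>.
\<close>

lemma zeta_of_word_upper_word: "zeta_of_word (upper_word ks) = mon ks"
proof -
  have b: "zeta_of_lower (replicate (Suc n) (1, 0)) = 0" for n
  proof -
    have "tower_word (replicate n 0) = mon (replicate n LY)" for n
      by (induction n) (simp_all add: append_letter_mon replicate_append_same)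
    then show ?thesis
      using reg_replicate_LY[of "Suc n"] by (simp add: zeta_of_lower_def on_lower_def del: replicate.simps)
  qed
  have b0: "zeta_of_lower [] = mon []"
    by (simp add: zeta_of_lower_def on_lower_def reg_def reg_word_def)
  have k: "zeta_of_upper (upper_word ks) = mon ks"
    by (simp add: zeta_of_upper_def on_upper_def comp_def)
  have bz: "zeta_of_lower (x # u) = 0" if "\<forall>y\<in>set (x # u). snd y = 0" for x u
  proof (rule ccontr)
    assume nz: "zeta_of_lower (x # u) \<noteq> 0"
    have "x # u = replicate (length (x # u)) (1, 0)"
      by (rule ones_eq[OF that zeta_of_lower_nonzero[OF nz]])
    then show False using nz b[of "length u"] by simp
  qed
  show ?thesis
  proof (cases ks)
    case Nil
    then show ?thesis by (simp add: zeta_of_word_def b0 zeta_of_upper_def on_upper_def stuffle_one)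
  next
    case (Cons k' ks')
    have "conv stuffle (\<lambda>u. zeta_of_lower ((k', 0) # u)) zeta_of_upper (upper_word ks') = 0"
      unfolding conv_eq_sum
    proof (rule sum.neutral, clarify)
      fix i
      have "\<forall>y\<in>set ((k', 0) # take i (upper_word ks')). snd y = 0" by (auto dest: in_set_takeD)
      then show "stuffle (zeta_of_lower ((k', 0) # take i (upper_word ks'))) (zeta_of_upper (drop i (upper_word ks'))) = 0"
        by (simp only: bz stuffle_linear)
    qed
    then have "zeta_of_word (upper_word ks) = stuffle (zeta_of_lower []) (zeta_of_upper (upper_word ks))"
      unfolding zeta_of_word_def Cons by simp
    then show ?thesis by (simp add: b0 k stuffle_one)
  qed
qed

definition zeta_of :: "(word2 \<Rightarrow>\<^sub>0 rat) \<Rightarrow> nat poly_word"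
  where "zeta_of = lin_ext zeta_of_word"

lemma carrier_QA: "carrier QA = {p. supp p \<subseteq> lists letters}"
  by (simp add: QA_def stuffle_algebra_def)

lemma zeta_of_linear [simp]:
  "zeta_of 0 = 0" "zeta_of (p + q) = zeta_of p + zeta_of q" "zeta_of (p - q) = zeta_of p - zeta_of q"
  "zeta_of (scale c p) = scale c (zeta_of p)" "zeta_of (mon w) = zeta_of_word w"
  by (simp_all add: zeta_of_def lin_ext_add lin_ext_minus lin_ext_scale)

lemma zeta_of_carrier: "p \<in> carrier QA \<Longrightarrow> zeta_of p \<in> carrier H1"
  unfolding zeta_of_def by (rule eds.lin_ext_carrier[unfolded H1_eds], rule zeta_of_word_carrier) (auto simp: carrier_QA)

lemma zeta_of_stuffle:
  assumes "p \<in> carrier QA" "q \<in> carrier QA"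
  shows "zeta_of (stuffle p q) \<doteq> stuffle (zeta_of p) (zeta_of q)"
proof -
  have "zeta_of (stuffle p q) = lin_ext (\<lambda>u. lin_ext (\<lambda>v. lin_ext zeta_of_word (stuffle_word u v)) q) p"
    by (simp add: zeta_of_def stuffle_def bilin_ext_def lin_ext_lin_ext)
  also have "\<dots> \<doteq> lin_ext (\<lambda>u. lin_ext (\<lambda>v. stuffle (zeta_of_word u) (zeta_of_word v)) q) p"
    using assms unfolding carrier_QA
    by (intro eds.eqv_lin_ext zeta_of_word_stuffle) auto
  also have "\<dots> = stuffle (zeta_of p) (zeta_of q)"
    using bilin_ext_stuffle[of zeta_of_word zeta_of_word p q] by (simp add: bilin_ext_def zeta_of_def)
  finally show ?thesis .
qed

lemma zeta_of_swap:
  assumes "p \<in> carrier QA"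
  shows "zeta_of (swap p - p) \<in> eds_ideal"
proof -
  have "zeta_of (swap p) = lin_ext (\<lambda>w. lin_ext zeta_of_word (swap_word w)) p"
    by (simp add: zeta_of_def swap_def lin_ext_lin_ext)
  also have "\<dots> \<doteq> zeta_of p"
    unfolding zeta_of_def using assms by (intro eds.eqv_lin_ext zeta_of_word_swap) (auto simp: carrier_QA)
  finally show ?thesis by (simp add: eds.eqv_def)
qed

lemma zeta_of_upper: "zeta_of (upper p) = p"
  by (simp add: zeta_of_def upper_def lin_ext_lin_ext zeta_of_word_upper_word)

section \<open>The kernel\<close>

lemma stuffle_idealI:
  fixes L :: "'a::ab_semigroup_add set"
  assumes closed: "\<And>a b. a \<in> L \<Longrightarrow> b \<in> L \<Longrightarrow> a + b \<in> L"
    and sub: "K \<subseteq> carrier (stuffle_algebra L)"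
    and zero: "0 \<in> K" and add: "\<And>p q. p \<in> K \<Longrightarrow> q \<in> K \<Longrightarrow> p + q \<in> K"
    and mult: "\<And>p q. p \<in> K \<Longrightarrow> q \<in> carrier (stuffle_algebra L) \<Longrightarrow> stuffle q p \<in> K"
  shows "ideal K (stuffle_algebra L)"
proof -
  interpret R: cring "stuffle_algebra L" by (rule cring_stuffle_algebra) (rule closed)
  have uminus: "- p \<in> K" if "p \<in> K" for p
  proof -
    have "scale (-1) (mon []) \<in> carrier (stuffle_algebra L)"
      using keys_scale[of "-1" "mon ([] :: 'a list)"] by (auto simp: stuffle_algebra_simps)
    moreover have "stuffle (scale (-1) (mon [])) p = - p"
      unfolding stuffle_linear(5) stuffle_one by (simp add: scale_uminus)
    ultimately show ?thesis using mult[OF that] by metis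
  qed
  have inv: "\<ominus>\<^bsub>stuffle_algebra L\<^esub> p = - p" if "p \<in> K" for p
    using R.minus_equality[of "- p" p] that sub uminus by (auto simp: stuffle_algebra_simps)
  show ?thesis
  proof (rule idealI)
    show "ring (stuffle_algebra L)" by (rule R.ring_axioms)
    show "subgroup K (add_monoid (stuffle_algebra L))"
    proof (rule R.add.subgroupI)
      show "K \<subseteq> carrier (stuffle_algebra L)" by (rule sub)
      show "K \<noteq> {}" using zero by blast
      show "\<ominus>\<^bsub>stuffle_algebra L\<^esub> p \<in> K" if "p \<in> K" for p using uminus[OF that] inv[OF that] by simp
      show "p \<oplus>\<^bsub>stuffle_algebra L\<^esub> q \<in> K" if "p \<in> K" "q \<in> K" for p q
        using add[OF that] by (simp add: stuffle_algebra_simps)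
    qed
    show "x \<otimes>\<^bsub>stuffle_algebra L\<^esub> a \<in> K" if "a \<in> K" "x \<in> carrier (stuffle_algebra L)" for a x
      using mult[OF that] by (simp add: stuffle_algebra_simps)
    show "a \<otimes>\<^bsub>stuffle_algebra L\<^esub> x \<in> K" if "a \<in> K" "x \<in> carrier (stuffle_algebra L)" for a x
      using mult[OF that] by (simp add: stuffle_algebra_simps stuffle_comm)
  qed
qed

lemma letters_add: "a \<in> letters \<Longrightarrow> b \<in> letters \<Longrightarrow> a + b \<in> letters"
  by (cases a; cases b) (simp add: letters_def)

definition zeta_gens :: "(word2 \<Rightarrow>\<^sub>0 rat) set"
  where "zeta_gens = {swap w - w | w. w \<in> carrier QA} \<union> {mon w | w. w \<in> lists letters \<and> \<not> zeta_type w}"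

text \<open>
  Lifted to the free algebra, this is the ideal that has to be the kernel.
\<close>

definition zeta_kernel :: "(word2 \<Rightarrow>\<^sub>0 rat) set"
  where "zeta_kernel = Idl\<^bsub>QA\<^esub> zeta_gens"

lemma swap_carrier: "swap p \<in> carrier QA"
  unfolding carrier_QA swap_def mem_Collect_eq
  by (rule keys_lin_ext_subset) (rule keys_swap_letters)

lemma QA_minus: "p \<in> carrier QA \<Longrightarrow> q \<in> carrier QA \<Longrightarrow> p - q \<in> carrier QA"
  unfolding carrier_QA mem_Collect_eq using keys_minus[of p q] by blast

lemma mon_QA: "mon w \<in> carrier QA \<longleftrightarrow> w \<in> lists letters"
  by (simp add: carrier_QA)

lemma swap_gens_carrier: "{swap w - w | w. w \<in> carrier QA} \<subseteq> carrier QA"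
  using swap_carrier QA_minus by blast

lemma zeta_gens_carrier: "zeta_gens \<subseteq> carrier QA"
  unfolding zeta_gens_def using swap_gens_carrier mon_QA by blast

interpretation Z: stuffle_ideal letters zeta_kernel
proof (rule stuffle_ideal.intro)
  interpret QA: cring QA by (rule cring_QA)
  show "ideal zeta_kernel (stuffle_algebra letters)"
    unfolding zeta_kernel_def QA_def[symmetric] by (rule QA.genideal_ideal) (rule zeta_gens_carrier)
  show "a + b \<in> letters" if "a \<in> letters" "b \<in> letters" for a b
    using that by (rule letters_add)
qed

notation Z.eqv (infix "\<simeq>" 50)

lemma zeta_gens_subset: "zeta_gens \<subseteq> zeta_kernel"
proof -
  interpret QA: cring QA by (rule cring_QA)
  show ?thesis unfolding zeta_kernel_def by (rule QA.genideal_self) (rule zeta_gens_carrier)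
qed

lemma QA_Z: "stuffle_algebra letters = QA"
  by (simp add: QA_def)

lemma QA_simps [simp]:
  "0 \<in> carrier QA" "p \<in> carrier QA \<Longrightarrow> q \<in> carrier QA \<Longrightarrow> p + q \<in> carrier QA"
  "p \<in> carrier QA \<Longrightarrow> q \<in> carrier QA \<Longrightarrow> p - q \<in> carrier QA"
  "p \<in> carrier QA \<Longrightarrow> scale c p \<in> carrier QA"
  "p \<in> carrier QA \<Longrightarrow> q \<in> carrier QA \<Longrightarrow> stuffle p q \<in> carrier QA"
  "mon w \<in> carrier QA \<longleftrightarrow> w \<in> lists letters"
  by (fact Z.carrier_simps[unfolded QA_Z])+

lemma zeta_of_vanishing_ideal: "ideal {p \<in> carrier QA. zeta_of p \<in> eds_ideal} QA"
  unfolding QA_Z[symmetric]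
proof (rule stuffle_idealI, unfold QA_Z)
  show "a + b \<in> letters" if "a \<in> letters" "b \<in> letters" for a b
    using that by (rule letters_add)
  show "p + q \<in> {p \<in> carrier QA. zeta_of p \<in> eds_ideal}"
    if "p \<in> {p \<in> carrier QA. zeta_of p \<in> eds_ideal}" "q \<in> {p \<in> carrier QA. zeta_of p \<in> eds_ideal}" for p q
    using that eds.ideal_add by simp
  show "stuffle q p \<in> {p \<in> carrier QA. zeta_of p \<in> eds_ideal}"
    if "p \<in> {p \<in> carrier QA. zeta_of p \<in> eds_ideal}" "q \<in> carrier QA" for p q
  proof -
    have "stuffle (zeta_of q) (zeta_of p) \<in> eds_ideal"
      using that by (intro eds.ideal_mult) (simp_all only: mem_Collect_eq H1_eds zeta_of_carrier)
    then have "zeta_of (stuffle q p) \<in> eds_ideal"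
      using that zeta_of_stuffle[of q p] by (intro eds.ideal_eqv[of "zeta_of (stuffle q p)"]) auto
    then show ?thesis using that by simp
  qed
qed auto

lemma zeta_of_zeta_kernel:
  assumes "p \<in> zeta_kernel"
  shows "zeta_of p \<in> eds_ideal"
proof -
  interpret QA: cring QA by (rule cring_QA)
  have "zeta_gens \<subseteq> {p \<in> carrier QA. zeta_of p \<in> eds_ideal}"
  proof
    fix x assume x: "x \<in> zeta_gens"
    then consider p where "p \<in> carrier QA" "x = swap p - p" | w where "x = mon w" "w \<in> lists letters" "\<not> zeta_type w"
      unfolding zeta_gens_def by blast
    then have "zeta_of x \<in> eds_ideal"
    proof cases
      case 1
      then show ?thesis using zeta_of_swap by simp
    next
      case 2
      then show ?thesis using zeta_of_word_not_zeta_type by simp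
    qed
    then show "x \<in> {p \<in> carrier QA. zeta_of p \<in> eds_ideal}" using x zeta_gens_carrier by blast
  qed
  then have "zeta_kernel \<subseteq> {p \<in> carrier QA. zeta_of p \<in> eds_ideal}"
    unfolding zeta_kernel_def by (intro QA.genideal_minimal zeta_of_vanishing_ideal)
  then show ?thesis using assms by blast
qed

lemma swap_eqv: "p \<in> carrier QA \<Longrightarrow> swap p \<simeq> p"
  using zeta_gens_subset unfolding Z.eqv_def zeta_gens_def by blast

lemma mon_not_zeta_type: "w \<in> lists letters \<Longrightarrow> \<not> zeta_type w \<Longrightarrow> mon w \<in> zeta_kernel"
  using zeta_gens_subset unfolding zeta_gens_def by blast

section \<open>Reduction to words with trivial lower row\<close>

lemma zeta_type_Cons: "zeta_type (x # w) \<Longrightarrow> zeta_type w"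
proof -
  assume "zeta_type (x # w)"
  then obtain ds ks where *: "\<forall>k\<in>set ks. 1 \<le> k" "x # w = lower_word ds @ upper_word ks"
    unfolding zeta_type_def by blast
  show "zeta_type w"
  proof (cases ds)
    case Nil
    then obtain k ks' where "ks = k # ks'" "w = lower_word [] @ upper_word ks'" using * by (cases ks) auto
    then show ?thesis unfolding zeta_type_def using * by (metis list.set_intros(2))
  next
    case (Cons d ds')
    then have "w = lower_word ds' @ upper_word ks" using * by simp
    then show ?thesis unfolding zeta_type_def using * by blast
  qed
qed

lemma zeta_type_large_head:
  assumes "zeta_type ((k, d) # w)" "2 \<le> k"
  shows "d = 0 \<and> (\<forall>x\<in>set w. snd x = 0)"
proof -
  obtain ds ks where *: "(k, d) # w = lower_word ds @ upper_word ks"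
    using assms(1) unfolding zeta_type_def by blast
  show ?thesis using * assms(2) by (cases ds; cases ks) auto
qed

text \<open>
  The total lower weight is additive. It detects that a positive lower entry survives in every term of
  a product, merged or not.
\<close>

lemma sum_snd_keys_stuffle:
  "t \<in> supp (stuffle_word w v) \<Longrightarrow>
    sum_list (map snd t) = sum_list (map snd w) + sum_list (map snd v)"
  for w v :: word2
proof (induction w v arbitrary: t rule: stuffle_word.induct)
  case (3 a w b v)
  have "t \<in> supp (prepend a (stuffle_word w (b # v))) \<union> supp (prepend b (stuffle_word (a # w) v))
      \<union> supp (prepend (a + b) (stuffle_word w v))"
    using 3(4) keys_add[of "prepend a (stuffle_word w (b # v)) + prepend b (stuffle_word (a # w) v)" "prepend (a + b) (stuffle_word w v)"]
      keys_add[of "prepend a (stuffle_word w (b # v))" "prepend b (stuffle_word (a # w) v)"] by auto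
  then consider s where "t = a # s" "s \<in> supp (stuffle_word w (b # v))"
    | s where "t = b # s" "s \<in> supp (stuffle_word (a # w) v)"
    | s where "t = (a + b) # s" "s \<in> supp (stuffle_word w v)"
    unfolding keys_prepend by blast
  then show ?case
    by cases (use 3 in \<open>simp_all add: snd_def split: prod.splits\<close>)
qed auto

abbreviation vanishing_words :: "word2 set"
  where "vanishing_words \<equiv> {w \<in> lists letters. \<not> zeta_type w}"

lemma vanishing_words_Cons: "x \<in> letters \<Longrightarrow> t \<in> vanishing_words \<Longrightarrow> x # t \<in> vanishing_words"
  using zeta_type_Cons[of x t] by auto

text \<open>
  Once a letter with upper entry at least \<open>2\<close> occurs in a word of zeta type, it and all letters after it
  have lower entry \<open>0\<close>.
\<close>

lemma vanishing_words_large_head: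
  assumes "2 \<le> k" "t \<in> lists letters" "d \<noteq> 0 \<or> sum_list (map snd t) \<noteq> 0"
  shows "(k, d) # t \<in> vanishing_words"
proof -
  have "\<not> zeta_type ((k, d) # t)"
  proof
    assume "zeta_type ((k, d) # t)"
    from zeta_type_large_head[OF this assms(1)] assms(3) show False by (auto simp: sum_list_eq_0_iff)
  qed
  then show ?thesis using assms by (auto simp: letters_def)
qed

lemma lower_letters: "lower_word ds \<in> lists letters"
  by (auto simp: letters_def)

lemma upper_letters: "\<forall>k\<in>set ks. 1 \<le> k \<Longrightarrow> upper_word ks \<in> lists letters"
  by (auto simp: letters_def)

lemma keys_stuffle_letters:
  "w \<in> lists letters \<Longrightarrow> v \<in> lists letters \<Longrightarrow> supp (stuffle_word w v) \<subseteq> lists letters"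
  by (rule keys_stuffle_word) (rule letters_add)

definition lower :: "(nat list \<Rightarrow>\<^sub>0 rat) \<Rightarrow> (word2 \<Rightarrow>\<^sub>0 rat)"
  where "lower = lin_ext (\<lambda>ds. mon (lower_word ds))"

lemma lower_linear [simp]:
  "lower (p + q) = lower p + lower q" "lower (scale c p) = scale c (lower p)"
  "lower (mon ds) = mon (lower_word ds)" "lower 0 = 0"
  by (simp_all add: lower_def lin_ext_add lin_ext_scale)

lemma upper_linear [simp]:
  "upper (p + q) = upper p + upper q" "upper (p - q) = upper p - upper q" "upper (scale c p) = scale c (upper p)"
  "upper (mon ks) = mon (upper_word ks)" "upper 0 = 0"
  by (simp_all add: upper_def lin_ext_add lin_ext_minus lin_ext_scale)

lemma lower_prepend: "lower (prepend d p) = prepend (1, d) (lower p)"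
  by (induction p rule: poly_induct) (simp_all add: prepend_mon)

lemma upper_prepend: "upper (prepend k p) = prepend (k, 0) (upper p)"
  by (induction p rule: poly_induct) (simp_all add: prepend_mon)

text \<open>
  A merged letter has upper entry \<open>2\<close>. Either its lower entry is positive or the last letter of the
  second word, whose lower entry is positive, still comes after it (possibly merged in its turn); in
  both cases the term is not of zeta type. It is essential that the second word does not end in \<open>(1, 0)\<close>, as
  \<open>(1, 0) * (1, 0) = 2 (1, 0) (1, 0) + (2, 0)\<close> shows.
\<close>

lemma lower_stuffle_vanishing:
  assumes "ds \<noteq> []" "1 \<le> last ds"
  shows "supp (stuffle_word (lower_word es) (lower_word ds) - lower (shuffle_word es ds)) \<subseteq> vanishing_words"
  using assms
proof (induction es ds rule: shuffle_word.induct)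
  case (3 e es d ds)
  let ?A = "stuffle_word (lower_word es) (lower_word (d # ds)) - lower (shuffle_word es (d # ds))"
  let ?B = "stuffle_word (lower_word (e # es)) (lower_word ds) - lower (shuffle_word (e # es) ds)"
  let ?C = "stuffle_word (lower_word es) (lower_word ds)"
  have eq: "stuffle_word (lower_word (e # es)) (lower_word (d # ds)) - lower (shuffle_word (e # es) (d # ds)) =
     prepend (1, e) ?A + prepend (1, d) ?B + prepend (2, e + d) ?C"
    by (simp add: lower_prepend prepend_minus numeral_2_eq_2)
  have l: "(1, x) \<in> letters" for x by (simp add: letters_def)
  have A: "supp (prepend (1, e) ?A) \<subseteq> vanishing_words"
    using 3(1)[OF 3(3,4)] by (intro keys_prepend_subset vanishing_words_Cons l) blast
  have "supp ?B \<subseteq> vanishing_words"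
  proof (cases "ds = []")
    case True
    then show ?thesis by simp
  next
    case False
    then show ?thesis using 3(2,4) by simp
  qed
  then have B: "supp (prepend (1, d) ?B) \<subseteq> vanishing_words"
    by (intro keys_prepend_subset vanishing_words_Cons l) blast
  have C: "supp (prepend (2, e + d) ?C) \<subseteq> vanishing_words"
  proof (rule keys_prepend_subset)
    fix t assume t: "t \<in> supp ?C"
    have "sum_list (map snd t) = sum_list es + sum_list ds"
      using sum_snd_keys_stuffle[OF t] by (simp add: comp_def)
    moreover have "last (d # ds) \<le> sum_list (d # ds)" by (rule member_le_sum_list) simp_all
    ultimately have "e + d \<noteq> 0 \<or> sum_list (map snd t) \<noteq> 0"
      using 3(4) by (simp only: sum_list.Cons) linarith
    moreover have "t \<in> lists letters"
      using t keys_stuffle_letters[OF lower_letters lower_letters] by blast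
    ultimately show "(2, e + d) # t \<in> vanishing_words" by (intro vanishing_words_large_head) auto
  qed
  show ?case unfolding eq by (intro keys_add_subset A B C)
qed auto

text \<open>
  The terms that remain when the concatenation is subtracted from the product in
  \<open>lower_upper_stuffle\<close>: those of zeta type have a shorter part with lower row \<open>0, \<dots>, 0\<close>.
\<close>

definition shorter :: "nat \<Rightarrow> word2 set"
  where "shorter n = vanishing_words \<union> {lower_word ds @ upper_word ks | ds ks.
     ds \<noteq> [] \<and> 1 \<le> last ds \<and> length ks < n \<and> (\<forall>k\<in>set ks. 1 \<le> k)}"

lemma shorter_Cons_lower: "t \<in> shorter n \<Longrightarrow> (1, d) # t \<in> shorter n"
proof -
  assume "t \<in> shorter n"
  then consider "t \<in> vanishing_words" | ds ks where "t = lower_word ds @ upper_word ks" "ds \<noteq> []" "1 \<le> last ds"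
     "length ks < n" "\<forall>k\<in>set ks. 1 \<le> k"
    unfolding shorter_def by blast
  then show "(1, d) # t \<in> shorter n"
  proof cases
    case 1
    have "(1, d) \<in> letters" by (simp add: letters_def)
    then show ?thesis using vanishing_words_Cons[OF _ 1] unfolding shorter_def by blast
  next
    case 2
    then have "(1, d) # t = lower_word (d # ds) @ upper_word ks" "d # ds \<noteq> []" "1 \<le> last (d # ds)" by auto
    then show ?thesis using 2 unfolding shorter_def by blast
  qed
qed

lemma shorter_mono: "t \<in> shorter n \<Longrightarrow> n \<le> m \<Longrightarrow> t \<in> shorter m"
  unfolding shorter_def using less_le_trans by blast

text \<open>
  The last letter of \<open>lower_word ds\<close> has a positive lower entry, so in a term of zeta type no letter with
  upper entry at least \<open>2\<close> precedes it and it is not merged. Apart from the concatenation, such a term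
  arises when some letters \<open>(1, 0)\<close> from the beginning of the second word move to the left of it.
\<close>

lemma lower_upper_stuffle:
  assumes "ds \<noteq> []" "1 \<le> last ds" "\<forall>k\<in>set ks. 1 \<le> k"
  shows "supp (stuffle_word (lower_word ds) (upper_word ks) - mon (lower_word ds @ upper_word ks)) \<subseteq> shorter (length ks)"
  using assms
proof (induction ds ks rule: shuffle_word.induct)
  case (3 d ds k ks)
  let ?v = "upper_word (k # ks)" and ?u = "lower_word (d # ds)"
  let ?A = "stuffle_word (lower_word ds) ?v - mon (lower_word ds @ ?v)"
  let ?B = "stuffle_word ?u (upper_word ks)"
  let ?C = "stuffle_word (lower_word ds) (upper_word ks)"
  have eq: "stuffle_word ?u ?v - mon (?u @ ?v) = prepend (1, d) ?A + prepend (k, 0) ?B + prepend (1 + k, d) ?C"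
    by (simp add: prepend_minus prepend_mon)
  have pos: "1 \<le> k" "\<forall>k\<in>set ks. 1 \<le> k" using 3(5) by auto
  have "supp ?A \<subseteq> shorter (length (k # ks))"
  proof (cases "ds = []")
    case True
    then show ?thesis by simp
  next
    case False
    then show ?thesis using 3(1,4,5) by simp
  qed
  then have A: "supp (prepend (1, d) ?A) \<subseteq> shorter (length (k # ks))"
    by (intro keys_prepend_subset shorter_Cons_lower) blast
  have le: "last (d # ds) \<le> sum_list (d # ds)" by (rule member_le_sum_list) simp_all
  have B: "supp (prepend (k, 0) ?B) \<subseteq> shorter (length (k # ks))"
  proof (rule keys_prepend_subset)
    fix t assume t: "t \<in> supp ?B"
    show "(k, 0) # t \<in> shorter (length (k # ks))"
    proof (cases "k = 1")
      case True
      have "t \<in> supp (?B - mon (?u @ upper_word ks)) \<or> t = ?u @ upper_word ks"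
        using t by (auto simp: in_keys_iff lookup_minus lookup_single when_def)
      moreover have "?u @ upper_word ks \<in> shorter (length (k # ks))"
        using 3(3,4) pos unfolding shorter_def by fastforce
      ultimately have "t \<in> shorter (length (k # ks))"
        using 3(2)[OF 3(3,4) pos(2)] shorter_mono[of t "length ks" "length (k # ks)"] by auto
      then show ?thesis unfolding True by (rule shorter_Cons_lower)
    next
      case False
      have "sum_list (map snd t) = sum_list (d # ds) + sum_list (map snd (upper_word ks))"
        using sum_snd_keys_stuffle[OF t] by (simp add: comp_def)
      then have "sum_list (map snd t) \<noteq> 0" using le 3(4) by linarith
      moreover have "t \<in> lists letters"
        using t keys_stuffle_letters[OF lower_letters upper_letters[OF pos(2)]] by blast
      ultimately have "(k, 0) # t \<in> vanishing_words" using False pos by (intro vanishing_words_large_head) auto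
      then show ?thesis unfolding shorter_def by blast
    qed
  qed
  have C: "supp (prepend (1 + k, d) ?C) \<subseteq> shorter (length (k # ks))"
  proof (rule keys_prepend_subset)
    fix t assume t: "t \<in> supp ?C"
    have "sum_list (map snd t) = sum_list ds + sum_list (map snd (upper_word ks))"
      using sum_snd_keys_stuffle[OF t] by (simp add: comp_def)
    then have "d \<noteq> 0 \<or> sum_list (map snd t) \<noteq> 0" using le 3(4) by (simp only: sum_list.Cons) linarith
    moreover have "t \<in> lists letters"
      using t keys_stuffle_letters[OF lower_letters upper_letters[OF pos(2)]] by blast
    ultimately have "(1 + k, d) # t \<in> vanishing_words" using pos by (intro vanishing_words_large_head) auto
    then show "(1 + k, d) # t \<in> shorter (length (k # ks))" unfolding shorter_def by blast
  qed
  show ?case unfolding eq by (intro keys_add_subset A B C)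
qed auto

lemma upper_stuffle: "upper (stuffle p q) = stuffle (upper p) (upper q)"
proof -
  have w: "upper (stuffle_word w v) = stuffle_word (upper_word w) (upper_word v)" for w v
    by (induction w v rule: stuffle_word.induct) (simp_all add: upper_prepend)
  show ?thesis
  proof (induction p rule: poly_induct)
    case (mon c w)
    show ?case
      by (induction q rule: poly_induct) (simp_all add: stuffle_mon w scale_add)
  qed simp_all
qed

lemma upper_carrier:
  assumes "p \<in> carrier H1"
  shows "upper p \<in> carrier QA"
  unfolding upper_def carrier_QA mem_Collect_eq
proof (rule keys_lin_ext_subset)
  fix ks assume "ks \<in> supp p"
  then have "\<forall>k\<in>set ks. 1 \<le> k" using assms unfolding carrier_H1 by blast
  from upper_letters[OF this] show "supp (mon (upper_word ks)) \<subseteq> lists letters" by simp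
qed

lemma lower_carrier: "lower p \<in> carrier QA"
  unfolding lower_def carrier_QA mem_Collect_eq
  by (rule keys_lin_ext_subset) (auto simp: letters_def)

lemma lower_eqv_upper: "lower p \<simeq> upper (from_xy (tower p))"
proof -
  have "swap (lower p) = upper (from_xy (tower p))"
    by (induction p rule: poly_induct)
      (simp_all add: swap_def lin_ext_add lin_ext_scale swap_lower_word tower_def del: One_nat_def)
  then show ?thesis using Z.eqv_sym[OF swap_eqv[OF lower_carrier[of p]]] by simp
qed

lemma mon_lower_eqv: "mon (lower_word ds) \<simeq> upper (from_xy (tower_word ds))"
  using lower_eqv_upper[of "mon ds"] by simp

lemma eqv_upper_lin_ext:
  assumes "\<And>t. t \<in> supp p \<Longrightarrow> \<exists>h\<in>carrier H1. mon t \<simeq> upper h"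
  shows "\<exists>h\<in>carrier H1. p \<simeq> upper h"
proof -
  obtain h where h: "\<And>t. t \<in> supp p \<Longrightarrow> h t \<in> carrier H1 \<and> mon t \<simeq> upper (h t)"
    using assms by metis
  have "lin_ext mon p \<simeq> lin_ext (\<lambda>t. upper (h t)) p"
    using h by (intro Z.eqv_lin_ext) blast
  moreover have "lin_ext (\<lambda>t. upper (h t)) p = upper (lin_ext h p)"
    by (simp add: upper_def lin_ext_lin_ext)
  moreover have "lin_ext h p \<in> carrier H1"
    using h by (intro eds.lin_ext_carrier[unfolded H1_eds]) blast
  ultimately show ?thesis by auto
qed

text \<open>
  The product of the two parts comes from the letters \<open>z\<^sub>k\<close>, as the first part may be replaced by its swap;
  it differs from the word by terms that are covered by the induction hypothesis.
\<close>

lemma mixed_word_eqv_upper: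
  assumes "ds \<noteq> []" "1 \<le> last ds" "\<forall>k\<in>set ks. 1 \<le> k"
  shows "\<exists>h\<in>carrier H1. mon (lower_word ds @ upper_word ks) \<simeq> upper h"
  using assms
proof (induction "length ks" arbitrary: ds ks rule: less_induct)
  case less
  let ?s = "stuffle_word (lower_word ds) (upper_word ks)" and ?m = "mon (lower_word ds @ upper_word ks)"
  have "\<exists>h\<in>carrier H1. mon t \<simeq> upper h" if "t \<in> supp (?s - ?m)" for t
  proof -
    have "t \<in> shorter (length ks)" using that lower_upper_stuffle[OF less.prems] by blast
    then consider "t \<in> vanishing_words" | ds' ks' where "t = lower_word ds' @ upper_word ks'" "ds' \<noteq> []" "1 \<le> last ds'"
      "length ks' < length ks" "\<forall>k\<in>set ks'. 1 \<le> k"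
      unfolding shorter_def by blast
    then show ?thesis
    proof cases
      case 1
      then have "mon t \<simeq> upper 0" using mon_not_zeta_type[of t] by (simp add: Z.eqv_def)
      then show ?thesis using H1_simps(1) by blast
    next
      case 2
      then show ?thesis using less.hyps[of ks' ds'] by simp
    qed
  qed
  then obtain h where h: "h \<in> carrier H1" "?s - ?m \<simeq> upper h"
    using eqv_upper_lin_ext by blast
  have ks: "mon ks \<in> carrier H1" using less.prems(3) by auto
  \<comment> \<open>The product \<open>?s\<close> comes from \<open>g\<close> and its difference to the word \<open>?m\<close> comes from \<open>h\<close>.\<close>
  define g where "g = stuffle (from_xy (tower_word ds)) (mon ks)"
  have "stuffle (mon (lower_word ds)) (mon (upper_word ks)) \<simeq> stuffle (upper (from_xy (tower_word ds))) (mon (upper_word ks))"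
    by (rule Z.eqv_mult_left[OF mon_lower_eqv]) (simp only: QA_Z QA_simps upper_letters[OF less.prems(3)])
  then have s: "?s \<simeq> upper g" by (simp add: g_def upper_stuffle stuffle_mon)
  have "?s + scale (-1) (?s - ?m) \<simeq> upper g + scale (-1) (upper h)"
    by (intro Z.eqv_add Z.eqv_scale s h)
  moreover have "?s + scale (-1) (?s - ?m) = ?m"
    by (simp add: scale_uminus)
  moreover have "upper g + scale (-1) (upper h) = upper (g - h)"
    by (simp add: scale_uminus)
  ultimately have "?m \<simeq> upper (g - h)" by (simp only:)
  moreover have "g - h \<in> carrier H1"
    unfolding g_def by (intro H1_simps from_xy_carrier ks h)
  ultimately show ?case by blast
qed

text \<open>
  Letters \<open>(1, 0)\<close> at the end of the first part are moved to the second part until the first part ends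
  in a letter with positive lower entry or is empty.
\<close>

lemma zeta_type_eqv_upper:
  assumes "\<forall>k\<in>set ks. 1 \<le> k"
  shows "\<exists>h\<in>carrier H1. mon (lower_word ds @ upper_word ks) \<simeq> upper h"
  using assms
proof (induction ds arbitrary: ks rule: rev_induct)
  case Nil
  then have "mon ks \<in> carrier H1" by auto
  then show ?case by (intro bexI[of _ "mon ks"]) simp_all
next
  case (snoc d ds)
  show ?case
  proof (cases "d = 0")
    case True
    then show ?thesis using snoc.IH[of "1 # ks"] snoc.prems by simp
  next
    case False
    then show ?thesis using mixed_word_eqv_upper[of "ds @ [d]" ks] snoc.prems by simp
  qed
qed

lemma eqv_upper:
  assumes "p \<in> carrier QA"
  shows "\<exists>h\<in>carrier H1. p \<simeq> upper h"
proof (rule eqv_upper_lin_ext)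
  fix t assume "t \<in> supp p"
  then have t: "t \<in> lists letters" using assms by (auto simp: carrier_QA)
  show "\<exists>h\<in>carrier H1. mon t \<simeq> upper h"
  proof (cases "zeta_type t")
    case True
    then obtain ds ks where "\<forall>k\<in>set ks. 1 \<le> k" "t = lower_word ds @ upper_word ks"
      unfolding zeta_type_def by blast
    then show ?thesis using zeta_type_eqv_upper by blast
  next
    case False
    then have "mon t \<simeq> upper 0" using mon_not_zeta_type[OF t] by (simp add: Z.eqv_def)
    then show ?thesis using H1_simps(1) by blast
  qed
qed

lemma lower_shuffle_eqv:
  assumes "\<And>ds. ds \<in> supp b \<Longrightarrow> ds = [] \<or> 1 \<le> last ds"
  shows "stuffle (lower a) (lower b) \<simeq> lower (shuffle a b)"
proof -
  have "stuffle (lower a) (lower b) = lin_ext (\<lambda>es. lin_ext (\<lambda>ds. stuffle_word (lower_word es) (lower_word ds)) b) a"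
    using bilin_ext_stuffle[of "\<lambda>es. mon (lower_word es)" "\<lambda>ds. mon (lower_word ds)" a b]
    by (simp add: bilin_ext_def lower_def stuffle_mon)
  also have "\<dots> \<simeq> lin_ext (\<lambda>es. lin_ext (\<lambda>ds. lower (shuffle_word es ds)) b) a"
  proof (intro Z.eqv_lin_ext)
    fix es ds assume "ds \<in> supp b"
    then consider "ds = []" | "ds \<noteq> []" "1 \<le> last ds" using assms by blast
    then show "stuffle_word (lower_word es) (lower_word ds) \<simeq> lower (shuffle_word es ds)"
    proof cases
      case 1
      then show ?thesis by simp
    next
      case 2
      let ?p = "stuffle_word (lower_word es) (lower_word ds) - lower (shuffle_word es ds)"
      have "lin_ext mon ?p \<in> zeta_kernel"
      proof (rule Z.lin_ext_ideal)
        fix w assume "w \<in> supp ?p"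
        then have "w \<in> vanishing_words" using lower_stuffle_vanishing[OF 2, of es] by (rule rev_subsetD)
        then show "mon w \<in> zeta_kernel" using mon_not_zeta_type by simp
      qed
      then show ?thesis by (simp add: Z.eqv_def)
    qed
  qed
  also have "lin_ext (\<lambda>es. lin_ext (\<lambda>ds. lower (shuffle_word es ds)) b) a = lower (shuffle a b)"
    by (simp add: lower_def shuffle_def bilin_ext_def lin_ext_lin_ext)
  finally show ?thesis .
qed

text \<open>
  The lower rows of the swap of a word with lower row \<open>0, \<dots>, 0\<close>, that is, a preimage under \<open>tower\<close>
  by \<open>tower_swap_upper_word\<close>.
\<close>

definition swap_to_lower :: "(nat list \<Rightarrow>\<^sub>0 rat) \<Rightarrow> (nat list \<Rightarrow>\<^sub>0 rat)"
  where "swap_to_lower = lin_ext (\<lambda>ks. lin_ext (\<lambda>v. mon (map snd v)) (swap_word (upper_word ks)))"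

lemma swap_upper_word:
  assumes "\<forall>k\<in>set ks. 1 \<le> k"
  shows "swap_word (upper_word ks) = lower (lin_ext (\<lambda>v. mon (map snd v)) (swap_word (upper_word ks)))"
proof -
  have "lin_ext (\<lambda>v. mon (lower_word (map snd v))) (swap_word (upper_word ks)) = swap_word (upper_word ks)"
  proof (rule lin_ext_id_on)
    fix v assume v: "v \<in> supp (swap_word (upper_word ks))"
    have "\<forall>x\<in>set (upper_word ks). snd x = 0" by simp
    then have "\<forall>x\<in>set v. fst x = 1"
      using swap_coeff_nonzero(3)[OF _ upper_letters[OF assms], of v] v unfolding in_keys_swap by blast
    from lower_word_eq[OF this] show "mon (lower_word (map snd v)) = mon v" by simp
  qed
  then show ?thesis by (simp add: lower_def lin_ext_lin_ext)
qed

lemma upper_eqv_lower: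
  assumes "p \<in> carrier H1"
  shows "upper p \<simeq> lower (swap_to_lower p)"
proof -
  have "swap (upper p) = lin_ext (\<lambda>ks. swap_word (upper_word ks)) p"
    by (simp add: swap_def upper_def lin_ext_lin_ext)
  also have "\<dots> = lin_ext (\<lambda>ks. lower (lin_ext (\<lambda>v. mon (map snd v)) (swap_word (upper_word ks)))) p"
    using assms by (intro lin_ext_cong swap_upper_word) (auto simp: carrier_H1)
  also have "\<dots> = lower (swap_to_lower p)"
    by (simp add: swap_to_lower_def lower_def lin_ext_lin_ext)
  finally show ?thesis using Z.eqv_sym[OF swap_eqv[OF upper_carrier[OF assms]]] by simp
qed

lemma tower_swap_to_lower:
  assumes "p \<in> carrier H1"
  shows "tower (swap_to_lower p) = to_xy p"
proof -
  have "tower (swap_to_lower p) = lin_ext (\<lambda>ks. tower_of_lower_row (swap_word (upper_word ks))) p"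
    by (simp add: tower_def swap_to_lower_def tower_of_lower_row_def lin_ext_lin_ext)
  also have "\<dots> = lin_ext (\<lambda>ks. mon (xy_word ks)) p"
    using assms by (intro lin_ext_cong tower_swap_upper_word) (auto simp: carrier_H1)
  finally show ?thesis by (simp add: to_xy_eq)
qed

lemma keys_swap_to_lower:
  assumes "p \<in> H0" "ds \<in> supp (swap_to_lower p)"
  shows "ds = [] \<or> 1 \<le> last ds"
proof -
  obtain ks where ks: "ks \<in> supp p"
    "ds \<in> supp (lin_ext (\<lambda>v. mon (map snd v)) (swap_word (upper_word ks)))"
    using assms(2) keys_lin_ext[of "\<lambda>ks. lin_ext (\<lambda>v. mon (map snd v)) (swap_word (upper_word ks))" p]
    unfolding swap_to_lower_def by blast
  then obtain v where v: "v \<in> supp (swap_word (upper_word ks))" "ds = map snd v"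
    using subsetD[OF keys_lin_ext ks(2)] by auto
  then have nz: "length v = length (upper_word ks)" "swap_lookup (upper_word ks) v \<noteq> 0"
    unfolding in_keys_swap swap_coeff_eq by (simp_all split: if_splits)
  show ?thesis
  proof (cases "ks = []")
    case True
    then show ?thesis using nz(1) v(2) by simp
  next
    case False
    have "hd ks \<noteq> 1" "ks \<in> lists {k. 1 \<le> k}"
      using assms(1) ks(1) False unfolding H0_def carrier_H1 by blast+
    moreover have "1 \<le> hd ks" using calculation(2) False by (cases ks) auto
    ultimately have "2 \<le> fst (hd (upper_word ks))" using False by (cases ks) auto
    then have "1 \<le> snd (last v)"
      using last_swap_lookup[of "upper_word ks" v] nz False by simp
    moreover have "v \<noteq> []" using nz(1) False by auto
    ultimately show ?thesis by (simp add: v(2) last_map)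
  qed
qed

text \<open>
  Write both factors as images of \<open>lower\<close> via the swap. The second factor lies in \<open>H0\<close>, so its lower
  rows end in a positive entry or are empty, and modulo the ideal the stuffle product is the shuffle product of the
  lower rows. Since \<open>tower\<close> is a homomorphism for the shuffle product, swapping back gives the shuffle
  product of the two factors.
\<close>

lemma upper_eds:
  assumes "h \<in> eds_ideal"
  shows "upper h \<in> zeta_kernel"
proof -
  interpret H1: cring H1 by (rule cring_H1)
  have ideal: "ideal {h \<in> carrier H1. upper h \<in> zeta_kernel} H1"
    unfolding H1_eds[symmetric]
  proof (rule stuffle_idealI, unfold H1_eds)
    show "a + b \<in> {k. 1 \<le> k}" if "a \<in> {k. 1 \<le> k}" "b \<in> {k. 1 \<le> k}" for a b :: nat
      using that by simp
    show "p + q \<in> {h \<in> carrier H1. upper h \<in> zeta_kernel}"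
      if "p \<in> {h \<in> carrier H1. upper h \<in> zeta_kernel}" "q \<in> {h \<in> carrier H1. upper h \<in> zeta_kernel}" for p q
      using that Z.ideal_add by simp
    show "stuffle q p \<in> {h \<in> carrier H1. upper h \<in> zeta_kernel}"
      if "p \<in> {h \<in> carrier H1. upper h \<in> zeta_kernel}" "q \<in> carrier H1" for p q
    proof -
      have "stuffle (upper q) (upper p) \<in> zeta_kernel"
        using that by (intro Z.ideal_mult) (simp_all only: mem_Collect_eq QA_Z upper_carrier)
      then show ?thesis using that by (simp add: upper_stuffle)
    qed
  qed auto
  have "eds_relations \<subseteq> {h \<in> carrier H1. upper h \<in> zeta_kernel}"
  proof
    fix x assume x: "x \<in> eds_relations"
    then obtain w v u where *: "x = stuffle w v - u" "w \<in> carrier H1" "v \<in> H0" "u \<in> carrier H1"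
      "to_xy u = shuffle (to_xy w) (to_xy v)"
      unfolding eds_relations_def by blast
    have v: "v \<in> carrier H1" using *(3) by (simp add: H0_def)
    let ?a = "swap_to_lower w" and ?b = "swap_to_lower v"
    have "upper (stuffle w v) = stuffle (upper w) (upper v)" by (rule upper_stuffle)
    also have "\<dots> \<simeq> stuffle (lower ?a) (lower ?b)"
      by (rule Z.eqv_mult[OF upper_eqv_lower[OF *(2)] upper_eqv_lower[OF v]])
        (simp_all only: QA_Z upper_carrier[OF v] lower_carrier)
    also have "\<dots> \<simeq> lower (shuffle ?a ?b)"
      by (rule lower_shuffle_eqv) (rule keys_swap_to_lower[OF *(3)])
    also have "\<dots> \<simeq> upper (from_xy (tower (shuffle ?a ?b)))"
      by (rule lower_eqv_upper)
    also have "from_xy (tower (shuffle ?a ?b)) = u"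
      by (simp only: tower_shuffle tower_swap_to_lower[OF *(2)] tower_swap_to_lower[OF v] *(5)[symmetric]
          from_xy_to_xy[OF *(4)])
    finally have "upper x \<in> zeta_kernel" by (simp add: *(1) Z.eqv_def)
    then show "x \<in> {h \<in> carrier H1. upper h \<in> zeta_kernel}" using x eds_relations_carrier by blast
  qed
  then have "eds_ideal \<subseteq> {h \<in> carrier H1. upper h \<in> zeta_kernel}"
    unfolding eds_ideal_def eds_relations_def[symmetric] by (intro H1.genideal_minimal ideal)
  then show ?thesis using assms by blast
qed

text \<open>
  Modulo the ideal \<open>p\<close> is \<open>upper h\<close>, and the value of \<open>upper h\<close> is \<open>h\<close> itself; so the value of \<open>p\<close>
  vanishes only if \<open>h\<close> lies in the ideal of extended double shuffle relations, which \<open>upper\<close> sends to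
  \<open>zeta_kernel\<close>.
\<close>

lemma zeta_of_vanishing_iff:
  assumes "p \<in> carrier QA"
  shows "zeta_of p \<in> eds_ideal \<longleftrightarrow> p \<in> zeta_kernel"
proof
  assume vanish: "zeta_of p \<in> eds_ideal"
  obtain h where h: "h \<in> carrier H1" "p \<simeq> upper h" using eqv_upper[OF assms] by blast
  have "zeta_of (p - upper h) \<in> eds_ideal" using h(2) by (intro zeta_of_zeta_kernel) (simp add: Z.eqv_def)
  then have "h \<in> eds_ideal" using eds.ideal_minus[OF vanish, of "zeta_of p - h"] by (simp add: zeta_of_upper)
  then have "upper h \<in> zeta_kernel" by (rule upper_eds)
  with h(2) show "p \<in> zeta_kernel" by (rule Z.ideal_eqv)
qed (rule zeta_of_zeta_kernel)

section \<open>Passage to the quotients\<close>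

lemma quotient_algebra_simps:
  "carrier (quotient_algebra A I) = carrier (A Quot I)"
  "x \<otimes>\<^bsub>quotient_algebra A I\<^esub> y = x \<otimes>\<^bsub>A Quot I\<^esub> y"
  "x \<oplus>\<^bsub>quotient_algebra A I\<^esub> y = x \<oplus>\<^bsub>A Quot I\<^esub> y"
  "\<one>\<^bsub>quotient_algebra A I\<^esub> = \<one>\<^bsub>A Quot I\<^esub>"
  "\<zero>\<^bsub>quotient_algebra A I\<^esub> = \<zero>\<^bsub>A Quot I\<^esub>"
  "c \<odot>\<^bsub>quotient_algebra A I\<^esub> C = (\<Union>x\<in>C. I +>\<^bsub>A\<^esub> (c \<odot>\<^bsub>A\<^esub> x))"
  by (simp_all add: quotient_algebra_def)

lemma ring_quotient_algebra:
  fixes A :: "('r, 'b) module"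
  assumes "ideal I A"
  shows "ring (quotient_algebra A I)"
proof -
  interpret Q: ring "A Quot I" by (rule ideal.quotient_is_ring[OF assms])
  show ?thesis
  proof (rule ringI)
    show "abelian_group (quotient_algebra A I)"
      by (rule abelian_groupI; unfold quotient_algebra_simps)
        (simp_all add: Q.a_ac Q.add.l_inv_ex)
    show "monoid (quotient_algebra A I)"
      by (rule monoidI; unfold quotient_algebra_simps) (simp_all add: Q.m_assoc)
  qed (unfold quotient_algebra_simps, simp_all add: Q.l_distr Q.r_distr)
qed

context stuffle_ideal
begin

interpretation I: ideal I R by (rule ideal)

lemma coset_eq: "I +>\<^bsub>R\<^esub> x = {y. y \<doteq> x}"
proof -
  have "y \<in> I +>\<^bsub>R\<^esub> x \<longleftrightarrow> y - x \<in> I" for y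
    by (auto simp: a_r_coset_def' stuffle_algebra_simps intro: bexI[of _ "y - x"])
  then show ?thesis by (auto simp: eqv_def)
qed

lemma coset_eq_iff: "I +>\<^bsub>R\<^esub> x = I +>\<^bsub>R\<^esub> y \<longleftrightarrow> x \<doteq> y"
  unfolding coset_eq using eqv_refl eqv_sym eqv_trans by blast

abbreviation "Q \<equiv> quotient_algebra R I"

lemma ring_Q: "ring Q"
  by (rule ring_quotient_algebra) (rule ideal)

lemma carrier_Q: "carrier Q = (\<lambda>x. I +>\<^bsub>R\<^esub> x) ` carrier R"
  by (auto simp: quotient_algebra_simps FactRing_def A_RCOSETS_def')

lemma Q_ops:
  "x \<in> carrier R \<Longrightarrow> y \<in> carrier R \<Longrightarrow> (I +>\<^bsub>R\<^esub> x) \<otimes>\<^bsub>Q\<^esub> (I +>\<^bsub>R\<^esub> y) = I +>\<^bsub>R\<^esub> (stuffle x y)"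
  "x \<in> carrier R \<Longrightarrow> y \<in> carrier R \<Longrightarrow> (I +>\<^bsub>R\<^esub> x) \<oplus>\<^bsub>Q\<^esub> (I +>\<^bsub>R\<^esub> y) = I +>\<^bsub>R\<^esub> (x + y)"
  "\<one>\<^bsub>Q\<^esub> = I +>\<^bsub>R\<^esub> (mon [])"
  "\<zero>\<^bsub>Q\<^esub> = I +>\<^bsub>R\<^esub> 0"
  using ring_hom_mult[OF I.rcos_ring_hom, of x y] ring_hom_add[OF I.rcos_ring_hom, of x y]
    ring_hom_one[OF I.rcos_ring_hom] I.a_rcos_zero[OF ideal ideal_zero]
  by (simp_all add: quotient_algebra_simps stuffle_algebra_simps FactRing_def)

lemma Q_smult: "c \<odot>\<^bsub>Q\<^esub> (I +>\<^bsub>R\<^esub> x) = I +>\<^bsub>R\<^esub> (scale c x)"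
proof -
  have "I +>\<^bsub>R\<^esub> (scale c y) = I +>\<^bsub>R\<^esub> (scale c x)" if "y \<in> I +>\<^bsub>R\<^esub> x" for y
    using that unfolding coset_eq_iff by (intro eqv_scale) (simp add: coset_eq)
  moreover have "x \<in> I +>\<^bsub>R\<^esub> x" by (simp add: coset_eq)
  ultimately show ?thesis unfolding quotient_algebra_simps stuffle_algebra_simps(6) by blast
qed

end

interpretation S: stuffle_ideal letters swap_ideal
proof (rule stuffle_ideal.intro)
  interpret QA: cring QA by (rule cring_QA)
  show "ideal swap_ideal (stuffle_algebra letters)"
    unfolding swap_ideal_def QA_def[symmetric] by (rule QA.genideal_ideal) (rule swap_gens_carrier)
  show "a + b \<in> letters" if "a \<in> letters" "b \<in> letters" for a b
    using that by (rule letters_add)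
qed

lemma swap_ideal_subset: "swap_ideal \<subseteq> zeta_kernel"
proof -
  interpret QA: cring QA by (rule cring_QA)
  have "ideal zeta_kernel QA" using Z.ideal unfolding QA_Z .
  moreover have "{swap w - w | w. w \<in> carrier QA} \<subseteq> zeta_kernel"
    using zeta_gens_subset unfolding zeta_gens_def by blast
  ultimately show ?thesis unfolding swap_ideal_def by (rule QA.genideal_minimal)
qed

lemma Gf_Q: "quotient_algebra QA swap_ideal = Gf_algebra"
  by (simp add: Gf_algebra_def)

lemma Zf_Q: "quotient_algebra H1 eds_ideal = Zf_algebra"
  by (simp add: Zf_algebra_def)

lemmas Gf_ops = S.Q_ops[unfolded Gf_Q QA_Z] S.Q_smult[unfolded Gf_Q QA_Z]

lemmas Zf_ops = eds.Q_ops[unfolded Zf_Q H1_eds] eds.Q_smult[unfolded Zf_Q H1_eds]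

text \<open>
  Well defined by \<open>proj_coset\<close>: the values of the elements of a coset are all congruent.
\<close>

definition proj :: "(word2 \<Rightarrow>\<^sub>0 rat) set \<Rightarrow> (nat list \<Rightarrow>\<^sub>0 rat) set"
  where "proj C = (\<Union>p\<in>C. eds_ideal +>\<^bsub>H1\<^esub> zeta_of p)"

lemma proj_coset: "proj (swap_ideal +>\<^bsub>QA\<^esub> p) = eds_ideal +>\<^bsub>H1\<^esub> zeta_of p"
proof -
  have "eds_ideal +>\<^bsub>H1\<^esub> zeta_of q = eds_ideal +>\<^bsub>H1\<^esub> zeta_of p" if "q \<in> swap_ideal +>\<^bsub>QA\<^esub> p" for q
  proof -
    have "q - p \<in> zeta_kernel"
      using that swap_ideal_subset unfolding S.coset_eq[unfolded QA_Z] S.eqv_def by blast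
    from zeta_of_zeta_kernel[OF this] show ?thesis
      unfolding eds.coset_eq_iff[unfolded H1_eds] by (simp add: eds.eqv_def)
  qed
  moreover have "p \<in> swap_ideal +>\<^bsub>QA\<^esub> p" by (simp add: S.coset_eq[unfolded QA_Z])
  ultimately show ?thesis unfolding proj_def by blast
qed

lemma carrier_Gf: "carrier Gf_algebra = (\<lambda>p. swap_ideal +>\<^bsub>QA\<^esub> p) ` carrier QA"
  using S.carrier_Q unfolding Gf_Q QA_Z .

lemma carrier_Zf: "carrier Zf_algebra = (\<lambda>p. eds_ideal +>\<^bsub>H1\<^esub> p) ` carrier H1"
  using eds.carrier_Q unfolding Zf_Q H1_eds .

lemma proj_ring_hom: "proj \<in> ring_hom Gf_algebra Zf_algebra"
proof (rule ring_hom_memI)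
  fix C assume "C \<in> carrier Gf_algebra"
  then obtain p where p: "p \<in> carrier QA" "C = swap_ideal +>\<^bsub>QA\<^esub> p" unfolding carrier_Gf by blast
  show "proj C \<in> carrier Zf_algebra"
    unfolding p(2) proj_coset carrier_Zf by (rule imageI) (rule zeta_of_carrier[OF p(1)])
  fix D assume "D \<in> carrier Gf_algebra"
  then obtain q where q: "q \<in> carrier QA" "D = swap_ideal +>\<^bsub>QA\<^esub> q" unfolding carrier_Gf by blast
  have "proj (C \<otimes>\<^bsub>Gf_algebra\<^esub> D) = eds_ideal +>\<^bsub>H1\<^esub> zeta_of (stuffle p q)"
    unfolding p(2) q(2) Gf_ops(1)[OF p(1) q(1)] by (rule proj_coset)
  also have "\<dots> = eds_ideal +>\<^bsub>H1\<^esub> stuffle (zeta_of p) (zeta_of q)"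
    unfolding eds.coset_eq_iff[unfolded H1_eds] by (rule zeta_of_stuffle[OF p(1) q(1)])
  also have "\<dots> = proj C \<otimes>\<^bsub>Zf_algebra\<^esub> proj D"
    unfolding p(2) q(2) proj_coset by (rule Zf_ops(1)[symmetric]) (rule zeta_of_carrier[OF p(1)], rule zeta_of_carrier[OF q(1)])
  finally show "proj (C \<otimes>\<^bsub>Gf_algebra\<^esub> D) = proj C \<otimes>\<^bsub>Zf_algebra\<^esub> proj D" .
  show "proj (C \<oplus>\<^bsub>Gf_algebra\<^esub> D) = proj C \<oplus>\<^bsub>Zf_algebra\<^esub> proj D"
    unfolding p(2) q(2) Gf_ops(2)[OF p(1) q(1)] proj_coset zeta_of_linear
    by (rule Zf_ops(2)[symmetric]) (rule zeta_of_carrier[OF p(1)], rule zeta_of_carrier[OF q(1)])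
next
  have "zeta_of (mon []) = mon []" using zeta_of_upper[of "mon []"] by simp
  then show "proj \<one>\<^bsub>Gf_algebra\<^esub> = \<one>\<^bsub>Zf_algebra\<^esub>"
    unfolding Gf_ops(3) proj_coset Zf_ops(3) by simp
qed

lemma proj_alg_hom: "proj \<in> alg_hom Gf_algebra Zf_algebra"
  unfolding alg_hom_def
proof (intro CollectI conjI allI ballI proj_ring_hom)
  fix c C assume "C \<in> carrier Gf_algebra"
  then obtain p where C: "C = swap_ideal +>\<^bsub>QA\<^esub> p" unfolding carrier_Gf by blast
  show "proj (c \<odot>\<^bsub>Gf_algebra\<^esub> C) = c \<odot>\<^bsub>Zf_algebra\<^esub> proj C"
    unfolding C Gf_ops(5) proj_coset Zf_ops(5) zeta_of_linear ..
qed

lemma proj_surj: "proj ` carrier Gf_algebra = carrier Zf_algebra"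
proof
  show "proj ` carrier Gf_algebra \<subseteq> carrier Zf_algebra"
    using ring_hom_closed[OF proj_ring_hom] by blast
  show "carrier Zf_algebra \<subseteq> proj ` carrier Gf_algebra"
  proof
    fix D assume "D \<in> carrier Zf_algebra"
    then obtain h where h: "h \<in> carrier H1" "D = eds_ideal +>\<^bsub>H1\<^esub> h" unfolding carrier_Zf by blast
    have "D = proj (swap_ideal +>\<^bsub>QA\<^esub> upper h)" unfolding proj_coset zeta_of_upper by (rule h(2))
    moreover have "swap_ideal +>\<^bsub>QA\<^esub> upper h \<in> carrier Gf_algebra"
      unfolding carrier_Gf by (rule imageI) (rule upper_carrier[OF h(1)])
    ultimately show "D \<in> proj ` carrier Gf_algebra" by blast
  qed
qed

lemma ring_Gf: "ring Gf_algebra"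
  using S.ring_Q unfolding QA_Z Gf_Q .

lemma ring_Zf: "ring Zf_algebra"
  using eds.ring_Q unfolding H1_eds Zf_Q .

lemma proj_kernel:
  "a_kernel Gf_algebra Zf_algebra proj = (\<lambda>p. swap_ideal +>\<^bsub>QA\<^esub> p) ` zeta_kernel"
proof -
  have "proj (swap_ideal +>\<^bsub>QA\<^esub> p) = \<zero>\<^bsub>Zf_algebra\<^esub> \<longleftrightarrow> p \<in> zeta_kernel" if "p \<in> carrier QA" for p
    unfolding proj_coset Zf_ops(4) eds.coset_eq_iff[unfolded H1_eds]
    using zeta_of_vanishing_iff[OF that] by (simp add: eds.eqv_def)
  moreover have "zeta_kernel \<subseteq> carrier QA" using Z.ideal_carrier unfolding QA_Z by blast
  ultimately show ?thesis unfolding a_kernel_def' carrier_Gf by blast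
qed

text \<open>
  An ideal of the quotient that contains the classes of all words not of zeta type pulls back to an
  ideal that contains \<open>zeta_gens\<close>, hence \<open>zeta_kernel\<close>.
\<close>

lemma coset_vimage_ideal:
  assumes "ideal K Gf_algebra"
  shows "ideal {p \<in> carrier QA. swap_ideal +>\<^bsub>QA\<^esub> p \<in> K} QA"
  unfolding QA_Z[symmetric]
proof (rule stuffle_idealI, unfold QA_Z)
  let ?V = "{p \<in> carrier QA. swap_ideal +>\<^bsub>QA\<^esub> p \<in> K}"
  interpret K: ideal K Gf_algebra by (rule assms)
  show "a + b \<in> letters" if "a \<in> letters" "b \<in> letters" for a b
    using that by (rule letters_add)
  show "0 \<in> ?V"
    using additive_subgroup.zero_closed[OF K.is_additive_subgroup] by (simp add: Gf_ops(4))
  show "p + q \<in> ?V" if "p \<in> ?V" "q \<in> ?V" for p q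
    using that additive_subgroup.a_closed[OF K.is_additive_subgroup, of "swap_ideal +>\<^bsub>QA\<^esub> p" "swap_ideal +>\<^bsub>QA\<^esub> q"]
    by (simp add: Gf_ops(2))
  show "stuffle q p \<in> ?V" if "p \<in> ?V" "q \<in> carrier QA" for p q
    using that K.I_l_closed[of "swap_ideal +>\<^bsub>QA\<^esub> p" "swap_ideal +>\<^bsub>QA\<^esub> q"]
    by (simp add: Gf_ops(1) carrier_Gf)
qed auto

lemma proj_kernel_generated:
  "a_kernel Gf_algebra Zf_algebra proj = Idl\<^bsub>Gf_algebra\<^esub> {Gf w | w. w \<in> lists letters \<and> \<not> zeta_type w}"
    (is "_ = Idl\<^bsub>_\<^esub> ?G")
proof
  interpret QA: cring QA by (rule cring_QA)
  interpret G: ring Gf_algebra by (rule ring_Gf)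
  interpret proj: ring_hom_ring Gf_algebra Zf_algebra proj
    by (rule ring_hom_ringI2[OF ring_Gf ring_Zf proj_ring_hom])
  have sub: "?G \<subseteq> a_kernel Gf_algebra Zf_algebra proj"
    unfolding proj_kernel Gf_def using mon_not_zeta_type by blast
  show "Idl\<^bsub>Gf_algebra\<^esub> ?G \<subseteq> a_kernel Gf_algebra Zf_algebra proj"
    by (rule G.genideal_minimal[OF proj.kernel_is_ideal sub])
  show "a_kernel Gf_algebra Zf_algebra proj \<subseteq> Idl\<^bsub>Gf_algebra\<^esub> ?G"
    unfolding genideal_def
  proof (intro Inter_greatest, clarify)
    fix C K assume C: "C \<in> a_kernel Gf_algebra Zf_algebra proj" and K: "ideal K Gf_algebra" "?G \<subseteq> K"
    let ?V = "{p \<in> carrier QA. swap_ideal +>\<^bsub>QA\<^esub> p \<in> K}"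
    have "zeta_gens \<subseteq> ?V"
    proof
      fix x assume x: "x \<in> zeta_gens"
      then consider p where "p \<in> carrier QA" "x = swap p - p" | w where "x = mon w" "w \<in> lists letters" "\<not> zeta_type w"
        unfolding zeta_gens_def by blast
      then have "swap_ideal +>\<^bsub>QA\<^esub> x \<in> K"
      proof cases
        case 1
        have "{swap w - w | w. w \<in> carrier QA} \<subseteq> swap_ideal"
          unfolding swap_ideal_def by (rule QA.genideal_self) (rule swap_gens_carrier)
        then have "x \<in> swap_ideal" using 1 by blast
        then have "swap_ideal +>\<^bsub>QA\<^esub> x = \<zero>\<^bsub>Gf_algebra\<^esub>"
          unfolding Gf_ops(4) S.coset_eq_iff[unfolded QA_Z] by (simp add: S.eqv_def)
        then show ?thesis
          using additive_subgroup.zero_closed[OF ideal.axioms(1)[OF K(1)]] by simp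
      next
        case 2
        then show ?thesis using K(2) unfolding Gf_def by blast
      qed
      then show "x \<in> ?V" using x zeta_gens_carrier by blast
    qed
    then have "zeta_kernel \<subseteq> ?V"
      unfolding zeta_kernel_def by (intro QA.genideal_minimal coset_vimage_ideal K)
    then show "C \<in> K" using C unfolding proj_kernel by blast
  qed
qed

theorem theorem1p1:
  shows "\<exists>\<pi>. \<pi> \<in> alg_hom Gf_algebra Zf_algebra
    \<and> \<pi> ` carrier Gf_algebra = carrier Zf_algebra
    \<and> (\<forall>ks. ks \<noteq> [] \<and> (\<forall>k\<in>set ks. 1 \<le> k) \<longrightarrow> \<pi> (Gf (map (\<lambda>k. (k, 0)) ks)) = zetaf ks)
    \<and> a_kernel Gf_algebra Zf_algebra \<pi> =
        Idl\<^bsub>Gf_algebra\<^esub> {Gf w | w. w \<in> lists letters \<and>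
          \<not> (\<exists>ds ks. (\<forall>k\<in>set ks. 1 \<le> k)
                \<and> w = map (\<lambda>d. (1, d)) ds @ map (\<lambda>k. (k, 0)) ks)}"
proof (intro exI[of _ proj] conjI allI impI)
  show "proj \<in> alg_hom Gf_algebra Zf_algebra" by (rule proj_alg_hom)
  show "proj ` carrier Gf_algebra = carrier Zf_algebra" by (rule proj_surj)
  show "proj (Gf (map (\<lambda>k. (k, 0)) ks)) = zetaf ks" for ks
    unfolding Gf_def zetaf_def proj_coset zeta_of_linear zeta_of_word_upper_word ..
  show "a_kernel Gf_algebra Zf_algebra proj =
        Idl\<^bsub>Gf_algebra\<^esub> {Gf w | w. w \<in> lists letters \<and>
          \<not> (\<exists>ds ks. (\<forall>k\<in>set ks. 1 \<le> k)
                \<and> w = map (\<lambda>d. (1, d)) ds @ map (\<lambda>k. (k, 0)) ks)}"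
    using proj_kernel_generated unfolding zeta_type_def .
qed

end
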